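(* Let $A$ be a local ring with maximal ideal $\mathfrak{m}$, $M$ a finitely generated $A$-module, $N$ a proper submodule of $M$, and $a_1,\ldots,a_r\in\mathfrak{m}$ an absolutely superficial $M$-sequence. Put $\mathfrak{q}=(a_1,\ldots,a_r)$. The following conditions are equivalent: (i) $a_1,\ldots,a_r$ are $N$-independent for $M$. (ii) For every permutation $\sigma$ of $\{1,\ldots,r\}$, $(a_{\sigma(1)},\ldots,a_{\sigma(r-1)})M:a_{\sigma(r)}\subseteq N$. Moreover, if $a_1,\ldots,a_r$ is a system of parameters of $M$, then (i) and (ii) are equivalent to each of the following two conditions: (iii) $l(\mathfrak{q}^nM/\mathfrak{q}^nN)=\binom{n+r-1}{r-1}\,l(M/N)<\infty$ for some $n\ge 1$; (iii$'$) $l(\mathfrak{q}^nM/\mathfrak{q}^nN)=\binom{n+r-1}{r-1}\,l(M/N)<\infty$ for all $n\ge 1$.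
   Context: Local rings are commutative and Noetherian; $l(\cdot)$ denotes length. For a submodule $N$ of a module $L$ and $a\in A$, $N:a=\{x\in L: ax\in N\}$. For $a_1,\ldots,a_r\in\mathfrak{m}$ ($r\ge1$) put $\mathfrak{q}_i=(a_1,\ldots,a_i)$, $\mathfrak{q}_0=0$, $\mathfrak{q}=\mathfrak{q}_r$. The sequence $a_1,\ldots,a_r$ is an absolutely superficial $M$-sequence if for each $i=1,\ldots,r$, with $M_{i-1}:=M/\mathfrak{q}_{i-1}M$, one has $(\mathfrak{q}^{n+1}M_{i-1}:a_i)\cap\mathfrak{q}M_{i-1}=\mathfrak{q}^nM_{i-1}$ for all sufficiently large $n$. Let $M[X]=M\otimes_AA[X_1,\ldots,X_r]$, its elements being regarded as polynomials with coefficients in $M$, which can be evaluated at $(a_1,\ldots,a_r)$ to give an element of $M$. For a proper submodule $N$ of $M$, the elements $a_1,\ldots,a_r$ are called $N$-independent for $M$ if every form (homogeneous polynomial) of $M[X]$ vanishing at $a_1,\ldots,a_r$ has all its coefficients in $N$.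
   Formalization: The equivalence of (i), (ii) with (iii), (iii′) is stated for r ≥ 2 or l(M/N) < ∞; for r = 1 with l(M/N) infinite it fails (A = M = k[[x]], N = 0, a_1 = x satisfies (i), (ii) but not (iii)). (iii) ⇔ (iii′) and (iii) ⇒ (i) are stated without this restriction. *)

theory Defs
  imports
    "HOL-Algebra.Algebra"
    "HOL-Library.Extended_Nat"
    "HOL-Library.Poly_Mapping"
    "HOL-Combinatorics.Permutations"
begin

section \<open>Local rings, submodules and quotient modules\<close>

locale noetherian_local_ring = noetherian_ring R + cring R for R (structure) +
  fixes m
  assumes maximal: "maximalideal m R"
    and unique_maximal: "maximalideal J R \<Longrightarrow> J = m"

definition gen_submodule ::
    "('a, 'c) ring_scheme \<Rightarrow> ('a, 'b, 'd) module_scheme \<Rightarrow> 'b set \<Rightarrow> 'b set"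
  where "gen_submodule A M S = \<Inter>{H. submodule H A M \<and> S \<subseteq> H}"

definition fin_gen_module ::
    "('a, 'c) ring_scheme \<Rightarrow> ('a, 'b, 'd) module_scheme \<Rightarrow> bool"
  where "fin_gen_module A M \<longleftrightarrow>
    module A M \<and> (\<exists>S \<subseteq> carrier M. finite S \<and> gen_submodule A M S = carrier M)"

text \<open>For an ideal \<open>I\<close> of \<open>A\<close> and a submodule \<open>N\<close> of \<open>M\<close>, this is the submodule \<open>I N\<close>.\<close>

definition ideal_smult ::
    "('a, 'c) ring_scheme \<Rightarrow> ('a, 'b, 'd) module_scheme \<Rightarrow> 'a set \<Rightarrow> 'b set \<Rightarrow> 'b set"
  where "ideal_smult A M I N = gen_submodule A M {x \<odot>\<^bsub>M\<^esub> y | x y. x \<in> I \<and> y \<in> N}"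

text \<open>The multiplicative fields \<open>mult\<close> and \<open>one\<close> of a module record carry no meaning for
  \<^locale>\<open>module\<close>; they are filled as in \<^const>\<open>FactRing\<close>.\<close>

definition FactModule :: "('a, 'b, 'd) module_scheme \<Rightarrow> 'b set \<Rightarrow> ('a, 'b set) module"
  where "FactModule M N =
    \<lparr>carrier = a_rcosets\<^bsub>M\<^esub> N, monoid.mult = rcoset_mult M N, one = N +>\<^bsub>M\<^esub> \<one>\<^bsub>M\<^esub>,
     ring.zero = N, add = set_add M,
     smult = (\<lambda>x C. \<Union>y\<in>C. N +>\<^bsub>M\<^esub> (x \<odot>\<^bsub>M\<^esub> y))\<rparr>"

text \<open>\<open>SubFactModule M P Q\<close> is \<open>P / Q\<close> for submodules \<open>Q \<subseteq> P\<close> of \<open>M\<close>.\<close>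

definition SubFactModule ::
    "('a, 'b, 'd) module_scheme \<Rightarrow> 'b set \<Rightarrow> 'b set \<Rightarrow> ('a, 'b set) module"
  where "SubFactModule M P Q = FactModule (M\<lparr>carrier := P\<rparr>) Q"

definition module_colon :: "('a, 'b, 'd) module_scheme \<Rightarrow> 'b set \<Rightarrow> 'a \<Rightarrow> 'b set"
  where "module_colon M N x = {y \<in> carrier M. x \<odot>\<^bsub>M\<^esub> y \<in> N}"

section \<open>Length, dimension, systems of parameters\<close>

definition module_length ::
    "('a, 'c) ring_scheme \<Rightarrow> ('a, 'b, 'd) module_scheme \<Rightarrow> enat"
  where "module_length A M =
    Sup {enat n | n. \<exists>C. (\<forall>i\<le>n. submodule (C i) A M) \<and> (\<forall>i<n. C i \<subset> C (Suc i))}"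

definition annihilator ::
    "('a, 'c) ring_scheme \<Rightarrow> ('a, 'b, 'd) module_scheme \<Rightarrow> 'a set"
  where "annihilator A M = {x \<in> carrier A. \<forall>y\<in>carrier M. x \<odot>\<^bsub>M\<^esub> y = \<zero>\<^bsub>M\<^esub>}"

text \<open>Krull dimension of \<open>A / Ann M\<close>; the zero module gets dimension \<open>0\<close>.\<close>

definition module_dim ::
    "('a, 'c) ring_scheme \<Rightarrow> ('a, 'b, 'd) module_scheme \<Rightarrow> enat"
  where "module_dim A M =
    Sup {enat n | n. \<exists>P. (\<forall>i\<le>n. primeideal (P i) A \<and> annihilator A M \<subseteq> P i) \<and>
                        (\<forall>i<n. P i \<subset> P (Suc i))}"

text \<open>Sequences \<open>a\<^sub>1, \<dots>, a\<^sub>r\<close> are functions on \<open>nat\<close> of which only the values on \<open>{1..r}\<close>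
  matter.  \<open>seq_ideal A a i\<close> is \<open>(a\<^sub>1, \<dots>, a\<^sub>i)\<close>, and the zero ideal for \<open>i = 0\<close>.\<close>

definition seq_ideal :: "('a, 'c) ring_scheme \<Rightarrow> (nat \<Rightarrow> 'a) \<Rightarrow> nat \<Rightarrow> 'a set"
  where "seq_ideal A a i = genideal A (a ` {1..i})"

text \<open>Powers of ideals are taken in the monoid \<^term>\<open>ideals_set A\<close>.\<close>

abbreviation ideal_power :: "('a, 'c) ring_scheme \<Rightarrow> 'a set \<Rightarrow> nat \<Rightarrow> 'a set"
  where "ideal_power A I n \<equiv> I [^]\<^bsub>ideals_set A\<^esub> n"

definition system_of_parameters ::
    "('a, 'c) ring_scheme \<Rightarrow> 'a set \<Rightarrow> ('a, 'b, 'd) module_scheme \<Rightarrow> nat \<Rightarrow> (nat \<Rightarrow> 'a) \<Rightarrow> bool"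
  where "system_of_parameters A m M r a \<longleftrightarrow>
    a \<in> {1..r} \<rightarrow> m \<and> module_dim A M = enat r \<and>
    module_length A (FactModule M (ideal_smult A M (seq_ideal A a r) (carrier M))) < \<infinity>"

section \<open>Absolutely superficial and independent sequences\<close>

definition absolutely_superficial ::
    "('a, 'c) ring_scheme \<Rightarrow> ('a, 'b, 'd) module_scheme \<Rightarrow> nat \<Rightarrow> (nat \<Rightarrow> 'a) \<Rightarrow> bool"
  where "absolutely_superficial A M r a \<longleftrightarrow>
    (\<forall>i\<in>{1..r}.
      let q = seq_ideal A a r;
          L = FactModule M (ideal_smult A M (seq_ideal A a (i - 1)) (carrier M))
      in \<forall>\<^sub>F n in sequentially.
           module_colon L (ideal_smult A L (ideal_power A q (n + 1)) (carrier L)) (a i)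
             \<inter> ideal_smult A L q (carrier L)
           = ideal_smult A L (ideal_power A q n) (carrier L))"

text \<open>An element of \<open>M[X\<^sub>1, \<dots>, X\<^sub>r]\<close> is given by its coefficients in \<open>M\<close>, indexed by
  exponent vectors \<open>u\<close> with finite support; \<open>u\<close> stands for the product of the
  \<open>X\<^sub>i\<close> to the power \<open>lookup u i\<close>.\<close>

definition module_polys ::
    "('a, 'b, 'd) module_scheme \<Rightarrow> nat \<Rightarrow> ((nat \<Rightarrow>\<^sub>0 nat) \<Rightarrow> 'b) set"
  where "module_polys M r =
    {F \<in> UNIV \<rightarrow> carrier M. finite {u. F u \<noteq> \<zero>\<^bsub>M\<^esub>} \<and>
       (\<forall>u. F u \<noteq> \<zero>\<^bsub>M\<^esub> \<longrightarrow> Poly_Mapping.keys u \<subseteq> {1..r})}"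

text \<open>The zero polynomial is homogeneous of every degree.\<close>

definition module_forms ::
    "('a, 'b, 'd) module_scheme \<Rightarrow> nat \<Rightarrow> ((nat \<Rightarrow>\<^sub>0 nat) \<Rightarrow> 'b) set"
  where "module_forms M r =
    {F \<in> module_polys M r. \<exists>d. \<forall>u. F u \<noteq> \<zero>\<^bsub>M\<^esub> \<longrightarrow> (\<Sum>i=1..r. Poly_Mapping.lookup u i) = d}"

definition module_poly_eval ::
    "('a, 'c) ring_scheme \<Rightarrow> ('a, 'b, 'd) module_scheme \<Rightarrow> nat \<Rightarrow> (nat \<Rightarrow> 'a) \<Rightarrow>
     ((nat \<Rightarrow>\<^sub>0 nat) \<Rightarrow> 'b) \<Rightarrow> 'b"
  where "module_poly_eval A M r a F =
    (\<Oplus>\<^bsub>M\<^esub>u\<in>{u. F u \<noteq> \<zero>\<^bsub>M\<^esub>}. (\<Otimes>\<^bsub>A\<^esub>i\<in>{1..r}. a i [^]\<^bsub>A\<^esub> Poly_Mapping.lookup u i) \<odot>\<^bsub>M\<^esub> F u)"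

definition independent_for ::
    "('a, 'c) ring_scheme \<Rightarrow> ('a, 'b, 'd) module_scheme \<Rightarrow> 'b set \<Rightarrow> nat \<Rightarrow> (nat \<Rightarrow> 'a) \<Rightarrow> bool"
  where "independent_for A M N r a \<longleftrightarrow>
    (\<forall>F\<in>module_forms M r. module_poly_eval A M r a F = \<zero>\<^bsub>M\<^esub> \<longrightarrow> (\<forall>u. F u \<in> N))"

definition colon_condition ::
    "('a, 'c) ring_scheme \<Rightarrow> ('a, 'b, 'd) module_scheme \<Rightarrow> 'b set \<Rightarrow> nat \<Rightarrow> (nat \<Rightarrow> 'a) \<Rightarrow> bool"
  where "colon_condition A M N r a \<longleftrightarrow>
    (\<forall>\<sigma>. \<sigma> permutes {1..r} \<longrightarrow>
      module_colon M (ideal_smult A M (seq_ideal A (a \<circ> \<sigma>) (r - 1)) (carrier M)) (a (\<sigma> r)) \<subseteq> N)"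

text \<open>For \<open>r = 1\<close> finiteness of \<open>l(M/N)\<close> is not implied by independence, even for a system of
  parameters: take \<open>A = M = k[[x]]\<close>, \<open>N = 0\<close>, \<open>a\<^sub>1 = x\<close>.  For \<open>r \<ge> 2\<close> it is, since the forms
  with coefficients \<open>a\<^sub>i y\<close>, \<open>- a\<^sub>j y\<close> at \<open>X\<^sub>j\<close>, \<open>X\<^sub>i\<close> vanish, so that \<open>\<qq> M \<subseteq> N\<close>.\<close>

definition length_condition ::
    "('a, 'c) ring_scheme \<Rightarrow> ('a, 'b, 'd) module_scheme \<Rightarrow> 'b set \<Rightarrow> nat \<Rightarrow> (nat \<Rightarrow> 'a) \<Rightarrow> nat \<Rightarrow> bool"
  where "length_condition A M N r a n \<longleftrightarrow>
    (let q = ideal_power A (seq_ideal A a r) n;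
         l = enat ((n + r - 1) choose (r - 1)) * module_length A (FactModule M N)
     in module_length A
          (SubFactModule M (ideal_smult A M q (carrier M)) (ideal_smult A M q N)) = l
        \<and> l < \<infinity>)"

end

theory Submission
  imports Defs
begin

text \<open>By Krull's intersection theorem an absolutely superficial sequence satisfies
  \<open>(\<qq>\<^sub>j M : a\<^sub>j\<^sub>+\<^sub>1) \<inter> \<qq> M = \<qq>\<^sub>j M\<close>, so \<open>\<qq>\<^sub>j M \<inter> \<qq>\<^sup>d M\<close> consists of the values of the forms of degree
  \<open>d\<close> in the ideal \<open>(X\<^sub>1, \<dots>, X\<^sub>j)\<close>.  As for d-sequences, the relations between forms are then
  controlled by the linear ones, and the coefficients of a linear relation range over the colon
  modules of condition (ii).  For the lengths, adjoin the multiples of the monomials of degree \<open>n\<close>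
  to \<open>\<qq>\<^sup>n N\<close> one at a time: the successive quotients of the resulting filtration of
  \<open>\<qq>\<^sup>n M / \<qq>\<^sup>n N\<close> are quotients of \<open>M / N\<close>, and all of them equal \<open>M / N\<close> exactly if every relation
  of degree \<open>n\<close> has its coefficients in \<open>N\<close>.\<close>

section \<open>Submodules and linear combinations\<close>

text \<open>The obstacle is that a_(j+1) can be cancelled modulo q_j M only on elements of qM, not
  on all of M. Values of forms of positive degree lie in qM, but the coefficients of a linear form
  need not; linear relations are therefore the irreducible input, and the inductions on the degree
  start at 1. Cancellation holds only for the given order of the sequence. The permutations in (ii)
  do not act there: they bring each coefficient of a linear relation in turn to the last place. All
  conditions are reduced to one predicate, \<open>relations_in N (exps r d)\<close>, for various d.
  A length equality in one degree n >= 1 speaks about degree n alone; but multiplying a linear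
  relation by X_1^(n-1) keeps its coefficients, so degree n settles degree 1, and from there every
  degree is reached. Finiteness of l(M/N) is what allows passing from equality of a sum of lengths
  to equality of each summand. For a system of parameters with r >= 2 it follows from linear
  independence, which forces qM into N.\<close>

context module
begin

lemma submodule_zero: "submodule H R M \<Longrightarrow> \<zero>\<^bsub>M\<^esub> \<in> H"
  using subgroup.one_closed[OF submodule.axioms(1)] by fastforce

lemma submodule_minus:
  assumes "submodule H R M" "x \<in> H" "y \<in> H"
  shows "x \<ominus>\<^bsub>M\<^esub> y \<in> H"
  using assms submoduleE(3,5)[OF assms(1)] by (simp add: a_minus_def)

lemma submodule_carrier: "submodule H R M \<Longrightarrow> x \<in> H \<Longrightarrow> x \<in> carrier M"
  using submoduleE(1) by blast

lemma submodule_finsum: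
  assumes "submodule H R M" "f \<in> U \<rightarrow> H"
  shows "(\<Oplus>\<^bsub>M\<^esub>u\<in>U. f u) \<in> H"
  using assms(2)
proof (induction U rule: infinite_finite_induct)
  case (infinite U)
  then show ?case by (simp add: submodule_zero[OF assms(1)])
next
  case empty
  then show ?case by (simp add: submodule_zero[OF assms(1)])
next
  case (insert u U)
  then have "f \<in> U \<rightarrow> carrier M" "f u \<in> carrier M"
    using submodule_carrier[OF assms(1)] by (auto simp: Pi_def)
  with insert show ?case
    using submoduleE(5)[OF assms(1)] by (simp add: M.finsum_insert Pi_def)
qed

lemma submodule_add_cancel:
  assumes "submodule H R M" "x \<in> carrier M" "y \<in> H" "x \<oplus>\<^bsub>M\<^esub> y \<in> H"
  shows "x \<in> H"
proof -
  have "x = (x \<oplus>\<^bsub>M\<^esub> y) \<ominus>\<^bsub>M\<^esub> y"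
    using assms submodule_carrier[OF assms(1)] by (simp add: a_minus_def M.a_assoc M.r_neg)
  then show ?thesis using submodule_minus[OF assms(1,4,3)] by simp
qed

lemma submodule_criterion:
  assumes "H \<subseteq> carrier M" "\<zero>\<^bsub>M\<^esub> \<in> H"
    and "\<And>x y. x \<in> H \<Longrightarrow> y \<in> H \<Longrightarrow> x \<oplus>\<^bsub>M\<^esub> y \<in> H"
    and "\<And>t x. t \<in> carrier R \<Longrightarrow> x \<in> H \<Longrightarrow> t \<odot>\<^bsub>M\<^esub> x \<in> H"
  shows "submodule H R M"
proof (rule submoduleI)
  fix x assume x: "x \<in> H"
  have "\<ominus>\<^bsub>M\<^esub> x = (\<ominus> \<one>) \<odot>\<^bsub>M\<^esub> x"
    using x assms(1) by (subst smult_l_minus) auto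
  then show "\<ominus>\<^bsub>M\<^esub> x \<in> H" using assms(4)[OF _ x] by simp
qed (use assms in auto)

lemma submodule_Int:
  assumes "submodule H R M" "submodule K R M"
  shows "submodule (H \<inter> K) R M"
  using assms
  by (intro submodule_criterion) (auto intro: submodule_zero submoduleE(4,5) submodule_carrier)

lemma zero_submodule: "submodule {\<zero>\<^bsub>M\<^esub>} R M"
  by (rule submodule_criterion) auto

lemma mem_set_add: "x \<in> H <+>\<^bsub>M\<^esub> K \<longleftrightarrow> (\<exists>h\<in>H. \<exists>k\<in>K. x = h \<oplus>\<^bsub>M\<^esub> k)"
  by (auto simp: set_add_def')

lemma submodule_set_add:
  assumes "submodule H R M" "submodule K R M"
  shows "submodule (H <+>\<^bsub>M\<^esub> K) R M"
proof (rule submodule_criterion)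
  note H = submoduleE[OF assms(1)] submodule_carrier[OF assms(1)]
  note K = submoduleE[OF assms(2)] submodule_carrier[OF assms(2)]
  show "H <+>\<^bsub>M\<^esub> K \<subseteq> carrier M" using H K by (auto simp: mem_set_add)
  have "\<zero>\<^bsub>M\<^esub> = \<zero>\<^bsub>M\<^esub> \<oplus>\<^bsub>M\<^esub> \<zero>\<^bsub>M\<^esub>" by simp
  then show "\<zero>\<^bsub>M\<^esub> \<in> H <+>\<^bsub>M\<^esub> K"
    using submodule_zero[OF assms(1)] submodule_zero[OF assms(2)] unfolding mem_set_add by blast
next
  note H = submoduleE[OF assms(1)] submodule_carrier[OF assms(1)]
  note K = submoduleE[OF assms(2)] submodule_carrier[OF assms(2)]
  fix x y assume "x \<in> H <+>\<^bsub>M\<^esub> K" "y \<in> H <+>\<^bsub>M\<^esub> K"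
  then obtain h k h' k' where *: "h \<in> H" "k \<in> K" "h' \<in> H" "k' \<in> K"
    "x = h \<oplus>\<^bsub>M\<^esub> k" "y = h' \<oplus>\<^bsub>M\<^esub> k'" by (auto simp: mem_set_add)
  then have "x \<oplus>\<^bsub>M\<^esub> y = (h \<oplus>\<^bsub>M\<^esub> h') \<oplus>\<^bsub>M\<^esub> (k \<oplus>\<^bsub>M\<^esub> k')"
    using H K by (simp add: M.a_ac)
  then show "x \<oplus>\<^bsub>M\<^esub> y \<in> H <+>\<^bsub>M\<^esub> K" using * H(5) K(5) unfolding mem_set_add by blast
next
  note H = submoduleE[OF assms(1)] submodule_carrier[OF assms(1)]
  note K = submoduleE[OF assms(2)] submodule_carrier[OF assms(2)]
  fix t x assume t: "t \<in> carrier R" and "x \<in> H <+>\<^bsub>M\<^esub> K"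
  then obtain h k where *: "h \<in> H" "k \<in> K" "x = h \<oplus>\<^bsub>M\<^esub> k" by (auto simp: mem_set_add)
  then have "t \<odot>\<^bsub>M\<^esub> x = t \<odot>\<^bsub>M\<^esub> h \<oplus>\<^bsub>M\<^esub> t \<odot>\<^bsub>M\<^esub> k" using t H K by (simp add: smult_r_distr)
  then show "t \<odot>\<^bsub>M\<^esub> x \<in> H <+>\<^bsub>M\<^esub> K" using * t H(4) K(4) unfolding mem_set_add by blast
qed

lemma set_add_upper1:
  assumes "submodule H R M" "submodule K R M"
  shows "H \<subseteq> H <+>\<^bsub>M\<^esub> K"
proof
  fix x assume x: "x \<in> H"
  then have "x = x \<oplus>\<^bsub>M\<^esub> \<zero>\<^bsub>M\<^esub>" using submodule_carrier[OF assms(1)] by simp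
  then show "x \<in> H <+>\<^bsub>M\<^esub> K" using x submodule_zero[OF assms(2)] unfolding mem_set_add by blast
qed

lemma set_add_upper2:
  assumes "submodule H R M" "submodule K R M"
  shows "K \<subseteq> H <+>\<^bsub>M\<^esub> K"
proof
  fix x assume x: "x \<in> K"
  then have "x = \<zero>\<^bsub>M\<^esub> \<oplus>\<^bsub>M\<^esub> x" using submodule_carrier[OF assms(2)] by simp
  then show "x \<in> H <+>\<^bsub>M\<^esub> K" using x submodule_zero[OF assms(1)] unfolding mem_set_add by blast
qed

lemma set_add_least:
  assumes "submodule L R M" "H \<subseteq> L" "K \<subseteq> L"
  shows "H <+>\<^bsub>M\<^esub> K \<subseteq> L"
  using assms(2,3) submoduleE(5)[OF assms(1)] by (auto simp: mem_set_add subset_iff)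

lemma set_add_mono: "H \<subseteq> H' \<Longrightarrow> K \<subseteq> K' \<Longrightarrow> H <+>\<^bsub>M\<^esub> K \<subseteq> H' <+>\<^bsub>M\<^esub> K'"
  unfolding subset_iff mem_set_add by blast

lemma submodule_scaled:
  assumes "t \<in> carrier R" "submodule K R M"
  shows "submodule ((\<lambda>x. t \<odot>\<^bsub>M\<^esub> x) ` K) R M"
proof -
  note K = submoduleE[OF assms(2)] submodule_carrier[OF assms(2)]
  show ?thesis
  proof (rule submodule_criterion)
    show "\<zero>\<^bsub>M\<^esub> \<in> (\<lambda>x. t \<odot>\<^bsub>M\<^esub> x) ` K"
      using assms submodule_zero[OF assms(2)] by (intro image_eqI[of _ _ "\<zero>\<^bsub>M\<^esub>"]) auto
    show "x \<oplus>\<^bsub>M\<^esub> y \<in> (\<lambda>x. t \<odot>\<^bsub>M\<^esub> x) ` K"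
      if xy: "x \<in> (\<lambda>x. t \<odot>\<^bsub>M\<^esub> x) ` K" "y \<in> (\<lambda>x. t \<odot>\<^bsub>M\<^esub> x) ` K" for x y
    proof -
      from xy obtain x' y' where *: "x' \<in> K" "x = t \<odot>\<^bsub>M\<^esub> x'" "y' \<in> K" "y = t \<odot>\<^bsub>M\<^esub> y'" by auto
      then have "x \<oplus>\<^bsub>M\<^esub> y = t \<odot>\<^bsub>M\<^esub> (x' \<oplus>\<^bsub>M\<^esub> y')" using assms K(6,7) by (simp add: smult_r_distr K)
      then show ?thesis using K(5)[OF *(1,3)] by (rule image_eqI)
    qed
    show "s \<odot>\<^bsub>M\<^esub> x \<in> (\<lambda>x. t \<odot>\<^bsub>M\<^esub> x) ` K"
      if s: "s \<in> carrier R" and x: "x \<in> (\<lambda>x. t \<odot>\<^bsub>M\<^esub> x) ` K" for s x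
    proof -
      from x obtain x' where *: "x' \<in> K" "x = t \<odot>\<^bsub>M\<^esub> x'" by auto
      then have "s \<odot>\<^bsub>M\<^esub> x = t \<odot>\<^bsub>M\<^esub> (s \<odot>\<^bsub>M\<^esub> x')"
        using assms K s by (simp add: smult_assoc1[symmetric] R.m_comm)
      then show ?thesis using K(4)[OF s *(1)] by (rule image_eqI)
    qed
  qed (use assms K in auto)
qed

lemma submodule_colon:
  assumes "submodule H R M" "t \<in> carrier R"
  shows "submodule (module_colon M H t) R M"
proof (rule submodule_criterion)
  show "t' \<odot>\<^bsub>M\<^esub> x \<in> module_colon M H t" if "t' \<in> carrier R" "x \<in> module_colon M H t" for t' x
  proof -
    have "t \<odot>\<^bsub>M\<^esub> (t' \<odot>\<^bsub>M\<^esub> x) = t' \<odot>\<^bsub>M\<^esub> (t \<odot>\<^bsub>M\<^esub> x)"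
      using that assms unfolding module_colon_def by (metis (no_types, lifting) mem_Collect_eq R.m_comm smult_assoc1)
    then show ?thesis using that assms submoduleE(4)[OF assms(1)] by (auto simp: module_colon_def)
  qed
qed (use assms submodule_zero[OF assms(1)] submoduleE[OF assms(1)] in
      \<open>auto simp: module_colon_def smult_r_distr\<close>)

lemma submodule_gen_submodule:
  assumes "S \<subseteq> carrier M"
  shows "submodule (gen_submodule R M S) R M"
proof (rule submodule_criterion)
  show "gen_submodule R M S \<subseteq> carrier M"
    using assms carrier_is_submodule unfolding gen_submodule_def by blast
qed (auto simp: gen_submodule_def submodule_zero submoduleE(4,5))

lemma gen_submodule_incl: "S \<subseteq> gen_submodule R M S"
  unfolding gen_submodule_def by blast

lemma gen_submodule_least: "submodule H R M \<Longrightarrow> S \<subseteq> H \<Longrightarrow> gen_submodule R M S \<subseteq> H"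
  unfolding gen_submodule_def by blast

lemma submodule_ideal_smult:
  assumes "I \<subseteq> carrier R" "P \<subseteq> carrier M"
  shows "submodule (ideal_smult R M I P) R M"
  unfolding ideal_smult_def using assms by (intro submodule_gen_submodule) auto

lemma ideal_smult_incl: "t \<in> I \<Longrightarrow> x \<in> P \<Longrightarrow> t \<odot>\<^bsub>M\<^esub> x \<in> ideal_smult R M I P"
  unfolding ideal_smult_def by (rule subsetD[OF gen_submodule_incl]) blast

lemma ideal_smult_least:
  "submodule H R M \<Longrightarrow> (\<And>t x. t \<in> I \<Longrightarrow> x \<in> P \<Longrightarrow> t \<odot>\<^bsub>M\<^esub> x \<in> H) \<Longrightarrow> ideal_smult R M I P \<subseteq> H"
  unfolding ideal_smult_def by (intro gen_submodule_least) auto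

end

text \<open>The ring elements \<open>c u\<close> are fixed and the module elements
  \<open>F u\<close> vary, as for a form with coefficients in a module evaluated at a point. In
  contrast to \<open>ideal_smult\<close>, membership hands out a coefficient family, which the
  arguments on relations need.\<close>

definition lin_combs ::
    "('a, 'c) ring_scheme \<Rightarrow> ('a, 'b, 'd) module_scheme \<Rightarrow> 'i set \<Rightarrow> ('i \<Rightarrow> 'a) \<Rightarrow> 'b set \<Rightarrow> 'b set"
  where "lin_combs A M U c P = {(\<Oplus>\<^bsub>M\<^esub>u\<in>U. c u \<odot>\<^bsub>M\<^esub> F u) | F. F \<in> U \<rightarrow> P}"

context module
begin

lemma lin_combsI: "F \<in> U \<rightarrow> P \<Longrightarrow> (\<Oplus>\<^bsub>M\<^esub>u\<in>U. c u \<odot>\<^bsub>M\<^esub> F u) \<in> lin_combs R M U c P"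
  unfolding lin_combs_def by blast

lemma lin_combsE:
  assumes "x \<in> lin_combs R M U c P"
  obtains F where "F \<in> U \<rightarrow> P" "x = (\<Oplus>\<^bsub>M\<^esub>u\<in>U. c u \<odot>\<^bsub>M\<^esub> F u)"
  using assms unfolding lin_combs_def by blast

lemma submodule_lin_combs:
  assumes "finite U" "c \<in> U \<rightarrow> carrier R" "submodule P R M"
  shows "submodule (lin_combs R M U c P) R M"
proof (rule submodule_criterion)
  note P = submoduleE[OF assms(3)] submodule_carrier[OF assms(3)]
  have summand: "(\<lambda>u. c u \<odot>\<^bsub>M\<^esub> F u) \<in> U \<rightarrow> carrier M" if "F \<in> U \<rightarrow> P" for F
    using that assms(2) P by (auto simp: Pi_def)
  show "lin_combs R M U c P \<subseteq> carrier M"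
    using summand by (auto simp: lin_combs_def intro!: M.finsum_closed)
  have "(\<Oplus>\<^bsub>M\<^esub>u\<in>U. c u \<odot>\<^bsub>M\<^esub> \<zero>\<^bsub>M\<^esub>) = \<zero>\<^bsub>M\<^esub>"
    using assms(2) by (intro M.add.finprod_one_eqI) (auto simp: Pi_iff)
  then show "\<zero>\<^bsub>M\<^esub> \<in> lin_combs R M U c P"
    using lin_combsI[of "\<lambda>_. \<zero>\<^bsub>M\<^esub>" U P c] submodule_zero[OF assms(3)] by auto
  show "x \<oplus>\<^bsub>M\<^esub> y \<in> lin_combs R M U c P"
    if "x \<in> lin_combs R M U c P" "y \<in> lin_combs R M U c P" for x y
  proof -
    from that obtain F G where F: "F \<in> U \<rightarrow> P" "x = (\<Oplus>\<^bsub>M\<^esub>u\<in>U. c u \<odot>\<^bsub>M\<^esub> F u)"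
      and G: "G \<in> U \<rightarrow> P" "y = (\<Oplus>\<^bsub>M\<^esub>u\<in>U. c u \<odot>\<^bsub>M\<^esub> G u)" by (elim lin_combsE) blast
    have "x \<oplus>\<^bsub>M\<^esub> y = (\<Oplus>\<^bsub>M\<^esub>u\<in>U. c u \<odot>\<^bsub>M\<^esub> F u \<oplus>\<^bsub>M\<^esub> c u \<odot>\<^bsub>M\<^esub> G u)"
      using F G summand by (simp add: M.finsum_addf)
    also have "\<dots> = (\<Oplus>\<^bsub>M\<^esub>u\<in>U. c u \<odot>\<^bsub>M\<^esub> (F u \<oplus>\<^bsub>M\<^esub> G u))"
      using F G P assms(2) by (intro M.finsum_cong') (auto simp: Pi_def smult_r_distr)
    finally show ?thesis using lin_combsI[of "\<lambda>u. F u \<oplus>\<^bsub>M\<^esub> G u" U P c] F G P(5) by (auto simp: Pi_def)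
  qed
  show "t \<odot>\<^bsub>M\<^esub> x \<in> lin_combs R M U c P"
    if t: "t \<in> carrier R" and "x \<in> lin_combs R M U c P" for t x
  proof -
    from that obtain F where F: "F \<in> U \<rightarrow> P" "x = (\<Oplus>\<^bsub>M\<^esub>u\<in>U. c u \<odot>\<^bsub>M\<^esub> F u)" by (elim lin_combsE) blast
    have "t \<odot>\<^bsub>M\<^esub> x = (\<Oplus>\<^bsub>M\<^esub>u\<in>U. t \<odot>\<^bsub>M\<^esub> (c u \<odot>\<^bsub>M\<^esub> F u))"
      unfolding F(2) using assms(1) t summand[OF F(1)] by (intro finsum_smult_ldistr) auto
    also have "\<dots> = (\<Oplus>\<^bsub>M\<^esub>u\<in>U. c u \<odot>\<^bsub>M\<^esub> (t \<odot>\<^bsub>M\<^esub> F u))"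
      using F P assms(2) t
      by (intro M.finsum_cong') (auto simp: Pi_def smult_assoc1[symmetric] R.m_comm)
    finally show ?thesis using lin_combsI[of "\<lambda>u. t \<odot>\<^bsub>M\<^esub> F u" U P c] F P(4) t by (auto simp: Pi_def)
  qed
qed

lemma lin_combs_least:
  assumes "submodule H R M" "\<And>u x. u \<in> U \<Longrightarrow> x \<in> P \<Longrightarrow> c u \<odot>\<^bsub>M\<^esub> x \<in> H"
  shows "lin_combs R M U c P \<subseteq> H"
proof
  fix x assume "x \<in> lin_combs R M U c P"
  then obtain F where "F \<in> U \<rightarrow> P" "x = (\<Oplus>\<^bsub>M\<^esub>u\<in>U. c u \<odot>\<^bsub>M\<^esub> F u)" by (rule lin_combsE)
  then show "x \<in> H" using assms by (auto intro!: submodule_finsum)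
qed

lemma finsum_extend:
  assumes "finite U" "V \<subseteq> U" "c \<in> U \<rightarrow> carrier R" "F \<in> V \<rightarrow> carrier M"
  shows "(\<Oplus>\<^bsub>M\<^esub>u\<in>U. c u \<odot>\<^bsub>M\<^esub> (if u \<in> V then F u else \<zero>\<^bsub>M\<^esub>)) = (\<Oplus>\<^bsub>M\<^esub>u\<in>V. c u \<odot>\<^bsub>M\<^esub> F u)"
  using assms
  by (intro M.add.finprod_mono_neutral_cong_right) (auto simp: Pi_iff intro!: smult_closed smult_r_null)

lemma lin_combs_gen:
  assumes "finite U" "c \<in> U \<rightarrow> carrier R" "submodule P R M" "u \<in> U" "x \<in> P"
  shows "c u \<odot>\<^bsub>M\<^esub> x \<in> lin_combs R M U c P"
proof -
  have "(\<Oplus>\<^bsub>M\<^esub>v\<in>{u}. c v \<odot>\<^bsub>M\<^esub> x) = c u \<odot>\<^bsub>M\<^esub> x"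
    using assms submodule_carrier[OF assms(3)]
    by (subst M.finsum_insert) (auto simp: Pi_iff intro!: M.r_zero smult_closed)
  then show ?thesis
    using finsum_extend[of U "{u}" c "\<lambda>_. x"] assms submodule_carrier[OF assms(3)]
      lin_combsI[of "\<lambda>v. if v \<in> {u} then x else \<zero>\<^bsub>M\<^esub>" U P c] submodule_zero[OF assms(3)]
    by auto
qed

lemma lin_combs_mono:
  assumes "finite U" "c \<in> U \<rightarrow> carrier R" "submodule P R M" "V \<subseteq> U"
  shows "lin_combs R M V c P \<subseteq> lin_combs R M U c P"
  using assms by (intro lin_combs_least submodule_lin_combs lin_combs_gen) auto

text \<open>Serves to extend a property of generators to the ideal they generate: once this
  multiplier ideal contains the generators, \<open>genideal_minimal\<close> makes it contain the
  whole ideal.\<close>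

lemma ideal_into_submodule:
  assumes "submodule H R M" "P \<subseteq> carrier M"
  shows "ideal {t \<in> carrier R. \<forall>x\<in>P. t \<odot>\<^bsub>M\<^esub> x \<in> H} R"
proof (rule idealI)
  note H = submoduleE[OF assms(1)] submodule_zero[OF assms(1)]
  show "ring R" by (rule R.ring_axioms)
  show "subgroup {t \<in> carrier R. \<forall>x\<in>P. t \<odot>\<^bsub>M\<^esub> x \<in> H} (add_monoid R)" (is "subgroup ?I _")
  proof (rule R.add.subgroupI)
    have "\<zero> \<in> ?I" using assms(2) H by (simp add: subset_iff)
    then show "?I \<noteq> {}" by blast
    show "\<ominus> t \<in> ?I" if "t \<in> ?I" for t
      using that assms(2) H by (simp add: smult_l_minus subset_iff)
    show "s \<oplus> t \<in> ?I" if "s \<in> ?I" "t \<in> ?I" for s t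
      using that assms(2) H by (simp add: smult_l_distr subset_iff)
  qed auto
  fix t x assume *: "t \<in> {t \<in> carrier R. \<forall>x\<in>P. t \<odot>\<^bsub>M\<^esub> x \<in> H}" "x \<in> carrier R"
  then show "x \<otimes> t \<in> {t \<in> carrier R. \<forall>x\<in>P. t \<odot>\<^bsub>M\<^esub> x \<in> H}"
    using assms(2) H by (auto simp: smult_assoc1 subset_iff)
  with * show "t \<otimes> x \<in> {t \<in> carrier R. \<forall>x\<in>P. t \<odot>\<^bsub>M\<^esub> x \<in> H}"
    by (auto simp: R.m_comm)
qed

text \<open>Ring coefficients of an element of the ideal are absorbed into \<open>P\<close>, so
  every element is a single sum over the generators.\<close>

lemma ideal_smult_genideal:
  assumes "finite U" "c \<in> U \<rightarrow> carrier R" "submodule P R M"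
  shows "ideal_smult R M (genideal R (c ` U)) P = lin_combs R M U c P"
proof
  note P = submoduleE(1)[OF assms(3)]
  have c: "c ` U \<subseteq> carrier R" using assms(2) by auto
  note sub = submodule_lin_combs[OF assms]
  have "genideal R (c ` U) \<subseteq> {t \<in> carrier R. \<forall>x\<in>P. t \<odot>\<^bsub>M\<^esub> x \<in> lin_combs R M U c P}"
    using c lin_combs_gen[OF assms] by (intro R.genideal_minimal ideal_into_submodule[OF sub P]) auto
  then show "ideal_smult R M (genideal R (c ` U)) P \<subseteq> lin_combs R M U c P"
    by (intro ideal_smult_least[OF sub]) auto
  have "genideal R (c ` U) \<subseteq> carrier R"
    using R.genideal_ideal[OF c] by (meson ideal.Icarr subsetI)
  then show "lin_combs R M U c P \<subseteq> ideal_smult R M (genideal R (c ` U)) P"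
    using R.genideal_self[OF c] P
    by (intro lin_combs_least submodule_ideal_smult ideal_smult_incl) auto
qed

end

section \<open>Noetherian modules\<close>

text \<open>The maximum condition is chosen because the proofs of Nakayama's lemma and of Krull's
  theorem below both begin with a submodule maximal for some property.\<close>

definition noetherian_module ::
    "('a, 'c) ring_scheme \<Rightarrow> ('a, 'b, 'd) module_scheme \<Rightarrow> bool"
  where "noetherian_module A M \<longleftrightarrow>
    (\<forall>F. F \<noteq> {} \<and> (\<forall>K\<in>F. submodule K A M) \<longrightarrow> (\<exists>K\<in>F. \<forall>K'\<in>F. K \<subseteq> K' \<longrightarrow> K' = K))"

lemma noetherian_moduleE:
  assumes "noetherian_module A M" "K \<in> F" "\<And>K. K \<in> F \<Longrightarrow> submodule K A M"
  obtains K where "K \<in> F" "\<And>K'. K' \<in> F \<Longrightarrow> K \<subseteq> K' \<Longrightarrow> K' = K"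
  using assms unfolding noetherian_module_def by (metis empty_iff)

lemma (in noetherian_ring) ideal_sequence_stable:
  assumes "\<And>n. ideal (J n) R" "\<And>n. J n \<subseteq> J (Suc n)"
  shows "\<exists>n0. \<forall>n\<ge>n0. J n = J n0"
proof -
  have mono: "J i \<subseteq> J j" if "i \<le> j" for i j
    using lift_Suc_mono_le[of J, OF assms(2) that] .
  have "subset.chain {I. ideal I R} (range J)"
    unfolding subset_chain_def
  proof (intro conjI ballI)
    show "I \<subseteq> I' \<or> I' \<subseteq> I" if "I \<in> range J" "I' \<in> range J" for I I'
    proof -
      from that obtain i j where "I = J i" "I' = J j" by auto
      then show ?thesis using mono[of i j] mono[of j i] nat_le_linear[of i j] by auto
    qed
  qed (use assms(1) in auto)
  then have "\<Union>(range J) \<in> range J" using ideal_chain_is_trivial[of "range J"] by blast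
  then obtain n0 where "\<Union>(range J) = J n0" by auto
  then show ?thesis using mono by blast
qed

text \<open>If 1 - t generated a proper ideal, an ideal maximal among those avoiding 1 and
  containing it would be a maximal ideal, hence equal to \<open>m\<close>; together with t in
  \<open>m\<close> this would put 1 into it. For Zorn's lemma, the union of a nonempty chain of
  ideals belongs to the chain because the ring is Noetherian.\<close>

lemma (in noetherian_local_ring) exists_one_minus_inverse:
  assumes "t \<in> m"
  obtains v where "v \<in> carrier R" "v \<otimes> (\<one> \<ominus> t) = \<one>"
proof -
  interpret m: maximalideal m R by (rule maximal)
  have t: "t \<in> carrier R" using assms m.a_Hcarr by simp
  have "\<one> \<in> PIdl (\<one> \<ominus> t)"
  proof (rule ccontr)
    assume no: "\<one> \<notin> PIdl (\<one> \<ominus> t)"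
    let ?S = "{J. ideal J R \<and> PIdl (\<one> \<ominus> t) \<subseteq> J \<and> \<one> \<notin> J}"
    have "\<exists>J\<in>?S. \<forall>J'\<in>?S. J \<subseteq> J' \<longrightarrow> J' = J"
    proof (rule subset_Zorn)
      fix C assume C: "subset.chain ?S C"
      show "\<exists>J\<in>?S. \<forall>J'\<in>C. J' \<subseteq> J"
      proof (cases "C = {}")
        case True
        have "PIdl (\<one> \<ominus> t) \<in> ?S" using no t by (simp add: cgenideal_ideal)
        then show ?thesis using True by blast
      next
        case False
        have "subset.chain {I. ideal I R} C" using C unfolding subset_chain_def by fast
        then have "\<Union>C \<in> C" using ideal_chain_is_trivial[OF False] by simp
        moreover have "C \<subseteq> ?S" using C by (simp add: subset_chain_def)
        ultimately have "\<Union>C \<in> ?S" by (rule rev_subsetD)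
        then show ?thesis by (rule bexI[rotated]) blast
      qed
    qed
    then obtain J where J: "J \<in> ?S" "\<And>J'. J' \<in> ?S \<Longrightarrow> J \<subseteq> J' \<Longrightarrow> J' = J" by auto
    then interpret J: ideal J R by simp
    have "maximalideal J R"
    proof (rule maximalidealI)
      show "carrier R \<noteq> J" using J(1) by auto
      fix J' assume *: "ideal J' R" "J \<subseteq> J'" "J' \<subseteq> carrier R"
      show "J' = J \<or> J' = carrier R"
      proof (cases "\<one> \<in> J'")
        case True
        then show ?thesis using ideal.one_imp_carrier[OF *(1)] by simp
      next
        case False
        then have "J' \<in> ?S" using * J(1) by blast
        then show ?thesis using J(2) * by blast
      qed
    qed (rule J.ideal_axioms)
    then have "J = m" by (rule unique_maximal)
    then have "\<one> \<ominus> t \<in> J" "t \<in> J" using J(1) cgenideal_self[of "\<one> \<ominus> t"] t assms by auto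
    then have "(\<one> \<ominus> t) \<oplus> t \<in> J" by (rule J.a_closed)
    moreover have "(\<one> \<ominus> t) \<oplus> t = \<one>" using t by algebra
    ultimately show False using J(1) by auto
  qed
  then show ?thesis using that unfolding cgenideal_def by force
qed

section \<open>Maximum condition for finitely generated modules and Nakayama's lemma\<close>

context module
begin

lemma submodule_cyclic:
  assumes "s \<in> carrier M"
  shows "submodule ((\<lambda>t. t \<odot>\<^bsub>M\<^esub> s) ` carrier R) R M"
proof (rule submodule_criterion)
  show "\<zero>\<^bsub>M\<^esub> \<in> (\<lambda>t. t \<odot>\<^bsub>M\<^esub> s) ` carrier R"
    using assms by (intro image_eqI[of _ _ \<zero>]) auto
qed (use assms in \<open>auto simp: smult_l_distr[symmetric] smult_assoc1[symmetric]\<close>)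

lemma gen_submodule_insert:
  assumes "S \<subseteq> carrier M" "s \<in> carrier M"
  shows "gen_submodule R M (insert s S) = (\<lambda>t. t \<odot>\<^bsub>M\<^esub> s) ` carrier R <+>\<^bsub>M\<^esub> gen_submodule R M S"
proof
  note sub = submodule_cyclic[OF assms(2)] submodule_gen_submodule[OF assms(1)]
  have "s \<in> (\<lambda>t. t \<odot>\<^bsub>M\<^esub> s) ` carrier R" using assms(2) by (intro image_eqI[of _ _ \<one>]) auto
  then show "gen_submodule R M (insert s S) \<subseteq> (\<lambda>t. t \<odot>\<^bsub>M\<^esub> s) ` carrier R <+>\<^bsub>M\<^esub> gen_submodule R M S"
    using set_add_upper1[OF sub] set_add_upper2[OF sub] gen_submodule_incl[of S]
    by (intro gen_submodule_least submodule_set_add sub) auto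
  have ins: "submodule (gen_submodule R M (insert s S)) R M"
    using assms by (intro submodule_gen_submodule) auto
  then show "(\<lambda>t. t \<odot>\<^bsub>M\<^esub> s) ` carrier R <+>\<^bsub>M\<^esub> gen_submodule R M S \<subseteq> gen_submodule R M (insert s S)"
    using gen_submodule_incl[of "insert s S"] submoduleE(4)[OF ins]
    by (intro set_add_least[OF ins] gen_submodule_least[OF ins]) auto
qed

text \<open>These are the coefficients at \<open>s\<close> of the elements of \<open>H\<close> that
  lie in R s + W, as the leading coefficients in Hilbert's basis theorem.\<close>

lemma leading_coefficients_ideal:
  assumes "submodule H R M" "submodule W R M" "s \<in> carrier M"
  shows "ideal {t \<in> carrier R. t \<odot>\<^bsub>M\<^esub> s \<in> H <+>\<^bsub>M\<^esub> W} R"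
  using ideal_into_submodule[OF submodule_set_add[OF assms(1,2)], of "{s}"] assms(3) by simp

text \<open>Induction on the generators in the manner of Hilbert's basis theorem: along an ascending
  sequence the intersection with R s + W is determined by the intersection with W and by the ideal
  of leading coefficients at s, and both become stationary.\<close>

lemma submodule_sequence_stable:
  assumes "noetherian_ring R" "finite S" "S \<subseteq> carrier M"
    and H: "\<And>n. submodule (H n) R M" "\<And>n. H n \<subseteq> H (Suc n)"
  shows "\<exists>n0. \<forall>n\<ge>n0. H n \<inter> gen_submodule R M S = H n0 \<inter> gen_submodule R M S"
  using assms(2,3)
proof (induction S)
  case empty
  have "gen_submodule R M {} \<subseteq> {\<zero>\<^bsub>M\<^esub>}" by (intro gen_submodule_least zero_submodule) auto
  then have "H n \<inter> gen_submodule R M {} = {\<zero>\<^bsub>M\<^esub>}" for n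
    using submodule_zero H(1) submodule_gen_submodule[of "{}"] by auto
  then show ?case by simp
next
  case (insert s S)
  have mono: "H i \<subseteq> H j" if "i \<le> j" for i j
    using lift_Suc_mono_le[of H, OF H(2) that] .
  let ?W = "gen_submodule R M S"
  have W: "submodule ?W R M" using insert.prems by (intro submodule_gen_submodule) auto
  have s: "s \<in> carrier M" using insert.prems by simp
  obtain n1 where n1: "\<And>n. n \<ge> n1 \<Longrightarrow> H n \<inter> ?W = H n1 \<inter> ?W"
    using insert.IH insert.prems by auto
  define J where "J n = {t \<in> carrier R. t \<odot>\<^bsub>M\<^esub> s \<in> H n <+>\<^bsub>M\<^esub> ?W}" for n
  have "J n \<subseteq> J (Suc n)" for n
    using H(2)[of n] unfolding J_def mem_set_add by blast
  then obtain n2 where n2: "\<And>n. n \<ge> n2 \<Longrightarrow> J n = J n2"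
    using noetherian_ring.ideal_sequence_stable[OF assms(1), of J]
      leading_coefficients_ideal[OF H(1) W s] unfolding J_def by blast
  define n0 where "n0 = max n1 n2"
  have "H n \<inter> gen_submodule R M (insert s S) \<subseteq> H n0" if n: "n \<ge> n0" for n
  proof
    fix h assume h: "h \<in> H n \<inter> gen_submodule R M (insert s S)"
    then obtain t w where tw: "t \<in> carrier R" "w \<in> ?W" "h = t \<odot>\<^bsub>M\<^esub> s \<oplus>\<^bsub>M\<^esub> w"
      using gen_submodule_insert[of S s] insert.prems by (auto simp: mem_set_add)
    note c = submodule_carrier[OF W] submodule_carrier[OF H(1)]
    have hc: "h \<in> carrier M" "w \<in> carrier M" using h tw c by auto
    have "t \<odot>\<^bsub>M\<^esub> s = h \<oplus>\<^bsub>M\<^esub> (\<ominus>\<^bsub>M\<^esub> w)" using tw s hc by (simp add: M.a_assoc M.r_neg)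
    then have "t \<in> J n" using tw h submoduleE(3)[OF W] unfolding J_def mem_set_add by blast
    then have "t \<in> J n0" using n2[of n] n2[of n0] n unfolding n0_def by auto
    then obtain h' w' where hw: "h' \<in> H n0" "w' \<in> ?W" "t \<odot>\<^bsub>M\<^esub> s = h' \<oplus>\<^bsub>M\<^esub> w'"
      unfolding J_def mem_set_add by auto
    have hc': "h' \<in> carrier M" "w' \<in> carrier M" using hw c by auto
    \<comment> \<open>An element h' of \<open>H n0\<close> with the same leading coefficient leaves
      the remainder w + w', which lies in W and in \<open>H n\<close>, hence in \<open>H n0\<close>
      by the choice of \<open>n1\<close>.\<close>
    have eq: "h = (w \<oplus>\<^bsub>M\<^esub> w') \<oplus>\<^bsub>M\<^esub> h'" using tw(3) hw(3) hc hc' by (simp add: M.a_ac)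
    have "w \<oplus>\<^bsub>M\<^esub> w' \<in> H n"
      using submodule_add_cancel[OF H(1)[of n], of "w \<oplus>\<^bsub>M\<^esub> w'" h'] hw(1) mono[OF n] h hc hc' eq by auto
    moreover have "w \<oplus>\<^bsub>M\<^esub> w' \<in> ?W" using tw hw submoduleE(5)[OF W] by blast
    ultimately have "w \<oplus>\<^bsub>M\<^esub> w' \<in> H n0"
      using n1[of n] n1[of n0] n unfolding n0_def by auto
    then show "h \<in> H n0" using eq hw(1) submoduleE(5)[OF H(1)] by simp
  qed
  then show ?case using mono by blast
qed

lemma noetherian_moduleI:
  assumes "noetherian_ring R" "fin_gen_module R M"
  shows "noetherian_module R M"
  unfolding noetherian_module_def
proof (intro allI impI, rule ccontr)
  fix F assume F: "F \<noteq> {} \<and> (\<forall>K\<in>F. submodule K R M)"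
    and no: "\<not> (\<exists>K\<in>F. \<forall>K'\<in>F. K \<subseteq> K' \<longrightarrow> K' = K)"
  have "\<exists>H. \<forall>n. H n \<in> F \<and> H n \<subset> H (Suc n)"
    by (rule dependent_nat_choice) (use F no in blast)+
  then obtain H where H: "\<And>n. H n \<in> F" "\<And>n. H n \<subset> H (Suc n)" by blast
  obtain S where S: "S \<subseteq> carrier M" "finite S" "gen_submodule R M S = carrier M"
    using assms(2) unfolding fin_gen_module_def by blast
  obtain n0 where n0: "H n \<inter> carrier M = H n0 \<inter> carrier M" if "n \<ge> n0" for n
    using submodule_sequence_stable[OF assms(1) S(2,1), of H] H F S(3) by (metis psubset_imp_subset)
  have "H n \<subseteq> carrier M" for n using H F submoduleE(1) by blast
  then have "H (Suc n0) = H n0" using n0[of "Suc n0"] by (metis Int_absorb2 le_SucI order_refl)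
  then show False using H(2)[of n0] by simp
qed

text \<open>Choose P' maximal among the proper submodules of K containing P. Then K/P' is simple and
  killed by \<open>m\<close>, so mK + P stays inside P', which contradicts the covering of K. The
  maximum condition replaces a choice of generators of K.\<close>

lemma nakayama:
  assumes local: "noetherian_local_ring R m" and noeth: "noetherian_module R M"
    and P: "submodule P R M" and K: "submodule K R M"
    and PK: "P \<subseteq> K" and gen: "K \<subseteq> ideal_smult R M m K <+>\<^bsub>M\<^esub> P"
  shows "K = P"
proof (rule ccontr)
  assume ne: "K \<noteq> P"
  interpret L: noetherian_local_ring R m by (rule local)
  interpret m: maximalideal m R by (rule L.maximal)
  let ?F = "{P'. submodule P' R M \<and> P \<subseteq> P' \<and> P' \<subset> K}"
  obtain P' where P': "P' \<in> ?F" "\<And>Q. Q \<in> ?F \<Longrightarrow> P' \<subseteq> Q \<Longrightarrow> Q = P'"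
    by (rule noetherian_moduleE[OF noeth, of P ?F]) (use ne P PK in auto)
  then have sP': "submodule P' R M" by simp
  have "t \<odot>\<^bsub>M\<^esub> y \<in> P'" if t: "t \<in> m" and y: "y \<in> K" for t y
  proof (rule ccontr)
    assume no: "t \<odot>\<^bsub>M\<^esub> y \<notin> P'"
    have tc: "t \<in> carrier R" using t m.a_Hcarr by simp
    have yc: "y \<in> carrier M" using y submodule_carrier[OF K] by simp
    let ?C = "(\<lambda>b. b \<odot>\<^bsub>M\<^esub> (t \<odot>\<^bsub>M\<^esub> y)) ` carrier R"
    have sC: "submodule ?C R M" using tc yc by (intro submodule_cyclic) auto
    have tyC: "t \<odot>\<^bsub>M\<^esub> y \<in> ?C" using tc yc by (intro image_eqI[of _ _ \<one>]) auto
    have "?C \<subseteq> K" using submoduleE(4)[OF K] tc y by auto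
    then have "P' <+>\<^bsub>M\<^esub> ?C \<subseteq> K" using P'(1) by (intro set_add_least[OF K]) auto
    moreover have "P' <+>\<^bsub>M\<^esub> ?C \<noteq> P'" using set_add_upper2[OF sP' sC] tyC no by blast
    ultimately have "P' <+>\<^bsub>M\<^esub> ?C = K"
      using P'(2)[of "P' <+>\<^bsub>M\<^esub> ?C"] P'(1) submodule_set_add[OF sP' sC] set_add_upper1[OF sP' sC] by blast
    \<comment> \<open>Since t y was assumed outside P', it generates K modulo P'. Expressing y
      itself in this way gives (1 - b t) y in P', and 1 - b t is a unit.\<close>
    then obtain p b where pb: "p \<in> P'" "b \<in> carrier R" "y = p \<oplus>\<^bsub>M\<^esub> b \<odot>\<^bsub>M\<^esub> (t \<odot>\<^bsub>M\<^esub> y)"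
      using y by (auto simp: mem_set_add)
    have pc: "p \<in> carrier M" using pb(1) submodule_carrier[OF sP'] by simp
    have "(\<one> \<ominus> b \<otimes> t) \<odot>\<^bsub>M\<^esub> y = y \<ominus>\<^bsub>M\<^esub> b \<odot>\<^bsub>M\<^esub> (t \<odot>\<^bsub>M\<^esub> y)"
      using pb(2) tc yc by (simp add: a_minus_def smult_l_distr smult_l_minus smult_assoc1)
    also have "\<dots> = p"
    proof -
      have "b \<odot>\<^bsub>M\<^esub> (t \<odot>\<^bsub>M\<^esub> y) \<in> carrier M" using pb tc yc by simp
      then show ?thesis using pb(3) pc
        by (metis M.add.inv_solve_right a_minus_def yc)
    qed
    finally have *: "(\<one> \<ominus> b \<otimes> t) \<odot>\<^bsub>M\<^esub> y \<in> P'" using pb(1) by simp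
    have "b \<otimes> t \<in> m" using t pb(2) m.I_l_closed by simp
    then obtain v where v: "v \<in> carrier R" "v \<otimes> (\<one> \<ominus> b \<otimes> t) = \<one>"
      by (rule L.exists_one_minus_inverse)
    have "y = (v \<otimes> (\<one> \<ominus> b \<otimes> t)) \<odot>\<^bsub>M\<^esub> y" using v yc by simp
    also have "\<dots> = v \<odot>\<^bsub>M\<^esub> ((\<one> \<ominus> b \<otimes> t) \<odot>\<^bsub>M\<^esub> y)" using v(1) pb(2) tc yc by (intro smult_assoc1) auto
    finally have "y \<in> P'" using * v(1) submoduleE(4)[OF sP'] by metis
    then show False using no tc submoduleE(4)[OF sP'] by blast
  qed
  then have "ideal_smult R M m K <+>\<^bsub>M\<^esub> P \<subseteq> P'"
    using P'(1) by (intro set_add_least[OF sP'] ideal_smult_least[OF sP']) auto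
  then show False using gen P'(1) by blast
qed

end

section \<open>Exponent vectors and powers of an ideal\<close>

definition exps :: "nat \<Rightarrow> nat \<Rightarrow> (nat \<Rightarrow>\<^sub>0 nat) set"
  where "exps r d = {u. Poly_Mapping.keys u \<subseteq> {1..r} \<and> (\<Sum>i=1..r. Poly_Mapping.lookup u i) = d}"

abbreviation unit_exp :: "nat \<Rightarrow> (nat \<Rightarrow>\<^sub>0 nat)"
  where "unit_exp i \<equiv> Poly_Mapping.single i (Suc 0)"

definition monom_val :: "('a, 'c) ring_scheme \<Rightarrow> nat \<Rightarrow> (nat \<Rightarrow> 'a) \<Rightarrow> (nat \<Rightarrow>\<^sub>0 nat) \<Rightarrow> 'a"
  where "monom_val A r a u = (\<Otimes>\<^bsub>A\<^esub>i\<in>{1..r}. a i [^]\<^bsub>A\<^esub> Poly_Mapping.lookup u i)"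

text \<open>Transfers finiteness and the stars-and-bars count from lists with prescribed length and
  sum to exponent vectors. Positions of a list start at 0 and variables at 1, whence the
  \<open>Suc i\<close>.\<close>

lemma bij_betw_exps_lists:
  "bij_betw (\<lambda>u. map (\<lambda>i. Poly_Mapping.lookup u (Suc i)) [0..<r]) (exps r d)
     {l. length l = r \<and> sum_list l = d}"
  unfolding bij_betw_def
proof
  let ?f = "\<lambda>u. map (\<lambda>i. Poly_Mapping.lookup u (Suc i)) [0..<r]"
  have sum: "(\<Sum>i=1..r. g i) = (\<Sum>i<r. g (Suc i))" for g :: "nat \<Rightarrow> nat"
    by (simp add: sum.shift_bounds_cl_Suc_ivl atLeast0AtMost[symmetric] lessThan_atLeast0
        sum.atLeast1_atMost_eq)
  show "inj_on ?f (exps r d)"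
  proof (rule inj_onI)
    fix u v assume uv: "u \<in> exps r d" "v \<in> exps r d" "?f u = ?f v"
    show "u = v"
    proof (rule poly_mapping_eqI)
      fix k
      show "Poly_Mapping.lookup u k = Poly_Mapping.lookup v k"
      proof (cases "k \<in> {1..r}")
        case True
        then obtain i where "k = Suc i" "i < r" by (cases k) auto
        then show ?thesis using arg_cong[OF uv(3), of "\<lambda>l. l ! i"] by simp
      next
        case False
        then have "k \<notin> Poly_Mapping.keys u" "k \<notin> Poly_Mapping.keys v"
          using uv by (auto simp: exps_def)
        then show ?thesis by (simp add: in_keys_iff)
      qed
    qed
  qed
  show "?f ` exps r d = {l. length l = r \<and> sum_list l = d}"
  proof (intro equalityI subsetI)
    fix l assume "l \<in> ?f ` exps r d"
    then show "l \<in> {l. length l = r \<and> sum_list l = d}"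
      by (auto simp: exps_def sum[unfolded One_nat_def] sum_list_sum_nth lessThan_atLeast0)
  next
    fix l assume l: "l \<in> {l. length l = r \<and> sum_list l = d}"
    define g where "g k = (if k \<in> {1..r} then l ! (k - 1) else 0)" for k
    have fin: "finite {k. g k \<noteq> 0}" by (rule finite_subset[of _ "{1..r}"]) (auto simp: g_def)
    define u where "u = Abs_poly_mapping g"
    have look: "Poly_Mapping.lookup u = g" unfolding u_def using fin by simp
    have "?f u = l" using l by (intro nth_equalityI) (auto simp: look g_def)
    moreover have "u \<in> exps r d"
      using l by (auto simp: exps_def look in_keys_iff sum[unfolded One_nat_def] g_def sum_list_sum_nth
          lessThan_atLeast0 split: if_splits)
    ultimately show "l \<in> ?f ` exps r d" by blast
  qed
qed

lemma finite_exps: "finite (exps r d)"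
proof -
  have "finite {l :: nat list. length l = r \<and> sum_list l = d}"
  proof (rule finite_subset)
    show "{l. length l = r \<and> sum_list l = d} \<subseteq> {l. set l \<subseteq> {..d} \<and> length l = r}"
      using member_le_sum_list by auto
  qed (simp add: finite_lists_length_eq)
  then show ?thesis using bij_betw_finite[OF bij_betw_exps_lists] by blast
qed

text \<open>Stars and bars counts with \<open>choose d\<close>; symmetry of the binomial gives the
  form used in the length formula. For r = 0 and d > 0 truncated subtraction would give 1 on the
  right and 0 on the left.\<close>

lemma card_exps:
  assumes "1 \<le> r"
  shows "card (exps r d) = (d + r - 1) choose (r - 1)"
proof -
  have "card (exps r d) = (d + r - 1) choose d"
    using bij_betw_same_card[OF bij_betw_exps_lists, of r d] card_length_sum_list[of r d] by simp
  also have "\<dots> = (d + r - 1) choose (r - 1)"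
    using assms binomial_symmetric[of d "d + r - 1"] by simp
  finally show ?thesis .
qed

lemma exps_shift:
  assumes "i \<in> {1..r}"
  shows "unit_exp i + u \<in> exps r (Suc d) \<longleftrightarrow> u \<in> exps r d"
proof -
  have "(\<Sum>k=1..r. Poly_Mapping.lookup (unit_exp i + u) k) =
      (\<Sum>k=1..r. if k = i then 1 else 0) + (\<Sum>k=1..r. Poly_Mapping.lookup u k)"
    by (subst sum.distrib[symmetric], rule sum.cong) (auto simp: lookup_add lookup_single when_def)
  also have "(\<Sum>k=1..r. if k = i then 1 else 0 :: nat) = 1" using assms by simp
  finally have "(\<Sum>k=1..r. Poly_Mapping.lookup (unit_exp i + u) k) =
      Suc (\<Sum>k=1..r. Poly_Mapping.lookup u k)" by simp
  moreover have "Poly_Mapping.keys (unit_exp i + u) = insert i (Poly_Mapping.keys u)"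
    by (auto simp: in_keys_iff lookup_add lookup_single when_def split: if_splits)
  ultimately show ?thesis using assms by (auto simp: exps_def)
qed

lemma exp_decompose:
  assumes "0 < Poly_Mapping.lookup u i"
  obtains v where "u = unit_exp i + v"
proof
  show "u = unit_exp i + (u - unit_exp i)"
    using assms by (intro poly_mapping_eqI) (auto simp: lookup_add lookup_minus lookup_single when_def)
qed

lemma lookup_shift:
  "Poly_Mapping.lookup (unit_exp i + v) k = (if k = i then Suc (Poly_Mapping.lookup v k) else Poly_Mapping.lookup v k)"
  by (simp add: lookup_add lookup_single when_def)

lemma exps_0: "exps r 0 = {0}"
proof (intro equalityI subsetI)
  fix u assume "u \<in> exps r 0"
  then have "Poly_Mapping.keys u \<subseteq> {1..r}" "\<forall>i\<in>{1..r}. Poly_Mapping.lookup u i = 0"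
    by (auto simp: exps_def)
  then have "Poly_Mapping.lookup u k = 0" for k by (metis in_keys_iff subsetD)
  then show "u \<in> {0}" by (simp add: poly_mapping_eqI)
qed (simp add: exps_def)

lemma exps_Suc_cases:
  assumes "u \<in> exps r (Suc d)"
  obtains i v where "i \<in> {1..r}" "v \<in> exps r d" "u = unit_exp i + v"
proof -
  have "\<exists>i\<in>{1..r}. 0 < Poly_Mapping.lookup u i"
    using assms unfolding exps_def by (metis (mono_tags, lifting) gr0I mem_Collect_eq nat.distinct(1) sum.neutral)
  then obtain i v where "i \<in> {1..r}" "u = unit_exp i + v" by (metis exp_decompose)
  then show ?thesis using that assms exps_shift by blast
qed

lemma exps_1: "exps r (Suc 0) = unit_exp ` {1..r}"
proof (intro equalityI subsetI)
  fix u assume "u \<in> exps r (Suc 0)"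
  then obtain i v where "i \<in> {1..r}" "v \<in> exps r 0" "u = unit_exp i + v"
    by (rule exps_Suc_cases)
  then show "u \<in> unit_exp ` {1..r}" by (simp add: exps_0)
next
  fix u assume "u \<in> unit_exp ` {1..r}"
  then obtain i where "i \<in> {1..r}" "u = unit_exp i + 0" by auto
  moreover have "0 \<in> exps r 0" by (simp add: exps_0)
  ultimately show "u \<in> exps r (Suc 0)" using exps_shift[of i r 0 0] by simp
qed

section \<open>Values of monomials as generators of the powers of q\<close>

context cring
begin

lemma monom_val_closed:
  assumes "a \<in> {1..r} \<rightarrow> carrier R"
  shows "monom_val R r a u \<in> carrier R"
  unfolding monom_val_def using assms by (intro finprod_closed) (auto simp: Pi_iff)

lemma monom_val_0: "monom_val R r a 0 = \<one>"
  unfolding monom_val_def by (rule finprod_one_eqI) simp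

lemma monom_val_shift:
  assumes "a \<in> {1..r} \<rightarrow> carrier R" "i \<in> {1..r}"
  shows "monom_val R r a (unit_exp i + u) = a i \<otimes> monom_val R r a u"
proof -
  have "monom_val R r a (unit_exp i + u) =
      (\<Otimes>k\<in>{1..r}. (if i = k then a k else \<one>) \<otimes> a k [^] Poly_Mapping.lookup u k)"
    unfolding monom_val_def
  proof (rule finprod_cong')
    fix k assume k: "k \<in> {1..r}"
    then have "a k \<in> carrier R" using assms(1) by auto
    then show "a k [^] Poly_Mapping.lookup (unit_exp i + u) k =
        (if i = k then a k else \<one>) \<otimes> a k [^] Poly_Mapping.lookup u k"
      by (auto simp: lookup_shift m_comm)
  qed (use assms in \<open>auto simp: Pi_iff\<close>)
  also have "\<dots> = (\<Otimes>k\<in>{1..r}. if i = k then a k else \<one>) \<otimes> monom_val R r a u"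
    unfolding monom_val_def using assms by (intro finprod_multf) (auto simp: Pi_iff)
  also have "(\<Otimes>k\<in>{1..r}. if i = k then a k else \<one>) = a i"
    using assms by (intro finprod_singleton) auto
  finally show ?thesis .
qed

lemma genideal_carrier: "S \<subseteq> carrier R \<Longrightarrow> genideal R S \<subseteq> carrier R"
  using genideal_ideal ideal.Icarr by (metis subsetI)

lemma ideal_multipliers:
  assumes "ideal J R" "B \<subseteq> carrier R"
  shows "ideal {s \<in> carrier R. \<forall>b\<in>B. s \<otimes> b \<in> J} R"
proof (rule idealI)
  interpret J: ideal J R by (rule assms(1))
  let ?I = "{s \<in> carrier R. \<forall>b\<in>B. s \<otimes> b \<in> J}"
  show "ring R" by (rule ring_axioms)
  show "subgroup ?I (add_monoid R)"
  proof (rule add.subgroupI)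
    have "\<zero> \<in> ?I" using assms(2) by (auto simp: subset_iff)
    then show "?I \<noteq> {}" by blast
    show "\<ominus> t \<in> ?I" if "t \<in> ?I" for t
      using that assms(2) by (auto simp: l_minus subset_iff)
    show "s \<oplus> t \<in> ?I" if "s \<in> ?I" "t \<in> ?I" for s t
      using that assms(2) by (auto simp: l_distr subset_iff)
  qed auto
  fix t x assume *: "t \<in> ?I" "x \<in> carrier R"
  then show "x \<otimes> t \<in> ?I"
    using assms(2) J.I_l_closed[OF _ *(2)] by (simp add: m_assoc subset_iff)
  with * show "t \<otimes> x \<in> ?I" by (auto simp: m_comm)
qed

text \<open>\<open>genideal_minimal\<close> is applied to one factor at a time: a fixed generator in
  S multiplies all of the ideal of T into the target, and then each element of that ideal does the
  same for the ideal of S.\<close>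

lemma ideal_prod_genideal:
  assumes "S \<subseteq> carrier R" "T \<subseteq> carrier R"
  shows "ideal_prod R (genideal R S) (genideal R T) = genideal R {s \<otimes> t | s t. s \<in> S \<and> t \<in> T}"
proof
  let ?J = "genideal R {s \<otimes> t | s t. s \<in> S \<and> t \<in> T}"
  have st: "{s \<otimes> t | s t. s \<in> S \<and> t \<in> T} \<subseteq> carrier R" using assms by auto
  interpret J: ideal ?J R by (rule genideal_ideal[OF st])
  have T: "genideal R T \<subseteq> {t \<in> carrier R. \<forall>s\<in>S. t \<otimes> s \<in> ?J}"
  proof (intro genideal_minimal ideal_multipliers J.ideal_axioms assms subsetI CollectI conjI ballI)
    fix t s assume ts: "t \<in> T" "s \<in> S"
    then have "s \<otimes> t \<in> ?J" by (intro subsetD[OF genideal_self[OF st]]) blast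
    moreover have "t \<otimes> s = s \<otimes> t" using ts assms by (intro m_comm) auto
    ultimately show "t \<otimes> s \<in> ?J" by simp
  qed (use assms in auto)
  have "genideal R S \<subseteq> {s \<in> carrier R. \<forall>t\<in>genideal R T. s \<otimes> t \<in> ?J}"
  proof (intro genideal_minimal ideal_multipliers J.ideal_axioms genideal_carrier assms
      oneideal subsetI CollectI conjI ballI)
    fix s t assume st: "s \<in> S" "t \<in> genideal R T"
    then have "t \<otimes> s \<in> ?J" using T by blast
    moreover have "s \<otimes> t = t \<otimes> s" using st assms genideal_carrier[OF assms(2)] by (intro m_comm) auto
    ultimately show "s \<otimes> t \<in> ?J" by simp
  qed (use assms in auto)
  then have *: "s \<otimes> t \<in> ?J" if "s \<in> genideal R S" "t \<in> genideal R T" for s t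
    using that by blast
  show "ideal_prod R (genideal R S) (genideal R T) \<subseteq> ?J"
  proof
    fix x assume "x \<in> ideal_prod R (genideal R S) (genideal R T)"
    then show "x \<in> ?J" by (induction rule: ideal_prod.induct) (auto intro: *)
  qed
  show "?J \<subseteq> ideal_prod R (genideal R S) (genideal R T)"
    using genideal_self[OF assms(1)] genideal_self[OF assms(2)]
    by (intro genideal_minimal ideal_prod_is_ideal genideal_ideal assms)
       (auto intro: ideal_prod.prod)
qed

text \<open>Each monomial of degree n + 1 is some a_i times one of degree n. In degree 0 the only
  monomial has value 1, matching the zeroth power, which is the unit ideal.\<close>

lemma ideal_power_seq_ideal:
  assumes "a \<in> {1..r} \<rightarrow> carrier R"
  shows "ideal_power R (seq_ideal R a r) n = genideal R (monom_val R r a ` exps r n)"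
proof (induction n)
  case 0
  have "genideal R {\<one>} = carrier R"
    using genideal_ideal[of "{\<one>}"] genideal_self[of "{\<one>}"] by (auto intro!: ideal.one_imp_carrier)
  then show ?case by (simp add: exps_0 monom_val_0 ideals_set_def nat_pow_def)
next
  case (Suc n)
  have mv: "monom_val R r a ` exps r n \<subseteq> carrier R" for n using monom_val_closed[OF assms] by auto
  have a: "a ` {1..r} \<subseteq> carrier R" using assms by auto
  have "{s \<otimes> t | s t. s \<in> monom_val R r a ` exps r n \<and> t \<in> a ` {1..r}} = monom_val R r a ` exps r (Suc n)"
  proof (intro equalityI subsetI)
    fix x assume "x \<in> {s \<otimes> t | s t. s \<in> monom_val R r a ` exps r n \<and> t \<in> a ` {1..r}}"
    then obtain u i where *: "u \<in> exps r n" "i \<in> {1..r}" "x = monom_val R r a u \<otimes> a i" by auto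
    then have "x = monom_val R r a (unit_exp i + u)"
      using assms monom_val_closed[OF assms] by (auto simp: monom_val_shift m_comm Pi_iff)
    then show "x \<in> monom_val R r a ` exps r (Suc n)" using * exps_shift by blast
  next
    fix x assume "x \<in> monom_val R r a ` exps r (Suc n)"
    then obtain u where u: "u \<in> exps r (Suc n)" "x = monom_val R r a u" by auto
    then obtain i v where *: "i \<in> {1..r}" "v \<in> exps r n" "u = unit_exp i + v" by (auto elim: exps_Suc_cases)
    then have "x = monom_val R r a v \<otimes> a i"
      using u assms monom_val_closed[OF assms] by (auto simp: monom_val_shift m_comm Pi_iff)
    then show "x \<in> {s \<otimes> t | s t. s \<in> monom_val R r a ` exps r n \<and> t \<in> a ` {1..r}}" using * by blast
  qed
  then show ?case
    using Suc ideal_prod_genideal[OF mv[of n] a] by (simp add: seq_ideal_def ideals_set_def nat_pow_def)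
qed

end

context module
begin

lemma ideal_smult_power:
  assumes "a \<in> {1..r} \<rightarrow> carrier R" "submodule P R M"
  shows "ideal_smult R M (ideal_power R (seq_ideal R a r) n) P =
    lin_combs R M (exps r n) (monom_val R r a) P"
  unfolding R.ideal_power_seq_ideal[OF assms(1)]
  using assms R.monom_val_closed[OF assms(1)] by (intro ideal_smult_genideal finite_exps) auto

lemma ideal_smult_seq_ideal:
  assumes "a \<in> {1..r} \<rightarrow> carrier R" "submodule P R M"
  shows "ideal_smult R M (seq_ideal R a r) P = lin_combs R M {1..r} a P"
  unfolding seq_ideal_def using assms by (intro ideal_smult_genideal) auto

end

section \<open>Krull's intersection theorem\<close>

context module
begin

text \<open>Pigeonhole: r exponents below k add up to at most r k, so a larger degree forces some
  exponent to be at least k.\<close>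

lemma monom_val_in_ideal:
  assumes a: "a \<in> {1..r} \<rightarrow> carrier R" and J: "ideal J R"
    and k: "\<And>i. i \<in> {1..r} \<Longrightarrow> a i [^] (k::nat) \<in> J"
    and u: "u \<in> exps r n" "r * k < n"
  shows "monom_val R r a u \<in> J"
proof -
  interpret J: ideal J R by (rule J)
  have "\<exists>i\<in>{1..r}. k \<le> Poly_Mapping.lookup u i"
  proof (rule ccontr)
    assume "\<not> ?thesis"
    then have "(\<Sum>i=1..r. Poly_Mapping.lookup u i) \<le> of_nat (card {1..r}) * k"
      by (intro sum_bounded_above) (auto simp: not_le less_imp_le)
    then show False using u by (simp add: exps_def)
  qed
  then obtain i where i: "i \<in> {1..r}" "k \<le> Poly_Mapping.lookup u i" by blast
  have ai: "a i \<in> carrier R" using i a by auto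
  let ?f = "\<lambda>i. a i [^] Poly_Mapping.lookup u i"
  have "monom_val R r a u = finprod R ?f (insert i ({1..r} - {i}))"
    unfolding monom_val_def using i by (simp add: insert_absorb)
  also have "\<dots> = ?f i \<otimes> finprod R ?f ({1..r} - {i})"
    using a i by (intro R.finprod_insert) (auto simp: Pi_iff)
  finally have eq: "monom_val R r a u = ?f i \<otimes> finprod R ?f ({1..r} - {i})" .
  have "?f i = a i [^] k \<otimes> a i [^] (Poly_Mapping.lookup u i - k)"
    using i ai by (simp add: R.nat_pow_mult)
  then have "?f i \<in> J" using k[OF i(1)] ai by (simp add: J.I_r_closed)
  then show ?thesis unfolding eq using a by (intro J.I_r_closed R.finprod_closed) (auto simp: Pi_iff)
qed

text \<open>A submodule \<open>L\<close> maximal with \<open>L \<inter> K = \<qq> K + P\<close> absorbs a power of every \<open>a\<^sub>i\<close>, hence a power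
  of \<open>\<qq>\<close>; applied to \<open>K = \<Inter>\<^sub>n (\<qq>\<^sup>n M + P)\<close> this gives \<open>K = \<qq> K + P\<close> without the Artin-Rees lemma.\<close>

lemma krull_intersection:
  assumes local: "noetherian_local_ring R m" and noeth: "noetherian_module R M"
    and am: "a \<in> {1..r} \<rightarrow> m" and P: "submodule P R M"
    and x: "\<And>n. n \<ge> n0 \<Longrightarrow> x \<in> lin_combs R M (exps r n) (monom_val R r a) (carrier M) <+>\<^bsub>M\<^esub> P"
  shows "x \<in> P"
proof -
  interpret L: noetherian_local_ring R m by (rule local)
  interpret m: maximalideal m R by (rule L.maximal)
  have a: "a \<in> {1..r} \<rightarrow> carrier R" using am m.a_Hcarr by (simp add: Pi_iff)
  have mv: "monom_val R r a \<in> U \<rightarrow> carrier R" for U using R.monom_val_closed[OF a] by auto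
  let ?B = "\<lambda>n. lin_combs R M (exps r n) (monom_val R r a) (carrier M)"
  have B: "submodule (?B n) R M" for n
    by (intro submodule_lin_combs finite_exps mv carrier_is_submodule)
  \<comment> \<open>Membership is imposed only from \<open>n0\<close> on, because superficiality
    will supply it only for large n.\<close>
  define K where "K = {y. \<forall>n\<ge>n0. y \<in> ?B n <+>\<^bsub>M\<^esub> P}"
  note BP = submodule_set_add[OF B P]
  have K: "submodule K R M"
  proof (rule submodule_criterion)
    show "K \<subseteq> carrier M" using submodule_carrier[OF BP[of n0]] by (auto simp: K_def)
  qed (use submodule_zero[OF BP] submoduleE(4,5)[OF BP] in \<open>auto simp: K_def\<close>)
  have PK: "P \<subseteq> K" using set_add_upper2[OF B P] by (auto simp: K_def)
  have xK: "x \<in> K" using x by (simp add: K_def)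
  define D where "D = lin_combs R M {1..r} a K <+>\<^bsub>M\<^esub> P"
  have qK: "submodule (lin_combs R M {1..r} a K) R M" using a K by (intro submodule_lin_combs) auto
  have D: "submodule D R M" unfolding D_def by (intro submodule_set_add qK P)
  have DK: "D \<subseteq> K"
    unfolding D_def using PK a submoduleE(4)[OF K]
    by (intro set_add_least[OF K] lin_combs_least[OF K]) (auto simp: Pi_iff)
  let ?F = "{L. submodule L R M \<and> L \<inter> K = D}"
  obtain L where L: "L \<in> ?F" "\<And>L'. L' \<in> ?F \<Longrightarrow> L \<subseteq> L' \<Longrightarrow> L' = L"
    by (rule noetherian_moduleE[OF noeth, of D ?F]) (use D DK in auto)
  then have sL: "submodule L R M" and LK: "L \<inter> K = D" by auto
  have "\<exists>k::nat. \<forall>y\<in>carrier M. (a i [^] k) \<odot>\<^bsub>M\<^esub> y \<in> L" if i: "i \<in> {1..r}" for i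
  proof -
    have ai: "a i \<in> carrier R" using i a by auto
    let ?C = "\<lambda>k::nat. module_colon M L (a i [^] k)"
    obtain C where C: "C \<in> range ?C" "\<And>C'. C' \<in> range ?C \<Longrightarrow> C \<subseteq> C' \<Longrightarrow> C' = C"
      by (rule noetherian_moduleE[OF noeth rangeI[of ?C 0]])
         (use ai submodule_colon[OF sL] in auto)
    then obtain k where k: "C = ?C k" by auto
    have step: "(a i [^] Suc k) \<odot>\<^bsub>M\<^esub> y = a i \<odot>\<^bsub>M\<^esub> ((a i [^] k) \<odot>\<^bsub>M\<^esub> y)" if "y \<in> carrier M" for y
      using that ai by (simp add: smult_assoc1[symmetric] R.m_comm)
    have "?C k \<subseteq> ?C (Suc k)" using step ai submoduleE(4)[OF sL] by (auto simp: module_colon_def)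
    then have stable: "?C (Suc k) = ?C k" using C(2)[of "?C (Suc k)"] k by blast
    let ?Q = "(\<lambda>y. (a i [^] k) \<odot>\<^bsub>M\<^esub> y) ` carrier M"
    have Q: "submodule ?Q R M" using ai by (intro submodule_scaled carrier_is_submodule) auto
    \<comment> \<open>Multiplication by a_i carries z from K into qK, hence into L. So y lies in the
      colon of a_i^(k+1), which by stability is the colon of a_i^k; thus z lies in L, and in D
      because it also lies in K.\<close>
    have "(?Q <+>\<^bsub>M\<^esub> L) \<inter> K \<subseteq> D"
    proof
      fix z assume z: "z \<in> (?Q <+>\<^bsub>M\<^esub> L) \<inter> K"
      then obtain y l where yl: "y \<in> carrier M" "l \<in> L" "z = (a i [^] k) \<odot>\<^bsub>M\<^esub> y \<oplus>\<^bsub>M\<^esub> l"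
        by (auto simp: mem_set_add)
      have lc: "l \<in> carrier M" using yl submodule_carrier[OF sL] by simp
      have "a i \<odot>\<^bsub>M\<^esub> z \<in> lin_combs R M {1..r} a K"
        using z a i K by (intro lin_combs_gen) auto
      then have "a i \<odot>\<^bsub>M\<^esub> z \<in> L" using set_add_upper1[OF qK P] LK unfolding D_def by blast
      moreover have "a i \<odot>\<^bsub>M\<^esub> z = (a i [^] Suc k) \<odot>\<^bsub>M\<^esub> y \<oplus>\<^bsub>M\<^esub> a i \<odot>\<^bsub>M\<^esub> l"
        using yl lc ai step[OF yl(1)] by (simp add: smult_r_distr del: R.nat_pow_Suc)
      ultimately have "(a i [^] Suc k) \<odot>\<^bsub>M\<^esub> y \<in> L"
        using submodule_add_cancel[OF sL, of "(a i [^] Suc k) \<odot>\<^bsub>M\<^esub> y" "a i \<odot>\<^bsub>M\<^esub> l"]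
          yl ai submoduleE(4)[OF sL ai yl(2)] by simp
      then have "y \<in> ?C k" using stable yl(1) by (auto simp: module_colon_def)
      then have "z \<in> L" using yl submoduleE(5)[OF sL] by (auto simp: module_colon_def)
      then show "z \<in> D" using z LK by blast
    qed
    moreover have "D \<subseteq> (?Q <+>\<^bsub>M\<^esub> L) \<inter> K" using LK set_add_upper2[OF Q sL] by blast
    ultimately have "?Q <+>\<^bsub>M\<^esub> L = L"
      using submodule_set_add[OF Q sL] set_add_upper2[OF Q sL] by (intro L(2)) auto
    then show ?thesis using set_add_upper1[OF Q sL] by (intro exI[of _ k]) auto
  qed
  then obtain e where e: "(a i [^] (e i :: nat)) \<odot>\<^bsub>M\<^esub> y \<in> L" if "i \<in> {1..r}" "y \<in> carrier M" for i y
    by metis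
  \<comment> \<open>A common exponent: the sum bounds every \<open>e i\<close> at once.\<close>
  define k where "k = (\<Sum>i=1..r. e i)"
  let ?J = "{t \<in> carrier R. \<forall>y\<in>carrier M. t \<odot>\<^bsub>M\<^esub> y \<in> L}"
  have J: "ideal ?J R" by (intro ideal_into_submodule[OF sL]) auto
  have ak: "a i [^] k \<in> ?J" if i: "i \<in> {1..r}" for i
  proof -
    have ai: "a i \<in> carrier R" using i a by auto
    have "e i \<le> k" unfolding k_def using i by (intro member_le_sum) auto
    then have "a i [^] k = a i [^] e i \<otimes> a i [^] (k - e i)" using ai by (simp add: R.nat_pow_mult)
    moreover have "a i [^] e i \<in> ?J" using e[OF i] ai by auto
    ultimately show ?thesis using ideal.I_r_closed[OF J, of "a i [^] e i" "a i [^] (k - e i)"] ai by simp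
  qed
  \<comment> \<open>A degree above r k, so that every monomial of degree n has an exponent at least
    k; the maximum with \<open>n0\<close> makes K a subset of q^n M + P.\<close>
  define n where "n = max n0 (Suc (r * k))"
  have "?B n \<subseteq> L"
  proof (rule lin_combs_least[OF sL])
    fix u y assume u: "u \<in> exps r n" and y: "y \<in> carrier M"
    have "monom_val R r a u \<in> ?J" by (rule monom_val_in_ideal[OF a J ak u]) (auto simp: n_def)
    then show "monom_val R r a u \<odot>\<^bsub>M\<^esub> y \<in> L" using y by blast
  qed
  moreover have "P \<subseteq> L" using LK set_add_upper2[OF qK P] unfolding D_def by blast
  ultimately have "?B n <+>\<^bsub>M\<^esub> P \<subseteq> L" by (intro set_add_least[OF sL])
  moreover have "K \<subseteq> ?B n <+>\<^bsub>M\<^esub> P" unfolding K_def n_def by auto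
  ultimately have "K = D" using LK by blast
  moreover have "lin_combs R M {1..r} a K \<subseteq> ideal_smult R M m K"
    using am submoduleE(1)[OF K] m.a_Hcarr
    by (intro lin_combs_least submodule_ideal_smult ideal_smult_incl) (auto simp: Pi_iff)
  ultimately have "K \<subseteq> ideal_smult R M m K <+>\<^bsub>M\<^esub> P"
    using set_add_mono[of _ "ideal_smult R M m K" P P] unfolding D_def by blast
  then have "K = P" by (rule nakayama[OF local noeth P K PK])
  then show ?thesis using xK by simp
qed

end

section \<open>Quotient modules\<close>

context
  fixes R (structure) and M (structure) and P
  assumes mod: "module R M" and sub: "submodule P R M"
begin

interpretation module R M by (rule mod)

interpretation P: abelian_subgroup P M
proof -
  show "abelian_subgroup P M"
    using submodule.axioms(1)[OF sub] M.a_comm_group by (intro abelian_subgroupI3 additive_subgroupI M.abelian_group_axioms)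
qed

lemma coset_eq_iff:
  assumes "x \<in> carrier M" "y \<in> carrier M"
  shows "P +>\<^bsub>M\<^esub> x = P +>\<^bsub>M\<^esub> y \<longleftrightarrow> x \<ominus>\<^bsub>M\<^esub> y \<in> P"
proof -
  have "x \<in> P +>\<^bsub>M\<^esub> y \<longleftrightarrow> x \<ominus>\<^bsub>M\<^esub> y \<in> P"
    using assms by (simp add: P.a_rcos_module a_minus_def)
  then show ?thesis
    using assms P.a_repr_independenceD[of x y] P.a_repr_independence'[of x y] by auto
qed

lemma carrier_FactModule: "carrier (FactModule M P) = (\<lambda>x. P +>\<^bsub>M\<^esub> x) ` carrier M"
  by (auto simp: FactModule_def A_RCOSETS_def')

lemma zero_FactModule: "\<zero>\<^bsub>FactModule M P\<^esub> = P +>\<^bsub>M\<^esub> \<zero>\<^bsub>M\<^esub>"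
  using submoduleE(1)[OF sub] by (simp add: FactModule_def)

lemma add_FactModule:
  "x \<in> carrier M \<Longrightarrow> y \<in> carrier M \<Longrightarrow>
    (P +>\<^bsub>M\<^esub> x) \<oplus>\<^bsub>FactModule M P\<^esub> (P +>\<^bsub>M\<^esub> y) = P +>\<^bsub>M\<^esub> (x \<oplus>\<^bsub>M\<^esub> y)"
  by (simp add: FactModule_def P.a_rcos_sum)

lemma smult_FactModule:
  assumes "t \<in> carrier R" "x \<in> carrier M"
  shows "t \<odot>\<^bsub>FactModule M P\<^esub> (P +>\<^bsub>M\<^esub> x) = P +>\<^bsub>M\<^esub> (t \<odot>\<^bsub>M\<^esub> x)"
proof -
  have "P +>\<^bsub>M\<^esub> (t \<odot>\<^bsub>M\<^esub> y) = P +>\<^bsub>M\<^esub> (t \<odot>\<^bsub>M\<^esub> x)" if y: "y \<in> P +>\<^bsub>M\<^esub> x" for y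
  proof -
    from y obtain p where p: "p \<in> P" "y = p \<oplus>\<^bsub>M\<^esub> x" by (auto simp: a_r_coset_def')
    have pc: "p \<in> carrier M" using p submodule_carrier[OF sub] by simp
    have "t \<odot>\<^bsub>M\<^esub> y \<ominus>\<^bsub>M\<^esub> t \<odot>\<^bsub>M\<^esub> x = t \<odot>\<^bsub>M\<^esub> p"
      using assms pc p by (simp add: smult_r_distr a_minus_def M.a_assoc M.r_neg)
    then show ?thesis using assms pc p submoduleE(4)[OF sub] by (simp add: coset_eq_iff)
  qed
  moreover have "P +>\<^bsub>M\<^esub> x \<noteq> {}" using P.a_rcos_self assms by blast
  ultimately have "(\<Union>y\<in>P +>\<^bsub>M\<^esub> x. P +>\<^bsub>M\<^esub> (t \<odot>\<^bsub>M\<^esub> y)) = P +>\<^bsub>M\<^esub> (t \<odot>\<^bsub>M\<^esub> x)"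
    by (intro SUP_eq_const)
  then show ?thesis by (simp add: FactModule_def)
qed

lemmas FactModule_ops = carrier_FactModule zero_FactModule add_FactModule smult_FactModule

lemma module_FactModule: "module R (FactModule M P)"
proof (rule moduleI)
  show "abelian_group (FactModule M P)"
  proof (rule abelian_groupI)
    fix C assume "C \<in> carrier (FactModule M P)"
    then obtain x where x: "x \<in> carrier M" "C = P +>\<^bsub>M\<^esub> x" by (auto simp: carrier_FactModule)
    show "\<exists>C'\<in>carrier (FactModule M P). C' \<oplus>\<^bsub>FactModule M P\<^esub> C = \<zero>\<^bsub>FactModule M P\<^esub>"
      using x by (intro bexI[of _ "P +>\<^bsub>M\<^esub> (\<ominus>\<^bsub>M\<^esub> x)"]) (auto simp: FactModule_ops M.l_neg)
  qed (auto simp: FactModule_ops M.a_ac)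
qed (auto simp: FactModule_ops R.is_cring smult_l_distr smult_r_distr smult_assoc1)

interpretation L: module R "FactModule M P" by (rule module_FactModule)

lemma submodule_coset_image:
  assumes "submodule K R M"
  shows "submodule ((\<lambda>x. P +>\<^bsub>M\<^esub> x) ` K) R (FactModule M P)"
proof (rule L.submodule_criterion)
  note K = submoduleE(4,5)[OF assms] submodule_zero[OF assms] submodule_carrier[OF assms]
  show "(\<lambda>x. P +>\<^bsub>M\<^esub> x) ` K \<subseteq> carrier (FactModule M P)"
    using K by (auto simp: carrier_FactModule)
  show "\<zero>\<^bsub>FactModule M P\<^esub> \<in> (\<lambda>x. P +>\<^bsub>M\<^esub> x) ` K" using K by (auto simp: zero_FactModule)
qed (use submoduleE(4,5)[OF assms] submodule_carrier[OF assms] in \<open>auto simp: FactModule_ops\<close>)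

lemma submodule_coset_preimage:
  assumes "submodule H R (FactModule M P)"
  shows "submodule {x \<in> carrier M. P +>\<^bsub>M\<^esub> x \<in> H} R M"
proof (rule submodule_criterion)
  show "\<zero>\<^bsub>M\<^esub> \<in> {x \<in> carrier M. P +>\<^bsub>M\<^esub> x \<in> H}"
    using L.submodule_zero[OF assms] by (simp add: zero_FactModule)
qed (use L.submoduleE(4,5)[OF assms] in \<open>auto simp: FactModule_ops[symmetric]\<close>)

lemma ideal_smult_FactModule:
  assumes "I \<subseteq> carrier R"
  shows "ideal_smult R (FactModule M P) I (carrier (FactModule M P)) =
    (\<lambda>x. P +>\<^bsub>M\<^esub> x) ` ideal_smult R M I (carrier M)"
proof
  note IM = submodule_ideal_smult[OF assms subset_refl]
  show "ideal_smult R (FactModule M P) I (carrier (FactModule M P)) \<subseteq>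
    (\<lambda>x. P +>\<^bsub>M\<^esub> x) ` ideal_smult R M I (carrier M)"
  proof (rule L.ideal_smult_least[OF submodule_coset_image[OF IM]])
    fix t C assume t: "t \<in> I" and "C \<in> carrier (FactModule M P)"
    then obtain x where x: "x \<in> carrier M" "C = P +>\<^bsub>M\<^esub> x" by (auto simp: carrier_FactModule)
    have "t \<odot>\<^bsub>FactModule M P\<^esub> C = P +>\<^bsub>M\<^esub> (t \<odot>\<^bsub>M\<^esub> x)" using t x assms by (auto simp: smult_FactModule)
    then show "t \<odot>\<^bsub>FactModule M P\<^esub> C \<in> (\<lambda>x. P +>\<^bsub>M\<^esub> x) ` ideal_smult R M I (carrier M)"
      using ideal_smult_incl[OF t x(1)] by blast
  qed
  let ?IL = "ideal_smult R (FactModule M P) I (carrier (FactModule M P))"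
  have "ideal_smult R M I (carrier M) \<subseteq> {x \<in> carrier M. P +>\<^bsub>M\<^esub> x \<in> ?IL}"
  proof (rule ideal_smult_least[OF submodule_coset_preimage])
    show "submodule ?IL R (FactModule M P)" using assms by (intro L.submodule_ideal_smult) auto
    fix t x assume tx: "t \<in> I" "x \<in> carrier M"
    then have "t \<odot>\<^bsub>FactModule M P\<^esub> (P +>\<^bsub>M\<^esub> x) \<in> ?IL"
      by (intro L.ideal_smult_incl) (auto simp: carrier_FactModule)
    then show "t \<odot>\<^bsub>M\<^esub> x \<in> {x \<in> carrier M. P +>\<^bsub>M\<^esub> x \<in> ?IL}"
      using tx assms by (auto simp: smult_FactModule)
  qed
  then show "(\<lambda>x. P +>\<^bsub>M\<^esub> x) ` ideal_smult R M I (carrier M) \<subseteq> ?IL" by blast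
qed

end

text \<open>Says that a_(j+1) is a nonzerodivisor on qM / q_j M. Elements of M outside qM may well
  be multiplied into q_j M, and these are the ones condition (ii) is about.\<close>

definition relative_regular ::
    "('a, 'c) ring_scheme \<Rightarrow> ('a, 'b, 'd) module_scheme \<Rightarrow> nat \<Rightarrow> (nat \<Rightarrow> 'a) \<Rightarrow> bool"
  where "relative_regular A M r a \<longleftrightarrow>
    (\<forall>j<r. \<forall>x \<in> lin_combs A M {1..r} a (carrier M).
      a (Suc j) \<odot>\<^bsub>M\<^esub> x \<in> lin_combs A M {1..j} a (carrier M) \<longrightarrow> x \<in> lin_combs A M {1..j} a (carrier M))"

text \<open>If a_(j+1) x is in q_j M, the class of x in L = M / q_j M is killed by a_(j+1), so it
  lies in the colon of q^(n+1) L for every n. As x is in qM, superficiality at index j + 1 puts the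
  class into q^n L for all large n, and lifting back to M makes x an element of q^n M + q_j
  M.\<close>

lemma (in module) absolutely_superficial_imp_relative_regular:
  assumes local: "noetherian_local_ring R m" and noeth: "noetherian_module R M"
    and am: "a \<in> {1..r} \<rightarrow> m" and sup: "absolutely_superficial R M r a"
  shows "relative_regular R M r a"
  unfolding relative_regular_def
proof (intro allI impI ballI)
  interpret L: noetherian_local_ring R m by (rule local)
  interpret m: maximalideal m R by (rule L.maximal)
  have a: "a \<in> {1..r} \<rightarrow> carrier R" using am m.a_Hcarr by (simp add: Pi_iff)
  fix j x
  assume j: "j < r" and x: "x \<in> lin_combs R M {1..r} a (carrier M)"
    and ax: "a (Suc j) \<odot>\<^bsub>M\<^esub> x \<in> lin_combs R M {1..j} a (carrier M)"
  let ?q = "seq_ideal R a r" and ?P = "lin_combs R M {1..j} a (carrier M)"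
  let ?L = "FactModule M ?P"
  have aj: "a \<in> {1..j} \<rightarrow> carrier R" and aSj: "a (Suc j) \<in> carrier R" using a j by auto
  have P: "submodule ?P R M" using aj by (intro submodule_lin_combs carrier_is_submodule) auto
  have xc: "x \<in> carrier M"
    using x a submodule_carrier[OF submodule_lin_combs[OF _ a carrier_is_submodule]] by auto
  have q: "?q \<subseteq> carrier R" unfolding seq_ideal_def using a by (intro R.genideal_carrier) auto
  have qn: "ideal_power R ?q n \<subseteq> carrier R" for n
    unfolding R.ideal_power_seq_ideal[OF a] using R.monom_val_closed[OF a] by (intro R.genideal_carrier) auto
  note L = module_FactModule[OF module_axioms P]
  have "\<forall>\<^sub>F n in sequentially.
      module_colon ?L (ideal_smult R ?L (ideal_power R ?q (n + 1)) (carrier ?L)) (a (Suc j))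
        \<inter> ideal_smult R ?L ?q (carrier ?L) = ideal_smult R ?L (ideal_power R ?q n) (carrier ?L)"
    using sup j unfolding absolutely_superficial_def Let_def
    by (auto simp: ideal_smult_seq_ideal[OF aj carrier_is_submodule] dest!: bspec[of _ _ "Suc j"])
  then obtain n0 where n0: "\<And>n. n \<ge> n0 \<Longrightarrow>
      module_colon ?L (ideal_smult R ?L (ideal_power R ?q (n + 1)) (carrier ?L)) (a (Suc j))
        \<inter> ideal_smult R ?L ?q (carrier ?L) = ideal_smult R ?L (ideal_power R ?q n) (carrier ?L)"
    unfolding eventually_sequentially by blast
  have "a (Suc j) \<odot>\<^bsub>?L\<^esub> (?P +>\<^bsub>M\<^esub> x) = \<zero>\<^bsub>?L\<^esub>"
    using ax aSj xc by (simp add: FactModule_ops[OF module_axioms P] coset_eq_iff[OF module_axioms P] 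
      submodule_minus[OF P _ submodule_zero[OF P]] del: One_nat_def)
  then have colon: "?P +>\<^bsub>M\<^esub> x \<in> module_colon ?L (ideal_smult R ?L (ideal_power R ?q (n + 1)) (carrier ?L)) (a (Suc j))" for n
    using xc module.submodule_zero[OF L module.submodule_ideal_smult[OF L qn subset_refl]]
    by (simp add: module_colon_def carrier_FactModule[OF module_axioms P] del: One_nat_def add_Suc_right)
  have "?P +>\<^bsub>M\<^esub> x \<in> ideal_smult R ?L ?q (carrier ?L)"
    using x unfolding ideal_smult_FactModule[OF module_axioms P q] ideal_smult_seq_ideal[OF a carrier_is_submodule]
    by (rule imageI)
  with colon n0 have "?P +>\<^bsub>M\<^esub> x \<in> ideal_smult R ?L (ideal_power R ?q n) (carrier ?L)" if "n \<ge> n0" for n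
    using that by blast
  then have *: "?P +>\<^bsub>M\<^esub> x \<in> (\<lambda>x. ?P +>\<^bsub>M\<^esub> x) ` lin_combs R M (exps r n) (monom_val R r a) (carrier M)" if "n \<ge> n0" for n
    using that
    by (simp only: ideal_smult_FactModule[OF module_axioms P qn] ideal_smult_power[OF a carrier_is_submodule])
  show "x \<in> ?P"
  proof (rule krull_intersection[OF local noeth am P])
    fix n assume "n \<ge> n0"
    then obtain y where y: "y \<in> lin_combs R M (exps r n) (monom_val R r a) (carrier M)"
      "?P +>\<^bsub>M\<^esub> x = ?P +>\<^bsub>M\<^esub> y" using * by blast
    have B: "submodule (lin_combs R M (exps r n) (monom_val R r a) (carrier M)) R M"
      using R.monom_val_closed[OF a] by (intro submodule_lin_combs finite_exps carrier_is_submodule) auto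
    have yc: "y \<in> carrier M" using submodule_carrier[OF B] y by blast
    have "x \<ominus>\<^bsub>M\<^esub> y \<in> ?P" using y(2) coset_eq_iff[OF module_axioms P xc yc] by blast
    moreover have "x = y \<oplus>\<^bsub>M\<^esub> (x \<ominus>\<^bsub>M\<^esub> y)"
      using xc yc by (simp add: a_minus_def M.a_lcomm M.r_neg)
    ultimately show "x \<in> lin_combs R M (exps r n) (monom_val R r a) (carrier M) <+>\<^bsub>M\<^esub> ?P"
      using y(1) unfolding mem_set_add by blast
  qed
qed

section \<open>Relations between forms\<close>

text \<open>The monomials of degree \<open>d\<close> in the ideal (X_1, ..., X_j); forms supported
  here are the degree \<open>d\<close> part of that ideal. It permits induction on the number of
  variables at fixed degree.\<close>

definition subexps :: "nat \<Rightarrow> nat \<Rightarrow> nat \<Rightarrow> (nat \<Rightarrow>\<^sub>0 nat) set"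
  where "subexps r d j = {u \<in> exps r d. \<exists>i\<in>{1..j}. 0 < Poly_Mapping.lookup u i}"

lemma finite_subexps: "finite (subexps r d j)"
  unfolding subexps_def using finite_exps by simp

lemma subexps_0: "subexps r d 0 = {}"
  by (auto simp: subexps_def)

lemma subexps_subset: "subexps r d j \<subseteq> exps r d"
  by (auto simp: subexps_def)

lemma subexps_Suc_self: "subexps r (Suc d) r = exps r (Suc d)"
proof -
  have "u \<in> subexps r (Suc d) r" if u: "u \<in> exps r (Suc d)" for u
  proof -
    obtain i v where "i \<in> {1..r}" "u = unit_exp i + v" using u by (rule exps_Suc_cases)
    then show ?thesis using u by (auto simp: subexps_def lookup_shift intro!: bexI[of _ i])
  qed
  then show ?thesis using subexps_subset by blast
qed

lemma subexps_mono: "j \<le> j' \<Longrightarrow> subexps r d j \<subseteq> subexps r d j'"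
  by (fastforce simp: subexps_def)

lemma shift_in_subexps:
  assumes "v \<in> exps r d" "i \<in> {1..j}" "j \<le> r"
  shows "unit_exp i + v \<in> subexps r (Suc d) j"
  using assms exps_shift[of i r v d] by (auto simp: subexps_def lookup_shift intro!: bexI[of _ i])

lemma shift_subexps:
  assumes "v \<in> subexps r d j" "i \<in> {1..r}"
  shows "unit_exp i + v \<in> subexps r (Suc d) j"
proof -
  from assms obtain k where "k \<in> {1..j}" "0 < Poly_Mapping.lookup v k" by (auto simp: subexps_def)
  then show ?thesis
    using assms exps_shift[of i r v d] by (auto simp: subexps_def lookup_shift intro!: bexI[of _ k])
qed

lemma subexps_cases:
  assumes "u \<in> subexps r (Suc d) j" "j \<le> r"
  obtains i v where "i \<in> {1..j}" "v \<in> exps r d" "u = unit_exp i + v"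
proof -
  from assms obtain i where i: "i \<in> {1..j}" "0 < Poly_Mapping.lookup u i" by (auto simp: subexps_def)
  then obtain v where "u = unit_exp i + v" by (auto elim: exp_decompose)
  then show ?thesis using that i assms exps_shift[of i r v d] by (auto simp: subexps_def)
qed

text \<open>The new monomials are those divisible by X_(j+1) and by no earlier variable. Excluding
  the v whose shift is already in the old set makes the union disjoint, so that sums over it
  split.\<close>

lemma subexps_Suc:
  assumes "Suc j \<le> r"
  shows "subexps r (Suc d) (Suc j) = subexps r (Suc d) j \<union>
    (+) (unit_exp (Suc j)) ` {v \<in> exps r d. unit_exp (Suc j) + v \<notin> subexps r (Suc d) j}"
    (is "?S' = ?S \<union> ?V")
proof
  show "?S \<union> ?V \<subseteq> ?S'"
    using subexps_mono[of j "Suc j"] shift_in_subexps[of _ r d "Suc j" "Suc j"] assms by auto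
  show "?S' \<subseteq> ?S \<union> ?V"
  proof
    fix u assume u: "u \<in> ?S'"
    show "u \<in> ?S \<union> ?V"
    proof (cases "u \<in> ?S")
      case False
      then have "0 < Poly_Mapping.lookup u (Suc j)"
        using u by (auto simp: subexps_def atLeastAtMostSuc_conv)
      then obtain v where v: "u = unit_exp (Suc j) + v" by (rule exp_decompose)
      then have "v \<in> exps r d" using u assms exps_shift[of "Suc j" r v d] by (auto simp: subexps_def)
      then show ?thesis using v False by blast
    qed simp
  qed
qed

section \<open>Values of forms and their intersection with q_j M\<close>

locale module_sequence = module R M for R (structure) and M (structure) +
  fixes r :: nat and a :: "nat \<Rightarrow> 'a"
  assumes a: "a \<in> {1..r} \<rightarrow> carrier R"
begin

abbreviation forms :: "(nat \<Rightarrow>\<^sub>0 nat) set \<Rightarrow> 'c set"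
  where "forms U \<equiv> lin_combs R M U (monom_val R r a) (carrier M)"

abbreviation linear :: "nat \<Rightarrow> 'c set"
  where "linear j \<equiv> lin_combs R M {1..j} a (carrier M)"

lemma monom_val_fun: "monom_val R r a \<in> U \<rightarrow> carrier R"
  using R.monom_val_closed[OF a] by auto

lemma submodule_forms: "finite U \<Longrightarrow> submodule (forms U) R M"
  by (intro submodule_lin_combs monom_val_fun carrier_is_submodule)

lemma submodule_linear: "j \<le> r \<Longrightarrow> submodule (linear j) R M"
  using a by (intro submodule_lin_combs carrier_is_submodule) auto

lemma smult_monom_val_shift:
  assumes "i \<in> {1..r}" "y \<in> carrier M"
  shows "monom_val R r a (unit_exp i + v) \<odot>\<^bsub>M\<^esub> y = a i \<odot>\<^bsub>M\<^esub> (monom_val R r a v \<odot>\<^bsub>M\<^esub> y)"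
proof -
  have "a i \<in> carrier R" using a assms by auto
  then show ?thesis
    using assms R.monom_val_closed[OF a] by (simp add: R.monom_val_shift[OF a assms(1)] smult_assoc1)
qed

lemma smult_forms:
  assumes "i \<in> {1..r}" "finite U'" "\<And>v. v \<in> U \<Longrightarrow> unit_exp i + v \<in> U'" "z \<in> forms U"
  shows "a i \<odot>\<^bsub>M\<^esub> z \<in> forms U'"
proof -
  have ai: "a i \<in> carrier R" using a assms(1) by auto
  have "forms U \<subseteq> module_colon M (forms U') (a i)"
  proof (rule lin_combs_least[OF submodule_colon[OF submodule_forms[OF assms(2)] ai]])
    fix v y assume v: "v \<in> U" and y: "y \<in> carrier M"
    have "a i \<odot>\<^bsub>M\<^esub> (monom_val R r a v \<odot>\<^bsub>M\<^esub> y) = monom_val R r a (unit_exp i + v) \<odot>\<^bsub>M\<^esub> y"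
      using smult_monom_val_shift[OF assms(1) y] by simp
    also have "\<dots> \<in> forms U'"
      using assms(2) assms(3)[OF v] y by (intro lin_combs_gen monom_val_fun carrier_is_submodule)
    finally show "monom_val R r a v \<odot>\<^bsub>M\<^esub> y \<in> module_colon M (forms U') (a i)"
      using y R.monom_val_closed[OF a] by (simp add: module_colon_def)
  qed
  then show ?thesis using assms(4) by (auto simp: module_colon_def)
qed

lemma forms_subexps_linear:
  assumes "j \<le> r"
  shows "forms (subexps r (Suc d) j) \<subseteq> linear j"
proof (rule lin_combs_least[OF submodule_linear[OF assms]])
  fix u y assume u: "u \<in> subexps r (Suc d) j" and y: "y \<in> carrier M"
  from u assms obtain i v where *: "i \<in> {1..j}" "u = unit_exp i + v" by (rule subexps_cases)
  have "monom_val R r a u \<odot>\<^bsub>M\<^esub> y = a i \<odot>\<^bsub>M\<^esub> (monom_val R r a v \<odot>\<^bsub>M\<^esub> y)"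
    using * y assms by (auto simp: smult_monom_val_shift)
  also have "\<dots> \<in> linear j"
    using a assms * y R.monom_val_closed[OF a] by (intro lin_combs_gen carrier_is_submodule) auto
  finally show "monom_val R r a u \<odot>\<^bsub>M\<^esub> y \<in> linear j" .
qed

lemma linear_forms:
  assumes "j \<le> r"
  shows "linear j \<subseteq> forms (subexps r 1 j)"
proof (rule lin_combs_least[OF submodule_forms[OF finite_subexps]])
  fix i y assume i: "i \<in> {1..j}" and y: "y \<in> carrier M"
  have "0 \<in> exps r 0" by (simp add: exps_0)
  then have "monom_val R r a 0 \<odot>\<^bsub>M\<^esub> y \<in> forms (exps r 0)"
    using y by (intro lin_combs_gen monom_val_fun carrier_is_submodule finite_exps)
  then have "y \<in> forms (exps r 0)" using y by (simp add: R.monom_val_0)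
  then show "a i \<odot>\<^bsub>M\<^esub> y \<in> forms (subexps r 1 j)"
    using shift_in_subexps[of _ r 0 i j] i assms by (intro smult_forms[of _ _ "exps r 0"] finite_subexps) auto
qed

lemma forms_subexps_Suc:
  assumes "Suc j \<le> r"
  shows "forms (subexps r (Suc d) (Suc j)) \<subseteq>
    forms (subexps r (Suc d) j) <+>\<^bsub>M\<^esub> (\<lambda>x. a (Suc j) \<odot>\<^bsub>M\<^esub> x) ` forms (exps r d)"
proof -
  have aj: "a (Suc j) \<in> carrier R" using a assms by auto
  note sub = submodule_forms[OF finite_subexps, of r "Suc d" j]
    submodule_scaled[OF aj submodule_forms[OF finite_exps], of r d]
  show ?thesis
  proof (rule lin_combs_least[OF submodule_set_add[OF sub]])
    fix u y assume u: "u \<in> subexps r (Suc d) (Suc j)" and y: "y \<in> carrier M"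
    then consider "u \<in> subexps r (Suc d) j" | v where "v \<in> exps r d" "u = unit_exp (Suc j) + v"
      unfolding subexps_Suc[OF assms] by blast
    then show "monom_val R r a u \<odot>\<^bsub>M\<^esub> y \<in>
      forms (subexps r (Suc d) j) <+>\<^bsub>M\<^esub> (\<lambda>x. a (Suc j) \<odot>\<^bsub>M\<^esub> x) ` forms (exps r d)"
    proof cases
      case 1
      then have "monom_val R r a u \<odot>\<^bsub>M\<^esub> y \<in> forms (subexps r (Suc d) j)"
        using y by (intro lin_combs_gen monom_val_fun carrier_is_submodule finite_subexps)
      then show ?thesis using set_add_upper1[OF sub] by blast
    next
      case 2
      then have "monom_val R r a v \<odot>\<^bsub>M\<^esub> y \<in> forms (exps r d)"
        using y by (intro lin_combs_gen monom_val_fun carrier_is_submodule finite_exps)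
      moreover have "monom_val R r a u \<odot>\<^bsub>M\<^esub> y = a (Suc j) \<odot>\<^bsub>M\<^esub> (monom_val R r a v \<odot>\<^bsub>M\<^esub> y)"
        unfolding 2(2) using y assms by (intro smult_monom_val_shift) auto
      ultimately show ?thesis using set_add_upper2[OF sub] by blast
    qed
  qed
qed

lemma linear_mono: "i \<le> j \<Longrightarrow> j \<le> r \<Longrightarrow> linear i \<subseteq> linear j"
  using a by (intro lin_combs_mono carrier_is_submodule) auto

text \<open>An element x of q_j M in q^(d+2) M is, by the case j + 1, of the form y + a_(j+1) z,
  where y is the value of a form in (X_1, ..., X_j) and z lies in q^(d+1) M. Then a_(j+1) z is in
  q_j M, and z is in qM, so cancellation puts z into q_j M; the statement in the lower degree
  applies to z. The positive degree of z is essential, which is why the induction starts with linear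
  forms.\<close>

lemma linear_Int_forms:
  assumes reg: "relative_regular R M r a" and "j \<le> r"
  shows "linear j \<inter> forms (exps r (Suc d)) \<subseteq> forms (subexps r (Suc d) j)"
  using assms(2)
proof (induction d arbitrary: j)
  case 0
  then show ?case using linear_forms[of j] by auto
next
  case (Suc d)
  show ?case using Suc.prems
  \<comment> \<open>Downward in j from j = r, where every monomial of positive degree is
    allowed.\<close>
  proof (induction j rule: inc_induct)
    case base
    then show ?case by (simp add: subexps_Suc_self)
  next
    case (step j)
    then have j: "Suc j \<le> r" "j \<le> r" by auto
    show ?case
    proof
      fix x assume x: "x \<in> linear j \<inter> forms (exps r (Suc (Suc d)))"
      then have "x \<in> forms (subexps r (Suc (Suc d)) (Suc j))"
        using step.IH linear_mono[of j "Suc j"] j by auto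
      then obtain y z where yz: "y \<in> forms (subexps r (Suc (Suc d)) j)" "z \<in> forms (exps r (Suc d))"
        "x = y \<oplus>\<^bsub>M\<^esub> a (Suc j) \<odot>\<^bsub>M\<^esub> z"
        using forms_subexps_Suc[OF j(1), of "Suc d"] unfolding subset_iff mem_set_add by blast
      have aj: "a (Suc j) \<in> carrier R" using a j by auto
      have c: "y \<in> carrier M" "z \<in> carrier M"
        using yz submodule_carrier[OF submodule_forms[OF finite_subexps]]
          submodule_carrier[OF submodule_forms[OF finite_exps]] by blast+
      have "y \<in> linear j" using yz(1) forms_subexps_linear[OF j(2), of "Suc d"] by blast
      then have "a (Suc j) \<odot>\<^bsub>M\<^esub> z \<in> linear j"
        using submodule_add_cancel[OF submodule_linear[OF j(2)], of "a (Suc j) \<odot>\<^bsub>M\<^esub> z" y] x yz c aj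
        by (simp add: M.a_comm)
      moreover have "z \<in> linear r"
        using yz(2) forms_subexps_linear[of r d] by (auto simp: subexps_Suc_self)
      ultimately have "z \<in> linear j" using reg j unfolding relative_regular_def by auto
      then have "z \<in> forms (subexps r (Suc d) j)" using Suc.IH[OF j(2)] yz(2) by blast
      then have "a (Suc j) \<odot>\<^bsub>M\<^esub> z \<in> forms (subexps r (Suc (Suc d)) j)"
        using j shift_subexps[of _ r "Suc d" j "Suc j"]
        by (intro smult_forms[of _ _ "subexps r (Suc d) j"] finite_subexps) auto
      then show "x \<in> forms (subexps r (Suc (Suc d)) j)"
        using yz submoduleE(5)[OF submodule_forms[OF finite_subexps]] by blast
    qed
  qed
qed

lemma finsum_shift:
  assumes "finite V" "i \<in> {1..r}" "F \<in> (+) (unit_exp i) ` V \<rightarrow> carrier M"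
  shows "(\<Oplus>\<^bsub>M\<^esub>u\<in>(+) (unit_exp i) ` V. monom_val R r a u \<odot>\<^bsub>M\<^esub> F u) =
    a i \<odot>\<^bsub>M\<^esub> (\<Oplus>\<^bsub>M\<^esub>v\<in>V. monom_val R r a v \<odot>\<^bsub>M\<^esub> F (unit_exp i + v))"
proof -
  have ai: "a i \<in> carrier R" using a assms by auto
  have "(\<Oplus>\<^bsub>M\<^esub>u\<in>(+) (unit_exp i) ` V. monom_val R r a u \<odot>\<^bsub>M\<^esub> F u) =
      (\<Oplus>\<^bsub>M\<^esub>v\<in>V. monom_val R r a (unit_exp i + v) \<odot>\<^bsub>M\<^esub> F (unit_exp i + v))"
    using assms R.monom_val_closed[OF a] by (intro M.finsum_reindex) (auto simp: Pi_iff)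
  also have "\<dots> = (\<Oplus>\<^bsub>M\<^esub>v\<in>V. a i \<odot>\<^bsub>M\<^esub> (monom_val R r a v \<odot>\<^bsub>M\<^esub> F (unit_exp i + v)))"
    using assms ai R.monom_val_closed[OF a]
    by (intro M.finsum_cong') (auto simp: Pi_iff smult_monom_val_shift)
  also have "\<dots> = a i \<odot>\<^bsub>M\<^esub> (\<Oplus>\<^bsub>M\<^esub>v\<in>V. monom_val R r a v \<odot>\<^bsub>M\<^esub> F (unit_exp i + v))"
    using assms ai R.monom_val_closed[OF a] by (intro finsum_smult_ldistr[symmetric]) (auto simp: Pi_iff)
  finally show ?thesis .
qed

end

lemma (in module) finsum_smult_add:
  assumes "c \<in> U \<rightarrow> carrier R" "F \<in> U \<rightarrow> carrier M" "G \<in> U \<rightarrow> carrier M"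
  shows "(\<Oplus>\<^bsub>M\<^esub>u\<in>U. c u \<odot>\<^bsub>M\<^esub> (F u \<oplus>\<^bsub>M\<^esub> G u)) =
    (\<Oplus>\<^bsub>M\<^esub>u\<in>U. c u \<odot>\<^bsub>M\<^esub> F u) \<oplus>\<^bsub>M\<^esub> (\<Oplus>\<^bsub>M\<^esub>u\<in>U. c u \<odot>\<^bsub>M\<^esub> G u)"
proof -
  have "(\<Oplus>\<^bsub>M\<^esub>u\<in>U. c u \<odot>\<^bsub>M\<^esub> (F u \<oplus>\<^bsub>M\<^esub> G u)) = (\<Oplus>\<^bsub>M\<^esub>u\<in>U. c u \<odot>\<^bsub>M\<^esub> F u \<oplus>\<^bsub>M\<^esub> c u \<odot>\<^bsub>M\<^esub> G u)"
    using assms by (intro M.finsum_cong') (auto simp: Pi_iff smult_r_distr)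
  also have "\<dots> = (\<Oplus>\<^bsub>M\<^esub>u\<in>U. c u \<odot>\<^bsub>M\<^esub> F u) \<oplus>\<^bsub>M\<^esub> (\<Oplus>\<^bsub>M\<^esub>u\<in>U. c u \<odot>\<^bsub>M\<^esub> G u)"
    using assms by (intro M.finsum_addf) (auto simp: Pi_iff)
  finally show ?thesis .
qed

lemma (in module) finsum_smult_diff:
  assumes "finite U" "c \<in> U \<rightarrow> carrier R" "F \<in> U \<rightarrow> carrier M" "G \<in> U \<rightarrow> carrier M"
  shows "(\<Oplus>\<^bsub>M\<^esub>u\<in>U. c u \<odot>\<^bsub>M\<^esub> (F u \<ominus>\<^bsub>M\<^esub> G u)) =
    (\<Oplus>\<^bsub>M\<^esub>u\<in>U. c u \<odot>\<^bsub>M\<^esub> F u) \<ominus>\<^bsub>M\<^esub> (\<Oplus>\<^bsub>M\<^esub>u\<in>U. c u \<odot>\<^bsub>M\<^esub> G u)"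
proof -
  have "(\<Oplus>\<^bsub>M\<^esub>u\<in>U. c u \<odot>\<^bsub>M\<^esub> (\<ominus>\<^bsub>M\<^esub> G u)) = (\<Oplus>\<^bsub>M\<^esub>u\<in>U. (\<ominus> \<one>) \<odot>\<^bsub>M\<^esub> (c u \<odot>\<^bsub>M\<^esub> G u))"
    using assms by (intro M.finsum_cong') (auto simp: Pi_iff smult_l_minus smult_r_minus)
  also have "\<dots> = (\<ominus> \<one>) \<odot>\<^bsub>M\<^esub> (\<Oplus>\<^bsub>M\<^esub>u\<in>U. c u \<odot>\<^bsub>M\<^esub> G u)"
    using assms by (intro finsum_smult_ldistr[symmetric]) (auto simp: Pi_iff)
  also have "\<dots> = \<ominus>\<^bsub>M\<^esub> (\<Oplus>\<^bsub>M\<^esub>u\<in>U. c u \<odot>\<^bsub>M\<^esub> G u)"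
    using assms by (subst smult_l_minus) (auto simp: Pi_iff intro!: M.finsum_closed smult_one)
  finally show ?thesis
    using finsum_smult_add[of c U F "\<lambda>u. \<ominus>\<^bsub>M\<^esub> G u"] assms by (simp add: a_minus_def Pi_iff)
qed

section \<open>Relations supported on a given set of monomials\<close>

context module_sequence
begin

text \<open>Independence restricted to relations supported in \<open>U\<close>. For
  \<open>U = exps r d\<close> it isolates one degree, which is all that a single length equality
  sees; the supports \<open>subexps\<close> carry the induction on the variables.\<close>

definition relations_in :: "'c set \<Rightarrow> (nat \<Rightarrow>\<^sub>0 nat) set \<Rightarrow> bool"
  where "relations_in N U \<longleftrightarrow>
    (\<forall>F \<in> U \<rightarrow> carrier M. (\<Oplus>\<^bsub>M\<^esub>u\<in>U. monom_val R r a u \<odot>\<^bsub>M\<^esub> F u) = \<zero>\<^bsub>M\<^esub> \<longrightarrow> F \<in> U \<rightarrow> N)"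

lemma relations_inD:
  assumes "relations_in N U" "F \<in> U \<rightarrow> carrier M"
    "(\<Oplus>\<^bsub>M\<^esub>u\<in>U. monom_val R r a u \<odot>\<^bsub>M\<^esub> F u) = \<zero>\<^bsub>M\<^esub>" "u \<in> U"
  shows "F u \<in> N"
  using assms unfolding relations_in_def by (auto simp: Pi_iff)

lemma relations_in_subset:
  assumes "relations_in N U" "finite U" "V \<subseteq> U"
  shows "relations_in N V"
  unfolding relations_in_def
proof (intro ballI impI Pi_I)
  fix F v assume F: "F \<in> V \<rightarrow> carrier M" and v: "v \<in> V"
    and eq: "(\<Oplus>\<^bsub>M\<^esub>u\<in>V. monom_val R r a u \<odot>\<^bsub>M\<^esub> F u) = \<zero>\<^bsub>M\<^esub>"
  have "(\<Oplus>\<^bsub>M\<^esub>u\<in>U. monom_val R r a u \<odot>\<^bsub>M\<^esub> (if u \<in> V then F u else \<zero>\<^bsub>M\<^esub>)) = \<zero>\<^bsub>M\<^esub>"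
    using finsum_extend[OF assms(2,3) monom_val_fun F] eq by simp
  from relations_inD[OF assms(1) _ this, of v] show "F v \<in> N" using F v assms(3) by (auto simp: Pi_iff split: if_splits)
qed

text \<open>Multiplication by X_1 turns a relation of degree d into one of degree d + 1 with the
  same coefficients. This direction uses no regularity of the sequence and lets a single degree n
  decide all lower ones.\<close>

lemma relations_in_shift:
  assumes "relations_in N (exps r (Suc d))" "1 \<le> r"
  shows "relations_in N (exps r d)"
  unfolding relations_in_def
proof (intro ballI impI Pi_I)
  fix F v assume F: "F \<in> exps r d \<rightarrow> carrier M" and v: "v \<in> exps r d"
    and eq: "(\<Oplus>\<^bsub>M\<^esub>u\<in>exps r d. monom_val R r a u \<odot>\<^bsub>M\<^esub> F u) = \<zero>\<^bsub>M\<^esub>"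
  let ?V = "(+) (unit_exp 1) ` exps r d" and ?F = "\<lambda>u. F (u - unit_exp 1)"
  have r: "1 \<in> {1..r}" using assms(2) by simp
  then have "a 1 \<in> carrier R" using a by blast
  have "?V \<subseteq> exps r (Suc d)" using exps_shift[OF r] by auto
  then have rel: "relations_in N ?V" by (rule relations_in_subset[OF assms(1) finite_exps])
  have F': "?F \<in> ?V \<rightarrow> carrier M" using F by (auto simp: Pi_iff)
  have "(\<Oplus>\<^bsub>M\<^esub>u\<in>?V. monom_val R r a u \<odot>\<^bsub>M\<^esub> ?F u) = \<zero>\<^bsub>M\<^esub>"
    using finsum_shift[OF finite_exps r F'] eq \<open>a 1 \<in> carrier R\<close> by simp
  from relations_inD[OF rel F' this, of "unit_exp 1 + v"] show "F v \<in> N" using v by simp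
qed

lemma relations_in_shift_le:
  assumes "relations_in N (exps r n)" "1 \<le> r" "d \<le> n"
  shows "relations_in N (exps r d)"
  using assms(3,1) by (induction d rule: inc_induct) (auto intro: relations_in_shift assms(2))

lemma finsum_exps_1:
  assumes "F \<in> exps r 1 \<rightarrow> carrier M"
  shows "(\<Oplus>\<^bsub>M\<^esub>u\<in>exps r 1. monom_val R r a u \<odot>\<^bsub>M\<^esub> F u) = (\<Oplus>\<^bsub>M\<^esub>i\<in>{1..r}. a i \<odot>\<^bsub>M\<^esub> F (unit_exp i))"
proof -
  have inj: "inj_on unit_exp {1..r}" by (intro inj_onI) (auto dest: arg_cong[of _ _ Poly_Mapping.keys])
  have mv: "monom_val R r a (unit_exp i) = a i" if "i \<in> {1..r}" for i
    using R.monom_val_shift[OF a that, of 0] that a by (auto simp: R.monom_val_0 Pi_iff)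
  have "(\<Oplus>\<^bsub>M\<^esub>u\<in>unit_exp ` {1..r}. monom_val R r a u \<odot>\<^bsub>M\<^esub> F u) =
      (\<Oplus>\<^bsub>M\<^esub>i\<in>{1..r}. monom_val R r a (unit_exp i) \<odot>\<^bsub>M\<^esub> F (unit_exp i))"
    using assms R.monom_val_closed[OF a] by (intro M.finsum_reindex inj) (auto simp: exps_1 Pi_iff)
  also have "\<dots> = (\<Oplus>\<^bsub>M\<^esub>i\<in>{1..r}. a i \<odot>\<^bsub>M\<^esub> F (unit_exp i))"
    using assms a by (intro M.finsum_cong') (auto simp: mv exps_1 Pi_iff)
  finally show ?thesis by (simp only: exps_1 One_nat_def)
qed

lemma relations_in_1_iff:
  "relations_in N (exps r 1) \<longleftrightarrow>
    (\<forall>y \<in> {1..r} \<rightarrow> carrier M. (\<Oplus>\<^bsub>M\<^esub>i\<in>{1..r}. a i \<odot>\<^bsub>M\<^esub> y i) = \<zero>\<^bsub>M\<^esub> \<longrightarrow> y \<in> {1..r} \<rightarrow> N)"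
proof
  assume rel: "relations_in N (exps r 1)"
  show "\<forall>y \<in> {1..r} \<rightarrow> carrier M. (\<Oplus>\<^bsub>M\<^esub>i\<in>{1..r}. a i \<odot>\<^bsub>M\<^esub> y i) = \<zero>\<^bsub>M\<^esub> \<longrightarrow> y \<in> {1..r} \<rightarrow> N"
  proof (intro ballI impI Pi_I)
    fix y i assume y: "y \<in> {1..r} \<rightarrow> carrier M" and i: "i \<in> {1..r}"
      and eq: "(\<Oplus>\<^bsub>M\<^esub>i\<in>{1..r}. a i \<odot>\<^bsub>M\<^esub> y i) = \<zero>\<^bsub>M\<^esub>"
    \<comment> \<open>Translates from indices of variables to exponent vectors; distinct variables
      have distinct unit vectors, so the description recovers the index.\<close>
    define F where "F u = y (THE k. u = unit_exp k)" for u
    have Fu: "F (unit_exp k) = y k" for k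
    proof -
      have "(THE k'. unit_exp k = unit_exp k') = k"
        by (rule the_equality) (auto dest: arg_cong[of _ _ Poly_Mapping.keys])
      then show ?thesis by (simp add: F_def)
    qed
    have F: "F \<in> exps r 1 \<rightarrow> carrier M" using y by (auto simp: exps_1 Fu)
    have "(\<Oplus>\<^bsub>M\<^esub>u\<in>exps r 1. monom_val R r a u \<odot>\<^bsub>M\<^esub> F u) = \<zero>\<^bsub>M\<^esub>"
      using finsum_exps_1[OF F] eq by (simp add: Fu)
    from relations_inD[OF rel F this, of "unit_exp i"] show "y i \<in> N"
      using i by (simp add: exps_1 Fu)
  qed
next
  assume lin: "\<forall>y \<in> {1..r} \<rightarrow> carrier M. (\<Oplus>\<^bsub>M\<^esub>i\<in>{1..r}. a i \<odot>\<^bsub>M\<^esub> y i) = \<zero>\<^bsub>M\<^esub> \<longrightarrow> y \<in> {1..r} \<rightarrow> N"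
  show "relations_in N (exps r 1)"
    unfolding relations_in_def
  proof (intro ballI impI)
    fix F assume F: "F \<in> exps r 1 \<rightarrow> carrier M"
      and eq: "(\<Oplus>\<^bsub>M\<^esub>u\<in>exps r 1. monom_val R r a u \<odot>\<^bsub>M\<^esub> F u) = \<zero>\<^bsub>M\<^esub>"
    have "(\<lambda>i. F (unit_exp i)) \<in> {1..r} \<rightarrow> carrier M" using F by (auto simp: exps_1)
    with lin have "(\<lambda>i. F (unit_exp i)) \<in> {1..r} \<rightarrow> N" using finsum_exps_1[OF F] eq by simp
    then show "F \<in> exps r 1 \<rightarrow> N" by (auto simp: exps_1)
  qed
qed

text \<open>Write a vanishing form as \<open>X\<^sub>j G + H\<close> with \<open>H \<in> (X\<^sub>1, \<dots>, X\<^sub>j\<^sub>-\<^sub>1)\<close>.  The value of \<open>G\<close> lies in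
  \<open>\<qq>\<^sub>j\<^sub>-\<^sub>1 M\<close>, hence equals the value of some \<open>K \<in> (X\<^sub>1, \<dots>, X\<^sub>j\<^sub>-\<^sub>1)\<close> of the same degree; then \<open>G - K\<close> and
  \<open>X\<^sub>j K + H\<close> both vanish and are covered by the induction hypotheses.\<close>

lemma relations_in_subexps:
  assumes reg: "relative_regular R M r a" and N: "submodule N R M"
    and lin: "relations_in N (exps r 1)" and "j \<le> r"
  shows "relations_in N (subexps r (Suc d) j)"
  using assms(4)
proof (induction d arbitrary: j)
  case 0
  show ?case
    using relations_in_subset[OF lin finite_exps] subexps_subset[of r "Suc 0" j] by simp
next
  case (Suc d)
  note outer = Suc.IH
  show ?case using Suc.prems
  proof (induction j)
    case 0
    then show ?case by (simp add: subexps_0 relations_in_def)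
  next
    case (Suc j)
    then have j: "Suc j \<le> r" "j \<le> r" "Suc j \<in> {1..r}" by auto
    let ?e = "unit_exp (Suc j)" and ?S = "subexps r (Suc (Suc d)) j" and ?T = "subexps r (Suc d) j"
    let ?E = "exps r (Suc d)"
    let ?V = "{v \<in> ?E. ?e + v \<notin> ?S}"
    let ?mv = "monom_val R r a"
    have finV: "finite ?V" using finite_exps by simp
    have aj: "a (Suc j) \<in> carrier R" using a j by auto
    have split: "subexps r (Suc (Suc d)) (Suc j) = ?S \<union> (+) ?e ` ?V" by (rule subexps_Suc[OF j(1)])
    have T: "?e + v \<in> ?S" if "v \<in> ?T" for v using shift_subexps[OF that j(3)] .
    have TE: "?T \<subseteq> ?E" by (rule subexps_subset)
    have mvc: "?mv u \<in> carrier R" for u using R.monom_val_closed[OF a] .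
    show ?case
      unfolding relations_in_def split
    proof (intro ballI impI)
      fix F assume F: "F \<in> ?S \<union> (+) ?e ` ?V \<rightarrow> carrier M"
        and eq: "(\<Oplus>\<^bsub>M\<^esub>u\<in>?S \<union> (+) ?e ` ?V. ?mv u \<odot>\<^bsub>M\<^esub> F u) = \<zero>\<^bsub>M\<^esub>"
      have FS: "F \<in> ?S \<rightarrow> carrier M" and FV: "F \<in> (+) ?e ` ?V \<rightarrow> carrier M" using F by auto
      \<comment> \<open>The coefficients of the terms divisible by X_(j+1) and by no earlier
        variable, with X_(j+1) removed. Padding by zero to all monomials of degree d + 1 makes z an
        element of q^(d+1) M, where cancellation is available.\<close>
      define G where "G v = (if v \<in> ?V then F (?e + v) else \<zero>\<^bsub>M\<^esub>)" for v
      have G: "G \<in> ?E \<rightarrow> carrier M" using FV by (auto simp: G_def Pi_iff)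
      define h where "h = (\<Oplus>\<^bsub>M\<^esub>u\<in>?S. ?mv u \<odot>\<^bsub>M\<^esub> F u)"
      define z where "z = (\<Oplus>\<^bsub>M\<^esub>v\<in>?E. ?mv v \<odot>\<^bsub>M\<^esub> G v)"
      have hS: "h \<in> forms ?S" unfolding h_def using FS by (rule lin_combsI)
      have zE: "z \<in> forms ?E" unfolding z_def using G by (rule lin_combsI)
      have hc: "h \<in> carrier M" and zc: "z \<in> carrier M"
        using submodule_carrier[OF submodule_forms[OF finite_subexps] hS]
          submodule_carrier[OF submodule_forms[OF finite_exps] zE] by auto
      have "(\<Oplus>\<^bsub>M\<^esub>u\<in>?S \<union> (+) ?e ` ?V. ?mv u \<odot>\<^bsub>M\<^esub> F u) =
          h \<oplus>\<^bsub>M\<^esub> (\<Oplus>\<^bsub>M\<^esub>u\<in>(+) ?e ` ?V. ?mv u \<odot>\<^bsub>M\<^esub> F u)"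
        unfolding h_def using finite_subexps finV FS FV mvc
        by (intro M.finsum_Un_disjoint) (auto simp: Pi_iff)
      also have "(\<Oplus>\<^bsub>M\<^esub>u\<in>(+) ?e ` ?V. ?mv u \<odot>\<^bsub>M\<^esub> F u) =
          a (Suc j) \<odot>\<^bsub>M\<^esub> (\<Oplus>\<^bsub>M\<^esub>v\<in>?V. ?mv v \<odot>\<^bsub>M\<^esub> F (?e + v))"
        by (rule finsum_shift[OF finV j(3) FV])
      also have "(\<Oplus>\<^bsub>M\<^esub>v\<in>?V. ?mv v \<odot>\<^bsub>M\<^esub> F (?e + v)) = z"
        unfolding z_def G_def using FV
        by (intro finsum_extend[symmetric] finite_exps monom_val_fun) auto
      finally have hz: "h \<oplus>\<^bsub>M\<^esub> a (Suc j) \<odot>\<^bsub>M\<^esub> z = \<zero>\<^bsub>M\<^esub>" using eq by simp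
      have "h \<in> linear j" using hS forms_subexps_linear[OF j(2)] by blast
      moreover have "a (Suc j) \<odot>\<^bsub>M\<^esub> z \<oplus>\<^bsub>M\<^esub> h \<in> linear j"
        using hz hc zc aj submodule_zero[OF submodule_linear[OF j(2)]] by (simp add: M.a_comm)
      ultimately have "a (Suc j) \<odot>\<^bsub>M\<^esub> z \<in> linear j"
        using submodule_add_cancel[OF submodule_linear[OF j(2)]] aj zc by blast
      moreover have "z \<in> linear r"
        using zE forms_subexps_linear[of r d] by (auto simp: subexps_Suc_self)
      ultimately have "z \<in> linear j" using reg j unfolding relative_regular_def by auto
      then have "z \<in> forms ?T" using linear_Int_forms[OF reg j(2)] zE by blast
      then obtain K where K: "K \<in> ?T \<rightarrow> carrier M" "z = (\<Oplus>\<^bsub>M\<^esub>v\<in>?T. ?mv v \<odot>\<^bsub>M\<^esub> K v)"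
        by (rule lin_combsE)
      define K' where "K' v = (if v \<in> ?T then K v else \<zero>\<^bsub>M\<^esub>)" for v
      have K': "K' \<in> ?E \<rightarrow> carrier M" using K by (auto simp: K'_def)
      have zK': "z = (\<Oplus>\<^bsub>M\<^esub>v\<in>?E. ?mv v \<odot>\<^bsub>M\<^esub> K' v)"
        unfolding K(2) K'_def using K TE
        by (intro finsum_extend[symmetric] finite_exps monom_val_fun) auto
      have "(\<Oplus>\<^bsub>M\<^esub>v\<in>?E. ?mv v \<odot>\<^bsub>M\<^esub> (G v \<ominus>\<^bsub>M\<^esub> K' v)) = z \<ominus>\<^bsub>M\<^esub> z"
        using finsum_smult_diff[OF finite_exps monom_val_fun G K'] zK' z_def by simp
      then have "(\<Oplus>\<^bsub>M\<^esub>v\<in>?E. ?mv v \<odot>\<^bsub>M\<^esub> (G v \<ominus>\<^bsub>M\<^esub> K' v)) = \<zero>\<^bsub>M\<^esub>"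
        using zc by (simp add: a_minus_def M.r_neg)
      \<comment> \<open>The difference G - K involves all variables but has lower degree, so the
        outer hypothesis is taken at j = r. Below, H + X_(j+1) K has the full degree but lies in
        (X_1, ..., X_j), which is the inner hypothesis.\<close>
      moreover have "relations_in N ?E" using outer[of r] by (simp add: subexps_Suc_self)
      moreover have "(\<lambda>v. G v \<ominus>\<^bsub>M\<^esub> K' v) \<in> ?E \<rightarrow> carrier M" using G K' by (auto simp: Pi_iff)
      ultimately have GK: "G v \<ominus>\<^bsub>M\<^esub> K' v \<in> N" if "v \<in> ?E" for v
        using relations_inD[of N ?E "\<lambda>v. G v \<ominus>\<^bsub>M\<^esub> K' v" v] that by blast
      \<comment> \<open>This is X_(j+1) K; multiplying by a variable keeps its monomials in the
        ideal (X_1, ..., X_j), so it can be added to H on \<open>?S\<close>.\<close>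
      define L where "L u = (if u \<in> (+) ?e ` ?T then K (u - ?e) else \<zero>\<^bsub>M\<^esub>)" for u
      have KT: "(\<lambda>u. K (u - ?e)) \<in> (+) ?e ` ?T \<rightarrow> carrier M" using K by (auto simp: Pi_iff)
      have L: "L \<in> ?S \<rightarrow> carrier M" using KT by (auto simp: L_def)
      have "(\<Oplus>\<^bsub>M\<^esub>u\<in>?S. ?mv u \<odot>\<^bsub>M\<^esub> L u) = (\<Oplus>\<^bsub>M\<^esub>u\<in>(+) ?e ` ?T. ?mv u \<odot>\<^bsub>M\<^esub> K (u - ?e))"
        unfolding L_def using T by (intro finsum_extend finite_subexps monom_val_fun KT) auto
      also have "\<dots> = a (Suc j) \<odot>\<^bsub>M\<^esub> z"
        using finsum_shift[OF finite_subexps j(3) KT] K(2) by simp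
      finally have "(\<Oplus>\<^bsub>M\<^esub>u\<in>?S. ?mv u \<odot>\<^bsub>M\<^esub> (F u \<oplus>\<^bsub>M\<^esub> L u)) = \<zero>\<^bsub>M\<^esub>"
        using finsum_smult_add[OF monom_val_fun FS L] hz by (simp add: h_def)
      moreover have "(\<lambda>u. F u \<oplus>\<^bsub>M\<^esub> L u) \<in> ?S \<rightarrow> carrier M" using FS L by (auto simp: Pi_iff)
      ultimately have FL: "F u \<oplus>\<^bsub>M\<^esub> L u \<in> N" if "u \<in> ?S" for u
        using relations_inD[OF Suc.IH[OF j(2)], of "\<lambda>u. F u \<oplus>\<^bsub>M\<^esub> L u" u] that by blast
      show "F \<in> ?S \<union> (+) ?e ` ?V \<rightarrow> N"
      proof (rule Pi_I)
        fix u assume "u \<in> ?S \<union> (+) ?e ` ?V"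
        \<comment> \<open>The delicate case is the second, where H and X_(j+1) K overlap. There v
          lies outside \<open>?V\<close>, so G v is zero and the relation G - K alone forces K v
          into N; the relation H + X_(j+1) K then gives F u.\<close>
        then consider "u \<in> ?S" "u \<notin> (+) ?e ` ?T" | v where "v \<in> ?T" "u = ?e + v"
          | v where "v \<in> ?V" "u = ?e + v" using T by auto
        then show "F u \<in> N"
        proof cases
          case 1
          then show ?thesis using FL[of u] FS by (auto simp: L_def Pi_iff)
        next
          case 2
          then have S: "u \<in> ?S" and v: "v \<in> ?E" using T TE by auto
          have c: "K v \<in> carrier M" using 2 K by auto
          have "G v = \<zero>\<^bsub>M\<^esub>" "K' v = K v" using 2 S by (auto simp: G_def K'_def)
          then have "\<ominus>\<^bsub>M\<^esub> K v \<in> N" using GK[OF v] c by (simp add: a_minus_def)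
          then have "K v \<in> N" using submoduleE(3)[OF N] c by (metis M.minus_minus)
          moreover have "L u = K v" using 2 by (auto simp: L_def)
          ultimately show ?thesis using FL[OF S] submodule_add_cancel[OF N] FS S by (metis Pi_mem)
        next
          case 3
          then have "v \<notin> ?T" "v \<in> ?E" using T by auto
          then have "K' v = \<zero>\<^bsub>M\<^esub>" "G v = F u" using 3 by (auto simp: K'_def G_def)
          moreover have "F u \<in> carrier M" using 3 FV by auto
          moreover have "F u \<ominus>\<^bsub>M\<^esub> \<zero>\<^bsub>M\<^esub> \<in> N" using GK[OF \<open>v \<in> ?E\<close>] calculation by simp
          ultimately show ?thesis
            using submodule_add_cancel[OF N, of "F u" "\<ominus>\<^bsub>M\<^esub> \<zero>\<^bsub>M\<^esub>"] submoduleE(3)[OF N submodule_zero[OF N]]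
            by (simp add: a_minus_def)
        qed
      qed
    qed
  qed
qed

lemma relations_in_all:
  assumes "relative_regular R M r a" "submodule N R M" "relations_in N (exps r 1)"
  shows "relations_in N (exps r d)"
proof (cases d)
  case 0
  show ?thesis
    unfolding relations_in_def
  proof (intro ballI impI Pi_I)
    fix F u assume F: "F \<in> exps r d \<rightarrow> carrier M" and u: "u \<in> exps r d"
      and eq: "(\<Oplus>\<^bsub>M\<^esub>u\<in>exps r d. monom_val R r a u \<odot>\<^bsub>M\<^esub> F u) = \<zero>\<^bsub>M\<^esub>"
    have "F 0 \<in> carrier M" "u = 0" using F u 0 by (auto simp: exps_0)
    moreover have "(\<Oplus>\<^bsub>M\<^esub>u\<in>{0}. monom_val R r a u \<odot>\<^bsub>M\<^esub> F u) = F 0"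
      using \<open>F 0 \<in> carrier M\<close> by (subst M.finsum_insert) (auto simp: R.monom_val_0)
    ultimately show "F u \<in> N" using eq 0 submodule_zero[OF assms(2)] by (simp add: exps_0)
  qed
next
  case (Suc d')
  then show ?thesis using relations_in_subexps[OF assms, of r d'] by (simp add: subexps_Suc_self)
qed

end

section \<open>Length\<close>

text \<open>Stated for an arbitrary family of sets, so that lengths of quotients and of intervals of
  submodules of M, which live on different types, can be compared.\<close>

definition is_chain :: "'x set set \<Rightarrow> nat \<Rightarrow> (nat \<Rightarrow> 'x set) \<Rightarrow> bool"
  where "is_chain S n C \<longleftrightarrow> (\<forall>i\<le>n. C i \<in> S) \<and> (\<forall>i<n. C i \<subset> C (Suc i))"

definition chain_length :: "'x set set \<Rightarrow> enat"
  where "chain_length S = Sup {enat n | n. \<exists>C. is_chain S n C}"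

lemma module_length_eq: "module_length A M = chain_length {H. submodule H A M}"
  by (simp add: module_length_def chain_length_def is_chain_def)

lemma chain_length_ge: "is_chain S n C \<Longrightarrow> enat n \<le> chain_length S"
  unfolding chain_length_def by (rule Sup_upper) blast

lemma chain_length_least: "(\<And>n C. is_chain S n C \<Longrightarrow> enat n \<le> k) \<Longrightarrow> chain_length S \<le> k"
  unfolding chain_length_def by (rule Sup_least) blast

text \<open>A strictly monotone map sends chains to chains of the same length. Equality of two
  lengths thus follows from one such map in each direction, without a bijection of lattices.\<close>

lemma chain_length_embed:
  assumes "\<And>H. H \<in> S \<Longrightarrow> f H \<in> T" "\<And>H K. H \<in> S \<Longrightarrow> K \<in> S \<Longrightarrow> H \<subset> K \<Longrightarrow> f H \<subset> f K"
  shows "chain_length S \<le> chain_length T"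
proof (rule chain_length_least)
  fix n C assume "is_chain S n C"
  then have "is_chain T n (\<lambda>i. f (C i))" using assms by (auto simp: is_chain_def)
  then show "enat n \<le> chain_length T" by (rule chain_length_ge)
qed

lemma chain_length_mono: "S \<subseteq> T \<Longrightarrow> chain_length S \<le> chain_length T"
  by (rule chain_length_embed[where f = "\<lambda>H. H"]) auto

text \<open>A finite supremum of a nonempty set of naturals in \<open>enat\<close> is a maximum; a
  member of \<open>S\<close> supplies the chain of length 0 that makes the set nonempty.\<close>

lemma chain_length_attained:
  assumes "S \<noteq> {}" "chain_length S = enat k"
  shows "\<exists>C. is_chain S k C"
proof -
  let ?A = "{enat n | n. \<exists>C. is_chain S n C}"
  obtain s where "s \<in> S" using assms(1) by blast
  then have "is_chain S 0 (\<lambda>_. s)" by (simp add: is_chain_def)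
  then have ne: "?A \<noteq> {}" by blast
  then have "finite ?A" "Sup ?A = Max ?A"
    using assms(2) unfolding chain_length_def Sup_enat_def by (auto split: if_splits)
  then have "enat k \<in> ?A" using Max_in[OF _ ne] assms(2) unfolding chain_length_def by metis
  then show ?thesis by auto
qed

lemma chain_length_singleton: "chain_length {H} = 0"
proof -
  have "enat n \<le> 0" if C: "is_chain {H} n C" for n C
  proof (cases n)
    case 0
    then show ?thesis by (simp add: zero_enat_def)
  next
    case (Suc k)
    then have "C 0 = H" "C (Suc 0) = H" "C 0 \<subset> C (Suc 0)" using C unfolding is_chain_def by auto
    then show ?thesis by simp
  qed
  then have "chain_length {H} \<le> 0" by (rule chain_length_least)
  then show ?thesis by simp
qed

lemma is_chain_extend:
  assumes "is_chain S n C" "K \<in> S" "C n \<subset> K"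
  shows "is_chain S (Suc n) (C(Suc n := K))"
  using assms by (auto simp: is_chain_def le_Suc_eq less_Suc_eq)

section \<open>Lengths of subquotients and their additivity\<close>

context module
begin

text \<open>For Q contained in P this is the lattice of submodules of P/Q, kept inside M so that
  several subquotients can be compared without changing the type of elements.\<close>

definition between :: "'c set \<Rightarrow> 'c set \<Rightarrow> 'c set set"
  where "between Q P = {H. submodule H R M \<and> Q \<subseteq> H \<and> H \<subseteq> P}"

text \<open>The correspondence of submodules under M to M/N, read through preimages in one direction
  and images in the other; strictness of the second map uses that the submodules contain N.\<close>

lemma module_length_FactModule:
  assumes N: "submodule N R M"
  shows "module_length R (FactModule M N) = chain_length (between N (carrier M))"
proof -
  let ?L = "FactModule M N"
  interpret L: module R ?L by (rule module_FactModule[OF module_axioms N])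
  note L = FactModule_ops[OF module_axioms N] and eq = coset_eq_iff[OF module_axioms N]
  have "chain_length {H. submodule H R ?L} \<le> chain_length (between N (carrier M))"
  proof (rule chain_length_embed[where f = "\<lambda>H. {x \<in> carrier M. N +>\<^bsub>M\<^esub> x \<in> H}"])
    fix H assume "H \<in> {H. submodule H R ?L}"
    then have H: "submodule H R ?L" by simp
    have "N +>\<^bsub>M\<^esub> x \<in> H" if "x \<in> N" for x
    proof -
      have "N +>\<^bsub>M\<^esub> x = N +>\<^bsub>M\<^esub> \<zero>\<^bsub>M\<^esub>"
        using eq[of x "\<zero>\<^bsub>M\<^esub>"] submodule_carrier[OF N that] submodule_minus[OF N that submodule_zero[OF N]] by simp
      then show ?thesis using L.submodule_zero[OF H] L by simp
    qed
    then show "{x \<in> carrier M. N +>\<^bsub>M\<^esub> x \<in> H} \<in> between N (carrier M)"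
      using submodule_coset_preimage[OF module_axioms N H] submodule_carrier[OF N] by (auto simp: between_def)
  next
    fix H H' assume "H \<in> {H. submodule H R ?L}" "H' \<in> {H. submodule H R ?L}" and lt: "H \<subset> H'"
    then have "H' \<subseteq> carrier ?L" using L.submoduleE(1)[of H'] by simp
    moreover obtain c where "c \<in> H'" "c \<notin> H" using lt by blast
    ultimately obtain x where "x \<in> carrier M" "N +>\<^bsub>M\<^esub> x \<in> H'" "N +>\<^bsub>M\<^esub> x \<notin> H"
      unfolding L(1) by blast
    then show "{x \<in> carrier M. N +>\<^bsub>M\<^esub> x \<in> H} \<subset> {x \<in> carrier M. N +>\<^bsub>M\<^esub> x \<in> H'}" using lt by blast
  qed
  moreover have "chain_length (between N (carrier M)) \<le> chain_length {H. submodule H R ?L}"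
  proof (rule chain_length_embed[where f = "\<lambda>K. (\<lambda>x. N +>\<^bsub>M\<^esub> x) ` K"])
    show "(\<lambda>x. N +>\<^bsub>M\<^esub> x) ` K \<in> {H. submodule H R ?L}" if "K \<in> between N (carrier M)" for K
      using submodule_coset_image[OF module_axioms N] that by (simp add: between_def)
    fix K K' assume K: "K \<in> between N (carrier M)" "K' \<in> between N (carrier M)" and lt: "K \<subset> K'"
    then have sK: "submodule K R M" "N \<subseteq> K" and sK': "submodule K' R M" by (auto simp: between_def)
    obtain x where x: "x \<in> K'" "x \<notin> K" using lt by blast
    have "N +>\<^bsub>M\<^esub> x \<notin> (\<lambda>x. N +>\<^bsub>M\<^esub> x) ` K"
    proof
      assume "N +>\<^bsub>M\<^esub> x \<in> (\<lambda>x. N +>\<^bsub>M\<^esub> x) ` K"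
      then obtain y where y: "y \<in> K" "N +>\<^bsub>M\<^esub> x = N +>\<^bsub>M\<^esub> y" by blast
      have c: "x \<in> carrier M" "y \<in> carrier M"
        using x y submodule_carrier[OF sK(1)] submodule_carrier[OF sK'] by auto
      then have "x \<ominus>\<^bsub>M\<^esub> y \<in> K" using eq y sK(2) by blast
      then have "x \<in> K" using submodule_add_cancel[OF sK(1) c(1), of "\<ominus>\<^bsub>M\<^esub> y"] submoduleE(3)[OF sK(1) y(1)]
        by (simp add: a_minus_def)
      then show False using x by simp
    qed
    then show "(\<lambda>x. N +>\<^bsub>M\<^esub> x) ` K \<subset> (\<lambda>x. N +>\<^bsub>M\<^esub> x) ` K'" using lt x by blast
  qed
  ultimately show ?thesis unfolding module_length_eq by (rule antisym)
qed

lemma submodule_carrier_update: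
  assumes P: "submodule P R M"
  shows "submodule H R (M\<lparr>carrier := P\<rparr>) \<longleftrightarrow> submodule H R M \<and> H \<subseteq> P"
proof -
  interpret MP: module R "M\<lparr>carrier := P\<rparr>" by (rule submodule.submodule_is_module[OF P module_axioms])
  show ?thesis
  proof (intro iffI conjI)
    assume H: "submodule H R (M\<lparr>carrier := P\<rparr>)"
    show "H \<subseteq> P" using MP.submoduleE(1)[OF H] by simp
    then show "submodule H R M"
      using submodule_carrier[OF P] MP.submoduleE(4,5)[OF H] MP.submodule_zero[OF H]
      by (intro submodule_criterion) auto
  next
    assume H: "submodule H R M \<and> H \<subseteq> P"
    then have sH: "submodule H R M" by simp
    show "submodule H R (M\<lparr>carrier := P\<rparr>)"
      using H submoduleE(4,5)[OF sH] submodule_zero[OF sH] by (intro MP.submodule_criterion) auto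
  qed
qed

lemma module_length_SubFactModule:
  assumes P: "submodule P R M" and Q: "submodule Q R M" and QP: "Q \<subseteq> P"
  shows "module_length R (SubFactModule M P Q) = chain_length (between Q P)"
proof -
  interpret MP: module R "M\<lparr>carrier := P\<rparr>" by (rule submodule.submodule_is_module[OF P module_axioms])
  have "submodule Q R (M\<lparr>carrier := P\<rparr>)" using submodule_carrier_update[OF P] Q QP by simp
  then have "module_length R (SubFactModule M P Q) = chain_length (MP.between Q P)"
    using MP.module_length_FactModule by (simp add: SubFactModule_def)
  moreover have "MP.between Q P = between Q P"
    unfolding MP.between_def between_def submodule_carrier_update[OF P] by blast
  ultimately show ?thesis by simp
qed

lemma between_refl: "submodule Q R M \<Longrightarrow> between Q Q = {Q}"
  by (auto simp: between_def)

lemma chain_length_between_pos: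
  assumes "submodule Q R M" "submodule P R M" "Q \<subset> P"
  shows "1 \<le> chain_length (between Q P)"
proof -
  have "is_chain (between Q P) 1 (\<lambda>i. if i = 0 then Q else P)"
    using assms by (auto simp: is_chain_def between_def)
  then show ?thesis using chain_length_ge by (metis one_enat_def)
qed

text \<open>Each term H of the chain is sent to H \<inter> S and H + S; by the modular law a strict
  inclusion stays strict in at least one of them. Recording the last terms of both new chains lets
  the induction append to them.\<close>

lemma between_chain_split:
  assumes Q: "submodule Q R M" and S: "submodule S R M" and P: "submodule P R M"
    and QS: "Q \<subseteq> S" and SP: "S \<subseteq> P"
  shows "is_chain (between Q P) n C \<Longrightarrow>
    \<exists>k l C' C''. n \<le> k + l \<and> is_chain (between Q S) k C' \<and> C' k = C n \<inter> S \<and>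
      is_chain (between S P) l C'' \<and> C'' l = C n <+>\<^bsub>M\<^esub> S"
proof (induction n)
  have meet: "H \<inter> S \<in> between Q S" and join: "H <+>\<^bsub>M\<^esub> S \<in> between S P" if "H \<in> between Q P" for H
    using that submodule_Int[OF _ S] submodule_set_add[OF _ S] set_add_upper2[OF _ S]
      set_add_least[OF P _ SP] QS by (auto simp: between_def)
  {
    case 0
    then have "C 0 \<in> between Q P" by (simp add: is_chain_def)
    then show ?case
      using meet join
      by (intro exI[of _ 0] exI[of _ "\<lambda>_. C 0 \<inter> S"] exI[of _ "\<lambda>_. C 0 <+>\<^bsub>M\<^esub> S"]) (auto simp: is_chain_def)
  next
    case (Suc n)
    then have C: "is_chain (between Q P) n C" "C n \<in> between Q P" "C (Suc n) \<in> between Q P" "C n \<subset> C (Suc n)"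
      by (auto simp: is_chain_def)
    then have sub: "submodule (C n) R M" "submodule (C (Suc n)) R M" by (auto simp: between_def)
    from Suc.IH[OF C(1)] obtain k l C' C'' where *: "n \<le> k + l"
      "is_chain (between Q S) k C'" "C' k = C n \<inter> S"
      "is_chain (between S P) l C''" "C'' l = C n <+>\<^bsub>M\<^esub> S" by blast
    have le: "C n \<inter> S \<subseteq> C (Suc n) \<inter> S" "C n <+>\<^bsub>M\<^esub> S \<subseteq> C (Suc n) <+>\<^bsub>M\<^esub> S"
      using C(4) set_add_mono[of "C n" "C (Suc n)" S S] by auto
    \<comment> \<open>Modular law: if H is contained in H' and both have the same intersection and
      the same sum with S, then x in H' is c + s with c in H, and s = x - c lies in H' \<inter> S =
      H \<inter> S.\<close>
    have strict: "C n \<inter> S \<noteq> C (Suc n) \<inter> S \<or> C n <+>\<^bsub>M\<^esub> S \<noteq> C (Suc n) <+>\<^bsub>M\<^esub> S"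
    proof (rule ccontr)
      assume "\<not> ?thesis"
      then have eq: "C n \<inter> S = C (Suc n) \<inter> S" "C n <+>\<^bsub>M\<^esub> S = C (Suc n) <+>\<^bsub>M\<^esub> S" by auto
      have "C (Suc n) \<subseteq> C n"
      proof
        fix x assume x: "x \<in> C (Suc n)"
        then have "x \<in> C n <+>\<^bsub>M\<^esub> S" using set_add_upper1[OF sub(2) S] eq(2) by blast
        then obtain c s where cs: "c \<in> C n" "s \<in> S" "x = c \<oplus>\<^bsub>M\<^esub> s" by (auto simp: mem_set_add)
        have car: "c \<in> carrier M" "s \<in> carrier M"
          using cs submodule_carrier[OF sub(1)] submodule_carrier[OF S] by auto
        have "s \<in> C (Suc n)"
          using submodule_add_cancel[OF sub(2) car(2), of c] cs x car C(4) by (auto simp: M.a_comm)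
        then have "s \<in> C n" using cs eq(1) by blast
        then show "x \<in> C n" using cs submoduleE(5)[OF sub(1)] by blast
      qed
      then show False using C(4) by blast
    qed
    have ext': "\<exists>k' C'. k \<le> k' \<and> (C n \<inter> S \<noteq> C (Suc n) \<inter> S \<longrightarrow> k < k') \<and>
        is_chain (between Q S) k' C' \<and> C' k' = C (Suc n) \<inter> S"
    proof (cases "C n \<inter> S = C (Suc n) \<inter> S")
      case True
      then show ?thesis using *(2,3) by auto
    next
      case False
      then have "is_chain (between Q S) (Suc k) (C'(Suc k := C (Suc n) \<inter> S))"
        using is_chain_extend[OF *(2) meet[OF C(3)]] *(3) le(1) by blast
      then show ?thesis by (intro exI[of _ "Suc k"]) auto
    qed
    have ext'': "\<exists>l' C''. l \<le> l' \<and> (C n <+>\<^bsub>M\<^esub> S \<noteq> C (Suc n) <+>\<^bsub>M\<^esub> S \<longrightarrow> l < l') \<and>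
        is_chain (between S P) l' C'' \<and> C'' l' = C (Suc n) <+>\<^bsub>M\<^esub> S"
    proof (cases "C n <+>\<^bsub>M\<^esub> S = C (Suc n) <+>\<^bsub>M\<^esub> S")
      case True
      then show ?thesis using *(4,5) by auto
    next
      case False
      then have "is_chain (between S P) (Suc l) (C''(Suc l := C (Suc n) <+>\<^bsub>M\<^esub> S))"
        using is_chain_extend[OF *(4) join[OF C(3)]] *(5) le(2) by blast
      then show ?thesis by (intro exI[of _ "Suc l"]) auto
    qed
    from ext' obtain k' D' where k': "k \<le> k'" "C n \<inter> S \<noteq> C (Suc n) \<inter> S \<longrightarrow> k < k'"
      "is_chain (between Q S) k' D'" "D' k' = C (Suc n) \<inter> S" by blast
    from ext'' obtain l' D'' where l': "l \<le> l'" "C n <+>\<^bsub>M\<^esub> S \<noteq> C (Suc n) <+>\<^bsub>M\<^esub> S \<longrightarrow> l < l'"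
      "is_chain (between S P) l' D''" "D'' l' = C (Suc n) <+>\<^bsub>M\<^esub> S" by blast
    have "Suc n \<le> k' + l'" using strict k'(1,2) l'(1,2) *(1) by linarith
    then show ?case using k'(3,4) l'(3,4) by blast
  }
qed

text \<open>The upper bound is the splitting of chains, the lower bound their concatenation at S.
  The latter requires chains of maximal length, available when the total is finite; otherwise the
  inequality is trivial.\<close>

lemma chain_length_between_add:
  assumes Q: "submodule Q R M" and S: "submodule S R M" and P: "submodule P R M"
    and QS: "Q \<subseteq> S" and SP: "S \<subseteq> P"
  shows "chain_length (between Q P) = chain_length (between Q S) + chain_length (between S P)"
proof (rule antisym)
  show "chain_length (between Q P) \<le> chain_length (between Q S) + chain_length (between S P)"
  proof (rule chain_length_least)
    fix n C assume "is_chain (between Q P) n C"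
    from between_chain_split[OF assms this] obtain k l C' C'' where *: "n \<le> k + l"
      "is_chain (between Q S) k C'" "is_chain (between S P) l C''" by blast
    have "enat n \<le> enat k + enat l" using *(1) by simp
    also have "\<dots> \<le> chain_length (between Q S) + chain_length (between S P)"
      using *(2,3) by (intro add_mono chain_length_ge)
    finally show "enat n \<le> chain_length (between Q S) + chain_length (between S P)" .
  qed
  have le: "chain_length (between Q S) \<le> chain_length (between Q P)"
    "chain_length (between S P) \<le> chain_length (between Q P)"
    using QS SP by (auto intro!: chain_length_mono simp: between_def)
  show "chain_length (between Q S) + chain_length (between S P) \<le> chain_length (between Q P)"
  proof (cases "chain_length (between Q P)")
    case (enat p)
    then obtain k l where kl: "chain_length (between Q S) = enat k" "chain_length (between S P) = enat l"
      using le by (metis enat_ord_simps(5) not_enat_eq)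
    have "Q \<in> between Q S" "S \<in> between S P" using Q S QS SP by (auto simp: between_def)
    then obtain C D where C: "is_chain (between Q S) k C" and D: "is_chain (between S P) l D"
      using chain_length_attained[OF _ kl(1)] chain_length_attained[OF _ kl(2)] by blast
    \<comment> \<open>The junction goes from \<open>C k\<close> directly to \<open>D 1\<close>,
      skipping \<open>D 0\<close>. The inclusions of \<open>C k\<close> in S and of S in
      \<open>D 0\<close> then give strictness even when both are equalities, and the length is still
      k + l.\<close>
    define E where "E i = (if i \<le> k then C i else D (i - k))" for i
    have "is_chain (between Q P) (k + l) E"
      unfolding is_chain_def
    proof (intro conjI allI impI)
      fix i assume i: "i \<le> k + l"
      show "E i \<in> between Q P"
      proof (cases "i \<le> k")
        case True
        then have "C i \<in> between Q S" using C by (simp add: is_chain_def)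
        then show ?thesis using True SP by (auto simp: E_def between_def)
      next
        case False
        then have "D (i - k) \<in> between S P" using D i by (simp add: is_chain_def)
        then show ?thesis using False QS by (auto simp: E_def between_def)
      qed
    next
      fix i assume i: "i < k + l"
      consider "i < k" | "i = k" | "k < i" by linarith
      then show "E i \<subset> E (Suc i)"
      proof cases
        case 1
        then show ?thesis using C by (simp add: E_def is_chain_def)
      next
        case 2
        then have "C k \<subseteq> S" "S \<subseteq> D 0" "D 0 \<subset> D (Suc 0)"
          using C D i by (auto simp: is_chain_def between_def)
        then show ?thesis using 2 by (auto simp: E_def)
      next
        case 3
        then have "D (i - k) \<subset> D (Suc (i - k))" using D i by (simp add: is_chain_def)
        then show ?thesis using 3 by (simp add: E_def Suc_diff_le)
      qed
    qed
    then show ?thesis using chain_length_ge kl by fastforce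
  qed simp
qed

text \<open>Multiplication by t induces an isomorphism from M/(W : t) onto (W + tM)/W. On submodules
  it appears as the two strictly monotone maps taking H to H : t and K to W + tK.\<close>

lemma chain_length_scaled:
  assumes W: "submodule W R M" and t: "t \<in> carrier R"
  shows "chain_length (between W (W <+>\<^bsub>M\<^esub> (\<lambda>x. t \<odot>\<^bsub>M\<^esub> x) ` carrier M)) =
    chain_length (between (module_colon M W t) (carrier M))" (is "chain_length (between W ?P) = _")
proof (rule antisym)
  note sc = submodule_scaled[OF t]
  show "chain_length (between W ?P) \<le> chain_length (between (module_colon M W t) (carrier M))"
  proof (rule chain_length_embed[where f = "\<lambda>H. module_colon M H t"])
    show "module_colon M H t \<in> between (module_colon M W t) (carrier M)" if "H \<in> between W ?P" for H
      using that submodule_colon[OF _ t, of H] by (auto simp: between_def module_colon_def)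
    fix H H' assume H: "H \<in> between W ?P" "H' \<in> between W ?P" and lt: "H \<subset> H'"
    then have sH: "submodule H R M" "W \<subseteq> H" and sH': "submodule H' R M" "W \<subseteq> H'" "H' \<subseteq> ?P"
      by (auto simp: between_def)
    obtain h where h: "h \<in> H'" "h \<notin> H" using lt by blast
    then obtain w x where wx: "w \<in> W" "x \<in> carrier M" "h = w \<oplus>\<^bsub>M\<^esub> t \<odot>\<^bsub>M\<^esub> x"
      using sH'(3) unfolding subset_iff mem_set_add by blast
    have wc: "w \<in> carrier M" using wx submodule_carrier[OF W] by simp
    have "t \<odot>\<^bsub>M\<^esub> x \<in> H'"
      using submodule_add_cancel[OF sH'(1), of "t \<odot>\<^bsub>M\<^esub> x" w] wx wc h t sH'(2) by (auto simp: M.a_comm)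
    moreover have "t \<odot>\<^bsub>M\<^esub> x \<notin> H" using wx h sH submoduleE(5)[OF sH(1)] by blast
    ultimately show "module_colon M H t \<subset> module_colon M H' t"
      using lt wx(2) by (auto simp: module_colon_def)
  qed
  show "chain_length (between (module_colon M W t) (carrier M)) \<le> chain_length (between W ?P)"
  proof (rule chain_length_embed[where f = "\<lambda>K. W <+>\<^bsub>M\<^esub> (\<lambda>x. t \<odot>\<^bsub>M\<^esub> x) ` K"])
    fix K assume K: "K \<in> between (module_colon M W t) (carrier M)"
    then have sK: "submodule K R M" "K \<subseteq> carrier M" by (auto simp: between_def)
    show "W <+>\<^bsub>M\<^esub> (\<lambda>x. t \<odot>\<^bsub>M\<^esub> x) ` K \<in> between W ?P"
      using submodule_set_add[OF W sc[OF sK(1)]] set_add_upper1[OF W sc[OF sK(1)]]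
        set_add_mono[OF subset_refl[of W] image_mono[OF sK(2), of "\<lambda>x. t \<odot>\<^bsub>M\<^esub> x"]]
      by (simp add: between_def)
  next
    fix K K' assume K: "K \<in> between (module_colon M W t) (carrier M)"
      "K' \<in> between (module_colon M W t) (carrier M)" and lt: "K \<subset> K'"
    then have sK: "submodule K R M" "module_colon M W t \<subseteq> K" and sK': "submodule K' R M"
      by (auto simp: between_def)
    obtain x where x: "x \<in> K'" "x \<notin> K" using lt by blast
    have xc: "x \<in> carrier M" using x submodule_carrier[OF sK'] by simp
    have "t \<odot>\<^bsub>M\<^esub> x \<notin> W <+>\<^bsub>M\<^esub> (\<lambda>x. t \<odot>\<^bsub>M\<^esub> x) ` K"
    proof
      assume "t \<odot>\<^bsub>M\<^esub> x \<in> W <+>\<^bsub>M\<^esub> (\<lambda>x. t \<odot>\<^bsub>M\<^esub> x) ` K"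
      then obtain w k where wk: "w \<in> W" "k \<in> K" "t \<odot>\<^bsub>M\<^esub> x = w \<oplus>\<^bsub>M\<^esub> t \<odot>\<^bsub>M\<^esub> k"
        by (auto simp: mem_set_add)
      have c: "w \<in> carrier M" "k \<in> carrier M"
        using wk submodule_carrier[OF W] submodule_carrier[OF sK(1)] by auto
      have "t \<odot>\<^bsub>M\<^esub> (x \<ominus>\<^bsub>M\<^esub> k) = w"
        using wk c xc t by (simp add: a_minus_def smult_r_distr smult_r_minus M.a_assoc M.r_neg)
      then have "x \<ominus>\<^bsub>M\<^esub> k \<in> K" using sK(2) wk(1) xc c by (auto simp: module_colon_def)
      then have "x \<in> K" using submodule_add_cancel[OF sK(1) xc, of "\<ominus>\<^bsub>M\<^esub> k"] submoduleE(3)[OF sK(1) wk(2)]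
        by (simp add: a_minus_def)
      then show False using x by simp
    qed
    moreover have "t \<odot>\<^bsub>M\<^esub> x \<in> W <+>\<^bsub>M\<^esub> (\<lambda>x. t \<odot>\<^bsub>M\<^esub> x) ` K'"
      using set_add_upper2[OF W sc[OF sK']] x(1) by blast
    moreover have "W <+>\<^bsub>M\<^esub> (\<lambda>x. t \<odot>\<^bsub>M\<^esub> x) ` K \<subseteq> W <+>\<^bsub>M\<^esub> (\<lambda>x. t \<odot>\<^bsub>M\<^esub> x) ` K'"
      using lt by (intro set_add_mono) auto
    ultimately show "W <+>\<^bsub>M\<^esub> (\<lambda>x. t \<odot>\<^bsub>M\<^esub> x) ` K \<subset> W <+>\<^bsub>M\<^esub> (\<lambda>x. t \<odot>\<^bsub>M\<^esub> x) ` K'" by blast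
  qed
qed

end

section \<open>The filtration by monomials\<close>

lemma (in module) lin_combs_insert:
  assumes "finite U" "u \<notin> U" "c \<in> insert u U \<rightarrow> carrier R"
  shows "lin_combs R M (insert u U) c (carrier M) =
    lin_combs R M U c (carrier M) <+>\<^bsub>M\<^esub> (\<lambda>x. c u \<odot>\<^bsub>M\<^esub> x) ` carrier M"
proof
  have cU: "c \<in> U \<rightarrow> carrier R" "c u \<in> carrier R" using assms(3) by auto
  note sub = submodule_lin_combs[OF assms(1) cU(1) carrier_is_submodule]
    submodule_scaled[OF cU(2) carrier_is_submodule]
  show "lin_combs R M (insert u U) c (carrier M) \<subseteq>
    lin_combs R M U c (carrier M) <+>\<^bsub>M\<^esub> (\<lambda>x. c u \<odot>\<^bsub>M\<^esub> x) ` carrier M"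
    using set_add_upper1[OF sub] set_add_upper2[OF sub] lin_combs_gen[OF assms(1) cU(1) carrier_is_submodule]
    by (intro lin_combs_least submodule_set_add sub) blast
  have "submodule (lin_combs R M (insert u U) c (carrier M)) R M"
    using assms by (intro submodule_lin_combs carrier_is_submodule) auto
  then show "lin_combs R M U c (carrier M) <+>\<^bsub>M\<^esub> (\<lambda>x. c u \<odot>\<^bsub>M\<^esub> x) ` carrier M \<subseteq>
    lin_combs R M (insert u U) c (carrier M)"
    using assms lin_combs_gen[of "insert u U" c "carrier M" u] carrier_is_submodule
    by (intro set_add_least lin_combs_mono) auto
qed

definition (in module) independent_mod ::
    "'c set \<Rightarrow> 'c set \<Rightarrow> 'i set \<Rightarrow> ('i \<Rightarrow> 'a) \<Rightarrow> bool"
  where "independent_mod N B U c \<longleftrightarrow>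
    (\<forall>F \<in> U \<rightarrow> carrier M. (\<Oplus>\<^bsub>M\<^esub>u\<in>U. c u \<odot>\<^bsub>M\<^esub> F u) \<in> B \<longrightarrow> F \<in> U \<rightarrow> N)"

lemma (in module) independent_modD:
  assumes "independent_mod N B U c" "F \<in> U \<rightarrow> carrier M" "(\<Oplus>\<^bsub>M\<^esub>u\<in>U. c u \<odot>\<^bsub>M\<^esub> F u) \<in> B"
  shows "F \<in> U \<rightarrow> N"
  using assms unfolding independent_mod_def by blast

lemma (in module) independent_mod_insert:
  assumes U: "finite U" "u \<notin> U" "c \<in> insert u U \<rightarrow> carrier R"
    and N: "submodule N R M" and B: "submodule B R M"
    and NB: "\<And>v x. v \<in> insert u U \<Longrightarrow> x \<in> N \<Longrightarrow> c v \<odot>\<^bsub>M\<^esub> x \<in> B"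
  shows "independent_mod N B (insert u U) c \<longleftrightarrow> independent_mod N B U c \<and>
    module_colon M (B <+>\<^bsub>M\<^esub> lin_combs R M U c (carrier M)) (c u) \<subseteq> N" (is "?L \<longleftrightarrow> ?R1 \<and> ?C \<subseteq> N")
proof (intro iffI conjI)
  have c: "c \<in> U \<rightarrow> carrier R" "c u \<in> carrier R" using U(3) by auto
  have sU: "submodule (lin_combs R M U c (carrier M)) R M"
    by (intro submodule_lin_combs U(1) c(1) carrier_is_submodule)
  have sum_insert: "(\<Oplus>\<^bsub>M\<^esub>v\<in>insert u U. c v \<odot>\<^bsub>M\<^esub> F v) =
      c u \<odot>\<^bsub>M\<^esub> F u \<oplus>\<^bsub>M\<^esub> (\<Oplus>\<^bsub>M\<^esub>v\<in>U. c v \<odot>\<^bsub>M\<^esub> F v)" if "F \<in> insert u U \<rightarrow> carrier M" for F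
    using that U c by (intro M.finsum_insert) (auto simp: Pi_iff)
  {
    assume L: ?L
    show ?R1
      unfolding independent_mod_def
    proof (intro ballI impI Pi_I)
      fix F v assume F: "F \<in> U \<rightarrow> carrier M" "(\<Oplus>\<^bsub>M\<^esub>v\<in>U. c v \<odot>\<^bsub>M\<^esub> F v) \<in> B" and v: "v \<in> U"
      let ?F = "\<lambda>v. if v \<in> U then F v else \<zero>\<^bsub>M\<^esub>"
      have "?F \<in> insert u U \<rightarrow> carrier M" using F by auto
      moreover have "(\<Oplus>\<^bsub>M\<^esub>v\<in>insert u U. c v \<odot>\<^bsub>M\<^esub> ?F v) \<in> B"
        using finsum_extend[of "insert u U" U c F, OF _ subset_insertI] F U by simp
      ultimately have "?F \<in> insert u U \<rightarrow> N" by (rule independent_modD[OF L])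
      then show "F v \<in> N" using v by (auto simp: Pi_iff split: if_splits)
    qed
    show "?C \<subseteq> N"
    proof
      fix y assume y: "y \<in> ?C"
      then have yc: "y \<in> carrier M" by (simp add: module_colon_def)
      from y obtain b s where bs: "b \<in> B" "s \<in> lin_combs R M U c (carrier M)" "c u \<odot>\<^bsub>M\<^esub> y = b \<oplus>\<^bsub>M\<^esub> s"
        by (auto simp: module_colon_def mem_set_add)
      have car: "b \<in> carrier M" "s \<in> carrier M"
        using bs submodule_carrier[OF B] submodule_carrier[OF sU] by auto
      obtain F where F: "F \<in> U \<rightarrow> carrier M" "\<ominus>\<^bsub>M\<^esub> s = (\<Oplus>\<^bsub>M\<^esub>v\<in>U. c v \<odot>\<^bsub>M\<^esub> F v)"
        using submoduleE(3)[OF sU bs(2)] by (rule lin_combsE)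
      \<comment> \<open>Coefficient y at u and the coefficients of -s elsewhere: the combination has
        the value b in B.\<close>
      let ?F = "\<lambda>v. if v = u then y else F v"
      have F': "?F \<in> insert u U \<rightarrow> carrier M" using F yc by auto
      have "(\<Oplus>\<^bsub>M\<^esub>v\<in>U. c v \<odot>\<^bsub>M\<^esub> ?F v) = (\<Oplus>\<^bsub>M\<^esub>v\<in>U. c v \<odot>\<^bsub>M\<^esub> F v)"
        using F U c by (intro M.finsum_cong') (auto simp: Pi_iff)
      then have "(\<Oplus>\<^bsub>M\<^esub>v\<in>insert u U. c v \<odot>\<^bsub>M\<^esub> ?F v) = c u \<odot>\<^bsub>M\<^esub> y \<oplus>\<^bsub>M\<^esub> \<ominus>\<^bsub>M\<^esub> s"
        using sum_insert[OF F'] F by simp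
      also have "\<dots> = b" using bs car by (simp add: M.a_assoc M.r_neg)
      finally have "(\<Oplus>\<^bsub>M\<^esub>v\<in>insert u U. c v \<odot>\<^bsub>M\<^esub> ?F v) \<in> B" using bs by simp
      then have "?F \<in> insert u U \<rightarrow> N" by (rule independent_modD[OF L F'])
      then show "y \<in> N" by auto
    qed
  }
  assume R: "?R1 \<and> ?C \<subseteq> N"
  show ?L
    unfolding independent_mod_def
  proof (intro ballI impI)
    fix F assume F: "F \<in> insert u U \<rightarrow> carrier M" "(\<Oplus>\<^bsub>M\<^esub>v\<in>insert u U. c v \<odot>\<^bsub>M\<^esub> F v) \<in> B"
    let ?s = "\<Oplus>\<^bsub>M\<^esub>v\<in>U. c v \<odot>\<^bsub>M\<^esub> F v"
    have FU: "F \<in> U \<rightarrow> carrier M" and Fu: "F u \<in> carrier M" using F by auto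
    have s: "?s \<in> lin_combs R M U c (carrier M)" using FU by (rule lin_combsI)
    then have sc: "?s \<in> carrier M" by (rule submodule_carrier[OF sU])
    note W = submodule_set_add[OF B sU]
    have eq: "c u \<odot>\<^bsub>M\<^esub> F u \<oplus>\<^bsub>M\<^esub> ?s \<in> B" using F sum_insert by simp
    then have "c u \<odot>\<^bsub>M\<^esub> F u \<oplus>\<^bsub>M\<^esub> ?s \<in> B <+>\<^bsub>M\<^esub> lin_combs R M U c (carrier M)"
      "?s \<in> B <+>\<^bsub>M\<^esub> lin_combs R M U c (carrier M)"
      using s set_add_upper1[OF B sU] set_add_upper2[OF B sU] by auto
    then have "F u \<in> ?C"
      using submodule_add_cancel[OF W, of "c u \<odot>\<^bsub>M\<^esub> F u" ?s] Fu c by (simp add: module_colon_def)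
    then have FuN: "F u \<in> N" using R by blast
    then have "c u \<odot>\<^bsub>M\<^esub> F u \<in> B" using NB by blast
    then have "?s \<in> B" using submodule_add_cancel[OF B sc, of "c u \<odot>\<^bsub>M\<^esub> F u"] eq Fu c sc by (simp add: M.a_comm)
    then have "F \<in> U \<rightarrow> N" using R FU unfolding independent_mod_def by blast
    then show "F \<in> insert u U \<rightarrow> N" using FuN by auto
  qed
qed

text \<open>Adding one generator contributes a factor M/C, where C is the colon module of
  \<open>independent_mod_insert\<close>. As N is contained in C, the factor has length at most l,
  with equality exactly for C = N. Since l is finite, the total reaches its bound only if every step
  does.\<close>

lemma (in module) chain_length_lin_combs:
  assumes "finite U" "c \<in> U \<rightarrow> carrier R"
    and N: "submodule N R M" and B: "submodule B R M"
    and NB: "\<And>u x. u \<in> U \<Longrightarrow> x \<in> N \<Longrightarrow> c u \<odot>\<^bsub>M\<^esub> x \<in> B"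
    and fin: "chain_length (between N (carrier M)) = enat l"
  shows "\<exists>k \<le> card U * l. chain_length (between B (B <+>\<^bsub>M\<^esub> lin_combs R M U c (carrier M))) = enat k \<and>
    (k = card U * l \<longleftrightarrow> independent_mod N B U c)"
  using assms(1,2) NB
proof (induction U)
  case empty
  have "lin_combs R M {} c (carrier M) = {\<zero>\<^bsub>M\<^esub>}" by (auto simp: lin_combs_def)
  moreover have "B <+>\<^bsub>M\<^esub> {\<zero>\<^bsub>M\<^esub>} = B"
    using set_add_upper1[OF B zero_submodule] set_add_least[OF B, of B "{\<zero>\<^bsub>M\<^esub>}"] submodule_zero[OF B] by auto
  ultimately show ?case
    using between_refl[OF B] chain_length_singleton by (simp add: zero_enat_def independent_mod_def)
next
  case (insert u U)
  have c: "c \<in> U \<rightarrow> carrier R" "c u \<in> carrier R" using insert.prems by auto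
  let ?UM = "lin_combs R M U c (carrier M)" and ?uM = "(\<lambda>x. c u \<odot>\<^bsub>M\<^esub> x) ` carrier M"
  let ?W = "B <+>\<^bsub>M\<^esub> ?UM"
  let ?C = "module_colon M ?W (c u)"
  have sU: "submodule ?UM R M" by (intro submodule_lin_combs insert.hyps c(1) carrier_is_submodule)
  have W: "submodule ?W R M" by (rule submodule_set_add[OF B sU])
  have su: "submodule ?uM R M" by (rule submodule_scaled[OF c(2) carrier_is_submodule])
  have C: "submodule ?C R M" by (rule submodule_colon[OF W c(2)])
  have CM: "?C \<subseteq> carrier M" by (auto simp: module_colon_def)
  have NC: "N \<subseteq> ?C"
    using insert.prems(2)[of u] set_add_upper1[OF B sU] submodule_carrier[OF N] by (auto simp: module_colon_def)
  have assoc: "B <+>\<^bsub>M\<^esub> lin_combs R M (insert u U) c (carrier M) = ?W <+>\<^bsub>M\<^esub> ?uM"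
  proof
    note WuM = submodule_set_add[OF W su]
    have iM: "submodule (?UM <+>\<^bsub>M\<^esub> ?uM) R M" by (rule submodule_set_add[OF sU su])
    note BiM = submodule_set_add[OF B iM]
    have eq: "lin_combs R M (insert u U) c (carrier M) = ?UM <+>\<^bsub>M\<^esub> ?uM"
      by (rule lin_combs_insert[OF insert.hyps insert.prems(1)])
    note up = set_add_upper1[OF B sU] set_add_upper2[OF B sU] set_add_upper1[OF W su] set_add_upper2[OF W su]
      set_add_upper1[OF sU su] set_add_upper2[OF sU su] set_add_upper1[OF B iM] set_add_upper2[OF B iM]
    show "B <+>\<^bsub>M\<^esub> lin_combs R M (insert u U) c (carrier M) \<subseteq> ?W <+>\<^bsub>M\<^esub> ?uM"
      unfolding eq by (intro set_add_least WuM order_trans[OF up(1) up(3)] order_trans[OF up(2) up(3)] up(4))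
    show "?W <+>\<^bsub>M\<^esub> ?uM \<subseteq> B <+>\<^bsub>M\<^esub> lin_combs R M (insert u U) c (carrier M)"
      unfolding eq by (intro set_add_least BiM up(7) order_trans[OF up(5) up(8)] order_trans[OF up(6) up(8)])
  qed
  have add1: "chain_length (between B (?W <+>\<^bsub>M\<^esub> ?uM)) =
      chain_length (between B ?W) + chain_length (between ?C (carrier M))"
    unfolding chain_length_scaled[OF W c(2), symmetric]
    by (intro chain_length_between_add B W submodule_set_add[OF W su] set_add_upper1[OF B sU] set_add_upper1[OF W su])
  \<comment> \<open>Splits l into g = l(C/N), the loss at this step, and y = l(M/C), its
    contribution; finiteness of l makes both natural numbers.\<close>
  have add2: "enat l = chain_length (between N ?C) + chain_length (between ?C (carrier M))"
    unfolding fin[symmetric] by (intro chain_length_between_add N C carrier_is_submodule NC CM)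
  then obtain g y where gy: "chain_length (between N ?C) = enat g" "chain_length (between ?C (carrier M)) = enat y"
    by (metis enat.distinct(2) not_enat_eq plus_enat_simps(2) plus_enat_simps(3))
  have l: "l = g + y" using add2 gy by simp
  have g: "g = 0 \<longleftrightarrow> ?C \<subseteq> N"
  proof
    assume "g = 0"
    then show "?C \<subseteq> N" using chain_length_between_pos[OF N C] NC gy(1) by (force simp: one_enat_def)
  next
    assume "?C \<subseteq> N"
    then have "?C = N" using NC by blast
    then have "enat g = 0" using gy(1) between_refl[OF N] chain_length_singleton by metis
    then show "g = 0" by (simp add: zero_enat_def)
  qed
  obtain k where k: "k \<le> card U * l" "chain_length (between B ?W) = enat k"
    "k = card U * l \<longleftrightarrow> independent_mod N B U c"
    using insert.IH[OF c(1)] insert.prems(2) by blast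
  have ins: "independent_mod N B (insert u U) c \<longleftrightarrow> independent_mod N B U c \<and> ?C \<subseteq> N"
    by (rule independent_mod_insert[OF insert.hyps insert.prems(1) N B insert.prems(2)])
  show ?case
  proof (intro exI conjI)
    show "k + y \<le> card (insert u U) * l" using k(1) l insert.hyps by simp
    show "chain_length (between B (B <+>\<^bsub>M\<^esub> lin_combs R M (insert u U) c (carrier M))) = enat (k + y)"
      unfolding assoc add1 k(2) gy(2) by simp
    have "k + y = card (insert u U) * l \<longleftrightarrow> k = card U * l \<and> g = 0"
      using k(1) l insert.hyps by simp linarith
    then show "k + y = card (insert u U) * l \<longleftrightarrow> independent_mod N B (insert u U) c"
      using ins k(3) g by simp
  qed
qed

section \<open>The conditions of the theorem in terms of relations\<close>

context module_sequence
begin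

text \<open>A value in q^n N is also the value of a form with coefficients in N. Subtracting that
  form gives a true relation, without changing the coefficients modulo N.\<close>

lemma independent_mod_forms:
  assumes N: "submodule N R M" and U: "finite U"
  shows "independent_mod N (lin_combs R M U (monom_val R r a) N) U (monom_val R r a) \<longleftrightarrow> relations_in N U"
proof
  note sub = submodule_lin_combs[OF U monom_val_fun N]
  assume "independent_mod N (lin_combs R M U (monom_val R r a) N) U (monom_val R r a)"
  then show "relations_in N U"
    unfolding independent_mod_def relations_in_def using submodule_zero[OF sub] by auto
next
  assume rel: "relations_in N U"
  show "independent_mod N (lin_combs R M U (monom_val R r a) N) U (monom_val R r a)"
    unfolding independent_mod_def
  proof (intro ballI impI Pi_I)
    fix F u assume F: "F \<in> U \<rightarrow> carrier M" and u: "u \<in> U"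
      and val: "(\<Oplus>\<^bsub>M\<^esub>u\<in>U. monom_val R r a u \<odot>\<^bsub>M\<^esub> F u) \<in> lin_combs R M U (monom_val R r a) N"
    from val obtain G where G: "G \<in> U \<rightarrow> N"
      "(\<Oplus>\<^bsub>M\<^esub>u\<in>U. monom_val R r a u \<odot>\<^bsub>M\<^esub> F u) = (\<Oplus>\<^bsub>M\<^esub>u\<in>U. monom_val R r a u \<odot>\<^bsub>M\<^esub> G u)"
      by (rule lin_combsE)
    have Gc: "G \<in> U \<rightarrow> carrier M" using G submodule_carrier[OF N] by auto
    have "(\<Oplus>\<^bsub>M\<^esub>u\<in>U. monom_val R r a u \<odot>\<^bsub>M\<^esub> G u) \<in> carrier M"
      using Gc R.monom_val_closed[OF a] by (intro M.finsum_closed) (auto simp: Pi_iff)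
    then have "(\<Oplus>\<^bsub>M\<^esub>u\<in>U. monom_val R r a u \<odot>\<^bsub>M\<^esub> (F u \<ominus>\<^bsub>M\<^esub> G u)) = \<zero>\<^bsub>M\<^esub>"
      using finsum_smult_diff[OF U monom_val_fun F Gc] G(2) by (simp add: a_minus_def M.r_neg)
    moreover have "(\<lambda>u. F u \<ominus>\<^bsub>M\<^esub> G u) \<in> U \<rightarrow> carrier M" using F Gc by (auto simp: Pi_iff)
    ultimately have "F u \<ominus>\<^bsub>M\<^esub> G u \<in> N" using relations_inD[OF rel, of "\<lambda>u. F u \<ominus>\<^bsub>M\<^esub> G u" u] u by blast
    moreover have "F u \<in> carrier M" "G u \<in> N" using F G u by auto
    ultimately show "F u \<in> N"
      using submodule_add_cancel[OF N, of "F u" "\<ominus>\<^bsub>M\<^esub> G u"] submoduleE(3)[OF N] by (simp add: a_minus_def)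
  qed
qed

text \<open>The binomial is the number of monomials of degree n, that is, of steps of the
  filtration; equality says that no step loses length. This equivalence holds for each n
  separately.\<close>

lemma length_condition_iff:
  assumes N: "submodule N R M" and r: "1 \<le> r"
  shows "length_condition R M N r a n \<longleftrightarrow>
    module_length R (FactModule M N) < \<infinity> \<and> relations_in N (exps r n)"
proof -
  let ?U = "exps r n" and ?mv = "monom_val R r a"
  let ?B = "lin_combs R M ?U ?mv N" and ?UM = "lin_combs R M ?U ?mv (carrier M)"
  have B: "submodule ?B R M" by (intro submodule_lin_combs finite_exps monom_val_fun N)
  have UM: "submodule ?UM R M" by (intro submodule_lin_combs finite_exps monom_val_fun carrier_is_submodule)
  have gen: "?mv u \<odot>\<^bsub>M\<^esub> x \<in> ?B" if "u \<in> ?U" "x \<in> N" for u x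
    using that by (intro lin_combs_gen finite_exps monom_val_fun N)
  have BU: "?B \<subseteq> ?UM"
    using submodule_carrier[OF N]
    by (intro lin_combs_least[OF UM] lin_combs_gen finite_exps monom_val_fun carrier_is_submodule) auto
  then have "?B <+>\<^bsub>M\<^esub> ?UM = ?UM"
    using set_add_upper2[OF B UM] set_add_least[OF UM, of ?B ?UM] by blast
  then have count: "\<exists>k \<le> card ?U * l. chain_length (between ?B ?UM) = enat k \<and>
      (k = card ?U * l \<longleftrightarrow> relations_in N ?U)"
    if "chain_length (between N (carrier M)) = enat l" for l
    using chain_length_lin_combs[of ?U ?mv N ?B l] that gen finite_exps monom_val_fun N B
      independent_mod_forms[OF N finite_exps, of r n] by simp
  \<comment> \<open>Excludes 0 * \<infinity> = 0 in \<open>enat\<close>: with a positive factor the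
    product is infinite as soon as l(M/N) is, so its finiteness means that of l(M/N).\<close>
  have pos: "0 < (n + r - 1) choose (r - 1)" using r by (intro zero_less_binomial) auto
  have len: "length_condition R M N r a n \<longleftrightarrow>
    chain_length (between ?B ?UM) = enat ((n + r - 1) choose (r - 1)) * chain_length (between N (carrier M)) \<and>
    enat ((n + r - 1) choose (r - 1)) * chain_length (between N (carrier M)) < \<infinity>"
    unfolding length_condition_def Let_def ideal_smult_power[OF a N] ideal_smult_power[OF a carrier_is_submodule]
      module_length_FactModule[OF N] module_length_SubFactModule[OF UM B BU] ..
  show ?thesis
  proof (cases "chain_length (between N (carrier M))")
    case (enat l)
    then obtain k where "chain_length (between ?B ?UM) = enat k"
      "k = ((n + r - 1) choose (r - 1)) * l \<longleftrightarrow> relations_in N ?U"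
      using count unfolding card_exps[OF r] by blast
    then show ?thesis unfolding len module_length_FactModule[OF N] using enat by simp
  next
    case infinity
    then show ?thesis unfolding len module_length_FactModule[OF N] using pos
      by (simp add: imult_infinity_right zero_enat_def)
  qed
qed

lemma independent_for_iff:
  assumes N: "submodule N R M"
  shows "independent_for R M N r a \<longleftrightarrow> (\<forall>d. relations_in N (exps r d))"
proof
  assume ind: "independent_for R M N r a"
  show "\<forall>d. relations_in N (exps r d)"
    unfolding relations_in_def
  proof (intro allI ballI impI Pi_I)
    fix d F u assume F: "F \<in> exps r d \<rightarrow> carrier M" and u: "u \<in> exps r d"
      and eq: "(\<Oplus>\<^bsub>M\<^esub>u\<in>exps r d. monom_val R r a u \<odot>\<^bsub>M\<^esub> F u) = \<zero>\<^bsub>M\<^esub>"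
    define G where "G u = (if u \<in> exps r d then F u else \<zero>\<^bsub>M\<^esub>)" for u
    have supp: "{u. G u \<noteq> \<zero>\<^bsub>M\<^esub>} \<subseteq> exps r d" by (auto simp: G_def)
    have Gc: "G u \<in> carrier M" for u using F by (auto simp: G_def)
    have "G \<in> module_forms M r"
      unfolding module_forms_def module_polys_def
    proof (intro CollectI conjI exI[of _ d])
      show "finite {u. G u \<noteq> \<zero>\<^bsub>M\<^esub>}" by (rule finite_subset[OF supp finite_exps])
    qed (use supp Gc in \<open>auto simp: exps_def\<close>)
    moreover have "module_poly_eval R M r a G = \<zero>\<^bsub>M\<^esub>"
    proof -
      have "module_poly_eval R M r a G = (\<Oplus>\<^bsub>M\<^esub>u\<in>exps r d. monom_val R r a u \<odot>\<^bsub>M\<^esub> G u)"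
        unfolding module_poly_eval_def monom_val_def[symmetric]
        using supp Gc R.monom_val_closed[OF a]
        by (intro M.add.finprod_mono_neutral_cong_left finite_exps) auto
      also have "\<dots> = (\<Oplus>\<^bsub>M\<^esub>u\<in>exps r d. monom_val R r a u \<odot>\<^bsub>M\<^esub> F u)"
        using F R.monom_val_closed[OF a] by (intro M.finsum_cong') (auto simp: G_def Pi_iff)
      finally show ?thesis using eq by simp
    qed
    ultimately have "G u \<in> N" using ind unfolding independent_for_def by blast
    then show "F u \<in> N" using u by (simp add: G_def)
  qed
next
  assume rel: "\<forall>d. relations_in N (exps r d)"
  show "independent_for R M N r a"
    unfolding independent_for_def
  proof (intro ballI impI allI)
    fix F u assume F: "F \<in> module_forms M r" and eq: "module_poly_eval R M r a F = \<zero>\<^bsub>M\<^esub>"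
    then obtain d where d: "\<And>u. F u \<noteq> \<zero>\<^bsub>M\<^esub> \<Longrightarrow> (\<Sum>i=1..r. Poly_Mapping.lookup u i) = d"
      unfolding module_forms_def by blast
    have Fc: "F u \<in> carrier M" for u using F by (auto simp: module_forms_def module_polys_def)
    have supp: "{u. F u \<noteq> \<zero>\<^bsub>M\<^esub>} \<subseteq> exps r d"
      using F d by (auto simp: module_forms_def module_polys_def exps_def)
    have "module_poly_eval R M r a F = (\<Oplus>\<^bsub>M\<^esub>u\<in>exps r d. monom_val R r a u \<odot>\<^bsub>M\<^esub> F u)"
      unfolding module_poly_eval_def monom_val_def[symmetric]
      using supp Fc R.monom_val_closed[OF a]
      by (intro M.add.finprod_mono_neutral_cong_left finite_exps) auto
    then have "F u \<in> N" if "u \<in> exps r d"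
      using relations_inD[of N "exps r d" F u] rel eq that Fc by auto
    then show "F u \<in> N" using supp submodule_zero[OF N] by (cases "F u = \<zero>\<^bsub>M\<^esub>") auto
  qed
qed

text \<open>In a linear relation a_i y_i is minus a combination of the other a_k, so y_i is an
  element of a colon module, and every element of that module arises in this way. Only the index
  omitted from the ideal matters; one direction therefore needs just transpositions.\<close>

lemma colon_condition_iff:
  assumes N: "submodule N R M" and r: "1 \<le> r"
  shows "colon_condition R M N r a \<longleftrightarrow> relations_in N (exps r 1)"
proof -
  have seq: "a \<circ> \<sigma> \<in> {1..r - 1} \<rightarrow> carrier R" if "\<sigma> permutes {1..r}" for \<sigma>
    using a permutes_in_image[OF that] by (auto simp: Pi_iff)
  have ideal_eq: "ideal_smult R M (seq_ideal R (a \<circ> \<sigma>) (r - 1)) (carrier M) =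
      lin_combs R M {1..r - 1} (a \<circ> \<sigma>) (carrier M)" if "\<sigma> permutes {1..r}" for \<sigma>
    by (rule ideal_smult_seq_ideal[OF seq[OF that] carrier_is_submodule])
  have ins: "{1..r} = insert r {1..r - 1}" and notin: "r \<notin> {1..r - 1}" using r by auto
  show ?thesis
  proof
    assume colon: "colon_condition R M N r a"
    show "relations_in N (exps r 1)"
      unfolding relations_in_1_iff
    proof (intro ballI impI Pi_I)
      fix y i assume y: "y \<in> {1..r} \<rightarrow> carrier M" and i: "i \<in> {1..r}"
        and eq: "(\<Oplus>\<^bsub>M\<^esub>i\<in>{1..r}. a i \<odot>\<^bsub>M\<^esub> y i) = \<zero>\<^bsub>M\<^esub>"
      \<comment> \<open>The transposition moves a_i to the last place, so the first r - 1 entries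
        are the a_k with k different from i.\<close>
      define \<sigma> where "\<sigma> = transpose i r"
      have perm: "\<sigma> permutes {1..r}" unfolding \<sigma>_def using i r by (intro permutes_swap_id) auto
      let ?S = "lin_combs R M {1..r - 1} (a \<circ> \<sigma>) (carrier M)"
      have S: "submodule ?S R M" by (intro submodule_lin_combs seq[OF perm] carrier_is_submodule) simp
      have mem: "a k \<odot>\<^bsub>M\<^esub> y k \<in> ?S" if k: "k \<in> {1..r} - {i}" for k
      proof -
        have "\<sigma> k \<in> {1..r}" using k permutes_in_image[OF perm] by blast
        moreover have "\<sigma> k \<noteq> r" using k by (auto simp: \<sigma>_def transpose_def split: if_splits)
        ultimately have "\<sigma> k \<in> {1..r - 1}" using ins by blast
        then have "(a \<circ> \<sigma>) (\<sigma> k) \<odot>\<^bsub>M\<^esub> y k \<in> ?S"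
          using y k by (intro lin_combs_gen seq[OF perm] carrier_is_submodule) auto
        then show ?thesis by (simp add: \<sigma>_def)
      qed
      have c: "a i \<odot>\<^bsub>M\<^esub> y i \<in> carrier M" using a y i by (auto simp: Pi_iff)
      have "(\<Oplus>\<^bsub>M\<^esub>k\<in>insert i ({1..r} - {i}). a k \<odot>\<^bsub>M\<^esub> y k) =
          a i \<odot>\<^bsub>M\<^esub> y i \<oplus>\<^bsub>M\<^esub> (\<Oplus>\<^bsub>M\<^esub>k\<in>{1..r} - {i}. a k \<odot>\<^bsub>M\<^esub> y k)"
        using a y i by (intro M.finsum_insert) (auto simp: Pi_iff)
      then have "a i \<odot>\<^bsub>M\<^esub> y i \<oplus>\<^bsub>M\<^esub> (\<Oplus>\<^bsub>M\<^esub>k\<in>{1..r} - {i}. a k \<odot>\<^bsub>M\<^esub> y k) \<in> ?S"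
        using eq i submodule_zero[OF S] by (simp add: insert_absorb)
      moreover have "(\<Oplus>\<^bsub>M\<^esub>k\<in>{1..r} - {i}. a k \<odot>\<^bsub>M\<^esub> y k) \<in> ?S"
        using mem by (intro submodule_finsum[OF S]) auto
      ultimately have "a i \<odot>\<^bsub>M\<^esub> y i \<in> ?S" using submodule_add_cancel[OF S c] by blast
      then have "y i \<in> module_colon M ?S (a (\<sigma> r))"
        using y i by (auto simp: module_colon_def \<sigma>_def)
      then show "y i \<in> N" using colon perm unfolding colon_condition_def ideal_eq[OF perm, symmetric] by blast
    qed
  next
    assume rel: "relations_in N (exps r 1)"
    show "colon_condition R M N r a"
      unfolding colon_condition_def
    proof (intro allI impI subsetI)
      fix \<sigma> x assume perm: "\<sigma> permutes {1..r}"
        and "x \<in> module_colon M (ideal_smult R M (seq_ideal R (a \<circ> \<sigma>) (r - 1)) (carrier M)) (a (\<sigma> r))"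
      then have x: "x \<in> carrier M" "a (\<sigma> r) \<odot>\<^bsub>M\<^esub> x \<in> lin_combs R M {1..r - 1} (a \<circ> \<sigma>) (carrier M)"
        unfolding ideal_eq[OF perm] by (auto simp: module_colon_def)
      let ?S = "lin_combs R M {1..r - 1} (a \<circ> \<sigma>) (carrier M)"
      have S: "submodule ?S R M" by (intro submodule_lin_combs seq[OF perm] carrier_is_submodule) simp
      \<comment> \<open>Representing the negative of a_(\<sigma> r) x absorbs the sign: x at place r
        together with y forms a relation in the permuted order, and w below undoes the
        permutation.\<close>
      obtain y where y: "y \<in> {1..r - 1} \<rightarrow> carrier M"
        "\<ominus>\<^bsub>M\<^esub> (a (\<sigma> r) \<odot>\<^bsub>M\<^esub> x) = (\<Oplus>\<^bsub>M\<^esub>k\<in>{1..r - 1}. (a \<circ> \<sigma>) k \<odot>\<^bsub>M\<^esub> y k)"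
        using submoduleE(3)[OF S x(2)] by (rule lin_combsE)
      define z where "z k = (if k = r then x else y k)" for k
      define w where "w i = z (inv_into UNIV \<sigma> i)" for i
      have z: "z \<in> {1..r} \<rightarrow> carrier M" using y x ins by (auto simp: z_def)
      have \<sigma>r: "\<sigma> k \<in> {1..r}" if "k \<in> {1..r}" for k using that permutes_in_image[OF perm] by blast
      have ac: "a (\<sigma> k) \<in> carrier R" if "k \<in> {1..r}" for k using \<sigma>r[OF that] a by blast
      have w\<sigma>: "w (\<sigma> k) = z k" for k by (simp add: w_def permutes_inverses(2)[OF perm])
      have w: "w \<in> {1..r} \<rightarrow> carrier M"
        using z permutes_in_image[OF permutes_inv[OF perm]] by (auto simp: w_def Pi_iff)
      have "(\<Oplus>\<^bsub>M\<^esub>i\<in>{1..r}. a i \<odot>\<^bsub>M\<^esub> w i) = (\<Oplus>\<^bsub>M\<^esub>i\<in>\<sigma> ` {1..r}. a i \<odot>\<^bsub>M\<^esub> w i)"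
        by (simp only: permutes_image[OF perm])
      also have "\<dots> = (\<Oplus>\<^bsub>M\<^esub>k\<in>{1..r}. a (\<sigma> k) \<odot>\<^bsub>M\<^esub> w (\<sigma> k))"
      proof (rule M.finsum_reindex)
        show "(\<lambda>i. a i \<odot>\<^bsub>M\<^esub> w i) \<in> \<sigma> ` {1..r} \<rightarrow> carrier M"
          unfolding permutes_image[OF perm] using a w by (auto simp: Pi_iff)
      qed (rule permutes_inj_on[OF perm])
      also have "\<dots> = (\<Oplus>\<^bsub>M\<^esub>k\<in>insert r {1..r - 1}. a (\<sigma> k) \<odot>\<^bsub>M\<^esub> z k)"
        by (simp only: w\<sigma> ins[symmetric])
      also have "\<dots> = a (\<sigma> r) \<odot>\<^bsub>M\<^esub> z r \<oplus>\<^bsub>M\<^esub> (\<Oplus>\<^bsub>M\<^esub>k\<in>{1..r - 1}. a (\<sigma> k) \<odot>\<^bsub>M\<^esub> z k)"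
        using notin ac z ins by (intro M.finsum_insert) (auto simp: Pi_iff)
      also have "(\<Oplus>\<^bsub>M\<^esub>k\<in>{1..r - 1}. a (\<sigma> k) \<odot>\<^bsub>M\<^esub> z k) = (\<Oplus>\<^bsub>M\<^esub>k\<in>{1..r - 1}. (a \<circ> \<sigma>) k \<odot>\<^bsub>M\<^esub> y k)"
        using ac y ins notin by (intro M.finsum_cong') (auto simp: z_def Pi_iff)
      also have "\<dots> = \<ominus>\<^bsub>M\<^esub> (a (\<sigma> r) \<odot>\<^bsub>M\<^esub> x)" by (rule y(2)[symmetric])
      finally have "(\<Oplus>\<^bsub>M\<^esub>i\<in>{1..r}. a i \<odot>\<^bsub>M\<^esub> w i) = \<zero>\<^bsub>M\<^esub>"
        using ac[of r] r x by (simp add: z_def M.r_neg)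
      then have "w \<in> {1..r} \<rightarrow> N" using rel w unfolding relations_in_1_iff by blast
      then have "w (\<sigma> r) \<in> N" using \<sigma>r r by auto
      then show "x \<in> N" by (simp add: w\<sigma> z_def)
    qed
  qed
qed

text \<open>The linear relation with coefficients \<open>a\<^sub>i y\<close> and \<open>- a\<^sub>j y\<close> at \<open>X\<^sub>j\<close> and \<open>X\<^sub>i\<close>.\<close>

lemma ideal_smult_subset_of_relations:
  assumes N: "submodule N R M" and r: "2 \<le> r" and rel: "relations_in N (exps r 1)"
  shows "ideal_smult R M (seq_ideal R a r) (carrier M) \<subseteq> N"
  unfolding ideal_smult_seq_ideal[OF a carrier_is_submodule]
proof (rule lin_combs_least[OF N])
  fix i y assume i: "i \<in> {1..r}" and y: "y \<in> carrier M"
  obtain j where j: "j \<in> {1..r}" "j \<noteq> i" using r by (cases "i = 1") (auto intro: that[of 1] that[of 2])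
  have ac: "a i \<in> carrier R" "a j \<in> carrier R" using a i j by auto
  define w where "w k = (if k = j then a i \<odot>\<^bsub>M\<^esub> y else if k = i then \<ominus>\<^bsub>M\<^esub> (a j \<odot>\<^bsub>M\<^esub> y) else \<zero>\<^bsub>M\<^esub>)" for k
  have w: "w \<in> {1..r} \<rightarrow> carrier M" using ac y by (auto simp: w_def)
  have "(\<Oplus>\<^bsub>M\<^esub>k\<in>{1..r}. a k \<odot>\<^bsub>M\<^esub> w k) = (\<Oplus>\<^bsub>M\<^esub>k\<in>{i, j}. a k \<odot>\<^bsub>M\<^esub> w k)"
    using a i j w by (intro M.add.finprod_mono_neutral_cong_right) (auto simp: w_def Pi_iff)
  also have "\<dots> = a i \<odot>\<^bsub>M\<^esub> w i \<oplus>\<^bsub>M\<^esub> a j \<odot>\<^bsub>M\<^esub> w j"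
    using j ac y by (simp add: w_def M.finsum_insert Pi_iff)
  also have "\<dots> = \<zero>\<^bsub>M\<^esub>"
    using j ac y by (simp add: w_def smult_r_minus smult_assoc1[symmetric] R.m_comm M.l_neg)
  finally have "w \<in> {1..r} \<rightarrow> N" using rel w unfolding relations_in_1_iff by blast
  then have "w j \<in> N" using j by blast
  then show "a i \<odot>\<^bsub>M\<^esub> y \<in> N" by (simp add: w_def)
qed

end

theorem corollary3p4:
  fixes A :: "('a, 'c) ring_scheme" and M :: "('a, 'b, 'd) module_scheme"
    and m :: "'a set" and N :: "'b set" and r :: nat and a :: "nat \<Rightarrow> 'a"
  assumes "noetherian_local_ring A m"
    and "fin_gen_module A M"
    and "submodule N A M" and "N \<noteq> carrier M"
    and "1 \<le> r" and "a \<in> {1..r} \<rightarrow> m"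
    and "absolutely_superficial A M r a"
  shows "(independent_for A M N r a \<longleftrightarrow> colon_condition A M N r a) \<and>
    (system_of_parameters A m M r a \<longrightarrow>
      ((\<exists>n\<ge>1. length_condition A M N r a n) \<longleftrightarrow> (\<forall>n\<ge>1. length_condition A M N r a n)) \<and>
      ((\<exists>n\<ge>1. length_condition A M N r a n) \<longrightarrow> independent_for A M N r a) \<and>
      (2 \<le> r \<or> module_length A (FactModule M N) < \<infinity> \<longrightarrow>
        (independent_for A M N r a \<longleftrightarrow> (\<exists>n\<ge>1. length_condition A M N r a n))))"
proof -
  interpret L: noetherian_local_ring A m by (rule assms(1))
  interpret m: maximalideal m A by (rule L.maximal)
  have mod: "module A M" using assms(2) by (simp add: fin_gen_module_def)
  have a: "a \<in> {1..r} \<rightarrow> carrier A" using assms(6) m.a_Hcarr by (simp add: Pi_iff)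
  interpret module_sequence A M r a
    by (intro module_sequence.intro module_sequence_axioms.intro mod a)
  note N = assms(3) and r = assms(5)
  have noeth: "noetherian_module A M" by (rule noetherian_moduleI[OF L.noetherian_ring_axioms assms(2)])
  have reg: "relative_regular A M r a"
    by (rule absolutely_superficial_imp_relative_regular[OF assms(1) noeth assms(6,7)])
  \<comment> \<open>Down from degree n to 1 by multiplication with X_1, then up to any d by
    regularity. The bound 1 <= n matters, since in degree 0 the only relation is zero.\<close>
  have all: "relations_in N (exps r d)" if "relations_in N (exps r n)" "1 \<le> n" for n d
    by (rule relations_in_all[OF reg N relations_in_shift_le[OF that(1) r that(2)]])
  have ind: "independent_for A M N r a \<longleftrightarrow> relations_in N (exps r 1)"
    unfolding independent_for_iff[OF N] using all[of 1] by blast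
  \<comment> \<open>For r >= 2 linear independence gives qM inside N, so every chain above N is a
    chain above qM, and M/qM has finite length for a system of parameters.\<close>
  have "module_length A (FactModule M N) < \<infinity>"
    if sop: "system_of_parameters A m M r a" and "2 \<le> r" "relations_in N (exps r 1)"
  proof -
    let ?qM = "ideal_smult A M (seq_ideal A a r) (carrier M)"
    have qM: "submodule ?qM A M"
      using a by (intro submodule_ideal_smult) (auto simp: seq_ideal_def intro!: L.genideal_carrier)
    have "between N (carrier M) \<subseteq> between ?qM (carrier M)"
      using ideal_smult_subset_of_relations[OF N that(2,3)] by (auto simp: between_def)
    then have "module_length A (FactModule M N) \<le> module_length A (FactModule M ?qM)"
      unfolding module_length_FactModule[OF N] module_length_FactModule[OF qM] by (rule chain_length_mono)
    also have "\<dots> < \<infinity>" using sop by (simp add: system_of_parameters_def)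
    finally show ?thesis .
  qed
  \<comment> \<open>After unfolding, each condition concerns \<open>relations_in\<close> in some
    degree, joined with finiteness of l(M/N) for the length conditions; \<open>all\<close> links the
    degrees and the previous fact supplies finiteness for r >= 2.\<close>
  then show ?thesis
    unfolding length_condition_iff[OF N r] colon_condition_iff[OF N r] ind
    using all by (metis order_refl)
qed

end
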